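(* Let $a,b,m,n$ be positive integers with $am-bn\in\{-1,1\}$. Let $g$ be a holomorphic function defined near $0\in\mathbb{C}$ and let $f$ be a meromorphic function defined near $0\in\mathbb{C}$ such that the map $(x,y)\mapsto x^a y^b f(x^n y^m)$ is holomorphic near $(0,0)\in\mathbb{C}^2$ with order at least $1$ at the origin. Consider the (commuting) holomorphic vector fields defined on a neighborhood of $(0,0)\in\mathbb{C}^2$ by $$X = x^a y^b\left[ m x \frac{\partial}{\partial x} - n y \frac{\partial}{\partial y}\right],$$ $$Y = g(x^n y^m)\left[ x\left(-bm + x^a y^b f(x^n y^m)\right)\frac{\partial}{\partial x} + y\left(am - \frac{n}{m}x^a y^b f(x^n y^m)\right)\frac{\partial}{\partial y}\right].$$ Let $f_0$ be the constant term in the Laurent series of $f$ around $0$. Assume that one of the following conditions holds: (1) $g(0)\neq 0$; or (2) $g(0)=g''(0)=f_0=0$ and $g'(0)\neq 0$. Then the pair $X,Y$ can be realized by complete vector fields on a Hausdorff open complex surface. That is, there exist an open neighborhood $U$ of $(0,0)$ on which $X$ and $Y$ are defined, a Hausdorff open complex surface $M$, commuting complete holomorphic vector fields $\overline{X},\overline{Y}$ on $M$ (hence generating a global holomorphic action of $\mathbb{C}^2$ on $M$), and a biholomorphism $\psi$ from $U$ onto an open subset of $M$ whose differential sends $X$ to $\overline{X}|_{\psi(U)}$ and $Y$ to $\overline{Y}|_{\psi(U)}$.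
   Context: A complex surface is a complex manifold of complex dimension $2$; "open" means non-compact. A holomorphic vector field is complete if its flow is defined for all complex times, i.e. it generates a global holomorphic action of $(\mathbb{C},+)$. The order of a holomorphic function at the origin is its order of vanishing there. *)

theory Defs
  imports "HOL-Complex_Analysis.Complex_Analysis" "HOL-Library.Extended_Nat"
begin

section \<open>Holomorphic maps between complex vector spaces\<close>

class complex_normed_vector = real_normed_vector +
  fixes cscale :: "complex \<Rightarrow> 'a \<Rightarrow> 'a"  (infixr "*\<^sub>C" 75)
  assumes cscale_add_right: "c *\<^sub>C (x + y) = c *\<^sub>C x + c *\<^sub>C y"
    and cscale_add_left: "(c + d) *\<^sub>C x = c *\<^sub>C x + d *\<^sub>C x"
    and cscale_cscale: "c *\<^sub>C d *\<^sub>C x = (c * d) *\<^sub>C x"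
    and cscale_of_real: "complex_of_real r *\<^sub>C x = r *\<^sub>R x"
    and norm_cscale: "norm (c *\<^sub>C x) = cmod c * norm x"

instantiation complex :: complex_normed_vector
begin

definition cscale_complex :: "complex \<Rightarrow> complex \<Rightarrow> complex"
  where "cscale_complex c x = c * x"

instance
  by standard (simp_all add: cscale_complex_def algebra_simps scaleR_conv_of_real norm_mult)

end

instantiation prod :: (complex_normed_vector, complex_normed_vector) complex_normed_vector
begin

definition cscale_prod :: "complex \<Rightarrow> 'a \<times> 'b \<Rightarrow> 'a \<times> 'b"
  where "cscale_prod c p = (c *\<^sub>C fst p, c *\<^sub>C snd p)"

instance
proof
  fix c :: complex and x :: "'a \<times> 'b"
  have "norm (c *\<^sub>C x) = sqrt ((cmod c)\<^sup>2 * ((norm (fst x))\<^sup>2 + (norm (snd x))\<^sup>2))"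
    by (simp add: cscale_prod_def norm_prod_def norm_cscale power_mult_distrib algebra_simps)
  then show "norm (c *\<^sub>C x) = cmod c * norm x"
    by (simp add: norm_prod_def real_sqrt_mult)
qed (simp_all add: cscale_prod_def cscale_add_right cscale_add_left cscale_cscale
       cscale_of_real prod_eq_iff)

end

text \<open>Complex differentiability at every point of the set; only used for open sets.\<close>

definition mholomorphic_on ::
    "('a::complex_normed_vector \<Rightarrow> 'b::complex_normed_vector) \<Rightarrow> 'a set \<Rightarrow> bool"
    (infixl "mholomorphic'_on" 50)
  where "F mholomorphic_on S \<longleftrightarrow>
    (\<forall>p\<in>S. \<exists>L. (F has_derivative L) (at p) \<and> (\<forall>c v. L (c *\<^sub>C v) = c *\<^sub>C L v))"

lemma mholomorphic_on_complex_iff: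
  fixes f :: "complex \<Rightarrow> complex"
  assumes "open S"
  shows "f mholomorphic_on S \<longleftrightarrow> f holomorphic_on S"
proof -
  have "(\<exists>L. (f has_derivative L) (at p) \<and> (\<forall>c v. L (c *\<^sub>C v) = c *\<^sub>C L v))
      \<longleftrightarrow> f field_differentiable (at p)" for p
  proof
    assume "\<exists>L. (f has_derivative L) (at p) \<and> (\<forall>c v. L (c *\<^sub>C v) = c *\<^sub>C L v)"
    then obtain L where L: "(f has_derivative L) (at p)" "\<And>c v. L (c * v) = c * L v"
      by (auto simp: cscale_complex_def)
    have "L = (*) (L 1)"
    proof
      fix c
      show "L c = L 1 * c"
        using L(2)[of c 1] unfolding mult_1_right by (simp only: mult.commute)
    qed
    with L(1) show "f field_differentiable (at p)"
      unfolding field_differentiable_def has_field_derivative_def by metis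
  next
    assume "f field_differentiable (at p)"
    then obtain d where "(f has_derivative (*) d) (at p)"
      unfolding field_differentiable_def has_field_derivative_def by blast
    then show "\<exists>L. (f has_derivative L) (at p) \<and> (\<forall>c v. L (c *\<^sub>C v) = c *\<^sub>C L v)"
      by (intro exI[of _ "(*) d"]) (simp add: cscale_complex_def)
  qed
  then show ?thesis
    using assms by (simp add: mholomorphic_on_def holomorphic_on_open field_differentiable_def)
qed

text \<open>The least total degree of a nonzero Taylor coefficient (\<open>\<infinity>\<close> for the zero germ).\<close>

definition order_at_origin :: "(complex \<times> complex \<Rightarrow> complex) \<Rightarrow> enat"
  where "order_at_origin h =
    Inf {enat (i + j) |i j.
      (deriv ^^ i) (\<lambda>x. (deriv ^^ j) (\<lambda>y. h (x, y)) 0) 0 \<noteq> 0}"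


section \<open>Complex manifolds\<close>

type_synonym ('p, 'e) chart = "'p set \<times> ('p \<Rightarrow> 'e)"

abbreviation chart_inv :: "('p, 'e) chart \<Rightarrow> 'e \<Rightarrow> 'p"
  where "chart_inv c \<equiv> inv_into (fst c) (snd c)"

text \<open>A manifold is given by a topology on its set of points and an atlas (not necessarily a
  maximal one). Second countability is required, the Hausdorff property is not.\<close>

definition complex_manifold ::
    "'p topology \<Rightarrow> ('p, 'e::complex_normed_vector) chart set \<Rightarrow> bool"
  where "complex_manifold T A \<longleftrightarrow>
    second_countable T \<and>
    (\<Union>c\<in>A. fst c) = topspace T \<and>
    (\<forall>c\<in>A. openin T (fst c) \<and> open (snd c ` fst c) \<and>
       homeomorphic_map (subtopology T (fst c)) (top_of_set (snd c ` fst c)) (snd c)) \<and>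
    (\<forall>c\<in>A. \<forall>d\<in>A. (snd d \<circ> chart_inv c) mholomorphic_on (snd c ` (fst c \<inter> fst d)))"

text \<open>Surfaces are taken to be connected; without this, non-compactness would be an empty
  requirement, as one could always add a disjoint copy of \<open>\<complex>\<^sup>2\<close>.\<close>

definition complex_surface ::
    "'p topology \<Rightarrow> ('p, complex \<times> complex) chart set \<Rightarrow> bool"
  where "complex_surface T A \<longleftrightarrow> complex_manifold T A \<and> connected_space T"

definition flat_atlas :: "'e set \<Rightarrow> ('e, 'e) chart set"
  where "flat_atlas U = {(U, \<lambda>z. z)}"

definition prod_atlas ::
    "('p, 'e) chart set \<Rightarrow> ('q, 'f) chart set \<Rightarrow> ('p \<times> 'q, 'e \<times> 'f) chart set"
  where "prod_atlas A B = {(fst c \<times> fst d, map_prod (snd c) (snd d)) |c d. c \<in> A \<and> d \<in> B}"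

definition restrict_atlas :: "'p set \<Rightarrow> ('p, 'e) chart set \<Rightarrow> ('p, 'e) chart set"
  where "restrict_atlas S A = {(fst c \<inter> S, snd c) |c. c \<in> A}"

definition holomorphic_map ::
    "'p topology \<Rightarrow> ('p, 'e::complex_normed_vector) chart set \<Rightarrow>
     'q topology \<Rightarrow> ('q, 'f::complex_normed_vector) chart set \<Rightarrow> ('p \<Rightarrow> 'q) \<Rightarrow> bool"
  where "holomorphic_map T A T' A' F \<longleftrightarrow>
    continuous_map T T' F \<and>
    (\<forall>c\<in>A. \<forall>d\<in>A'. (snd d \<circ> F \<circ> chart_inv c) mholomorphic_on
       (snd c ` {p \<in> fst c. F p \<in> fst d}))"

definition biholomorphic_map ::
    "'p topology \<Rightarrow> ('p, 'e::complex_normed_vector) chart set \<Rightarrow>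
     'q topology \<Rightarrow> ('q, 'f::complex_normed_vector) chart set \<Rightarrow> ('p \<Rightarrow> 'q) \<Rightarrow> bool"
  where "biholomorphic_map T A T' A' F \<longleftrightarrow>
    holomorphic_map T A T' A' F \<and>
    (\<exists>G. holomorphic_map T' A' T A G \<and>
      (\<forall>p\<in>topspace T. G (F p) = p) \<and> (\<forall>q\<in>topspace T'. F (G q) = q))"


section \<open>Vector fields\<close>

text \<open>A vector field assigns to a chart \<open>c\<close> and a point \<open>p\<close> in the domain of \<open>c\<close> the coordinates,
  in the chart \<open>c\<close>, of a tangent vector at \<open>p\<close>. Its values at points outside the domain of \<open>c\<close>
  carry no meaning.\<close>

type_synonym ('p, 'e) vfield = "('p, 'e) chart \<Rightarrow> 'p \<Rightarrow> 'e"

text \<open>The differential of \<open>F\<close> sends \<open>V\<close> to \<open>V'\<close> along \<open>F\<close>.\<close>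

definition differential_sends ::
    "('p, 'e::complex_normed_vector) chart set \<Rightarrow> ('q, 'f::complex_normed_vector) chart set \<Rightarrow>
     ('p \<Rightarrow> 'q) \<Rightarrow> ('p, 'e) vfield \<Rightarrow> ('q, 'f) vfield \<Rightarrow> bool"
  where "differential_sends A A' F V V' \<longleftrightarrow>
    (\<forall>c\<in>A. \<forall>d\<in>A'. \<forall>p\<in>fst c. F p \<in> fst d \<longrightarrow>
      frechet_derivative (snd d \<circ> F \<circ> chart_inv c) (at (snd c p)) (V c p) = V' d (F p))"

text \<open>The first condition is the transformation law of tangent vectors under changes of
  charts.\<close>

definition holomorphic_vector_field ::
    "('p, 'e::complex_normed_vector) chart set \<Rightarrow> ('p, 'e) vfield \<Rightarrow> bool"
  where "holomorphic_vector_field A V \<longleftrightarrow>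
    differential_sends A A (\<lambda>p. p) V V \<and>
    (\<forall>c\<in>A. (V c \<circ> chart_inv c) mholomorphic_on (snd c ` fst c))"

definition lie_bracket ::
    "('e::real_normed_vector \<Rightarrow> 'e) \<Rightarrow> ('e \<Rightarrow> 'e) \<Rightarrow> 'e \<Rightarrow> 'e"
  where "lie_bracket F G z =
    frechet_derivative G (at z) (F z) - frechet_derivative F (at z) (G z)"

definition commuting_fields ::
    "('p, 'e::complex_normed_vector) chart set \<Rightarrow> ('p, 'e) vfield \<Rightarrow> ('p, 'e) vfield \<Rightarrow> bool"
  where "commuting_fields A V W \<longleftrightarrow>
    (\<forall>c\<in>A. \<forall>z\<in>snd c ` fst c. lie_bracket (V c \<circ> chart_inv c) (W c \<circ> chart_inv c) z = 0)"

definition holomorphic_action ::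
    "'p topology \<Rightarrow> ('p, 'e::complex_normed_vector) chart set \<Rightarrow>
     ('g::complex_normed_vector \<Rightarrow> 'p \<Rightarrow> 'p) \<Rightarrow> bool"
  where "holomorphic_action T A \<Phi> \<longleftrightarrow>
    holomorphic_map (prod_topology euclidean T) (prod_atlas (flat_atlas UNIV) A) T A
      (\<lambda>(t, p). \<Phi> t p) \<and>
    (\<forall>p\<in>topspace T. \<Phi> 0 p = p) \<and>
    (\<forall>s t. \<forall>p\<in>topspace T. \<Phi> (s + t) p = \<Phi> s (\<Phi> t p))"

text \<open>For each \<open>p\<close>, the curve \<open>t \<mapsto> \<Phi> t p\<close>, with complex time \<open>t\<close>, is an integral curve of \<open>V\<close>.\<close>

definition generated_by ::
    "'p topology \<Rightarrow> ('p, 'e::complex_normed_vector) chart set \<Rightarrow>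
     (complex \<Rightarrow> 'p \<Rightarrow> 'p) \<Rightarrow> ('p, 'e) vfield \<Rightarrow> bool"
  where "generated_by T A \<Phi> V \<longleftrightarrow>
    (\<forall>p\<in>topspace T. \<forall>t. \<forall>c\<in>A. \<Phi> t p \<in> fst c \<longrightarrow>
      ((\<lambda>s. snd c (\<Phi> s p)) has_derivative (\<lambda>\<tau>. \<tau> *\<^sub>C V c (\<Phi> t p))) (at t))"

definition complete_vector_field ::
    "'p topology \<Rightarrow> ('p, 'e::complex_normed_vector) chart set \<Rightarrow> ('p, 'e) vfield \<Rightarrow> bool"
  where "complete_vector_field T A V \<longleftrightarrow>
    (\<exists>\<Phi>. holomorphic_action T A \<Phi> \<and> generated_by T A \<Phi> V)"


section \<open>The two vector fields\<close>

definition field_X :: "nat \<Rightarrow> nat \<Rightarrow> nat \<Rightarrow> nat \<Rightarrow> complex \<times> complex \<Rightarrow> complex \<times> complex"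
  where "field_X a b m n = (\<lambda>(x, y).
    (x ^ a * y ^ b) *\<^sub>C (of_nat m * x, - (of_nat n * y)))"

text \<open>Here \<open>h\<close> stands for the holomorphic extension of \<open>x\<^sup>a y\<^sup>b f(x\<^sup>n y\<^sup>m)\<close> across the coordinate
  axes, where \<open>f(x\<^sup>n y\<^sup>m)\<close> itself need not make sense.\<close>

definition field_Y ::
    "nat \<Rightarrow> nat \<Rightarrow> nat \<Rightarrow> nat \<Rightarrow> (complex \<Rightarrow> complex) \<Rightarrow> (complex \<times> complex \<Rightarrow> complex) \<Rightarrow>
     complex \<times> complex \<Rightarrow> complex \<times> complex"
  where "field_Y a b m n g h = (\<lambda>(x, y).
    g (x ^ n * y ^ m) *\<^sub>C
      (x * (- (of_nat b * of_nat m) + h (x, y)),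
       y * (of_nat a * of_nat m - of_nat n / of_nat m * h (x, y))))"

text \<open>The type of points of the surface to be constructed. Any type with at least continuum many
  elements would do, since a second countable manifold has at most that many points; this one
  has room for a quotient of a disjoint union of pieces of \<open>\<complex>\<^sup>2\<close> indexed by \<open>\<complex>\<^sup>2\<close>, with
  equivalence classes as points.\<close>

type_synonym surface_point = "((complex \<times> complex) \<times> (complex \<times> complex)) set"

end

theory Submission
  imports Defs
begin

text \<open>Put \<open>u = x\<^sup>a y\<^sup>b\<close>, \<open>v = x\<^sup>n y\<^sup>m\<close> and \<open>e = a m - b n\<close>. The monomial map
  \<open>(x, y) \<mapsto> (u, v)\<close> has determinant \<open>e\<close>, hence is an automorphism of the torus \<open>x y \<noteq> 0\<close>, and
  it sends the two fields to
  \<open>X = e u\<^sup>2 \<partial>\<^sub>u\<close> and \<open>Y = e m v g(v) \<partial>\<^sub>v + (e/m) g(v) f(v) u\<^sup>2 \<partial>\<^sub>u\<close>.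
  In the reciprocal coordinates \<open>s = 1/u\<close>, \<open>r = 1/v\<close> the field \<open>X\<close> is the constant field
  \<open>- e \<partial>\<^sub>s\<close>.

  The first step brings \<open>Y\<close> to a model in which \<open>g f\<close> is replaced by the constant \<open>c = g(0) f\<^sub>0\<close>
  and \<open>g(v)\<close> by \<open>\<kappa> + \<mu> v\<close> with \<open>\<kappa> \<mu> = 0\<close>. It uses a change of variables that adds a
  meromorphic function of \<open>v\<close> to \<open>1/u\<close> and divides \<open>v\<close> by a unit \<open>Q(v)\<close>. Both unknown functions
  solve equations of the form \<open>v \<phi>' - k \<phi> = R\<close>, and such an equation is solvable near \<open>0\<close> as soon
  as the coefficient of \<open>v\<^sup>k\<close> in \<open>R\<close> vanishes (\<open>resonant_euler_equation\<close>). If \<open>g(0) \<noteq> 0\<close> this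
  can be arranged with \<open>\<kappa> = g(0)\<close>, \<open>\<mu> = 0\<close>; if \<open>g(0) = 0 \<noteq> g'(0)\<close> one takes \<open>\<kappa> = 0\<close>,
  \<open>\<mu> = g'(0)\<close>, and the two coefficients in question vanish because \<open>f\<^sub>0 = 0\<close> and \<open>g''(0) = 0\<close>
  (\<open>normalizing_functions\<close>). The change of variables is a biholomorphism near the origin of the
  \<open>(x, y)\<close>-plane, axes included, because the pole of \<open>f\<close> is compensated by the monomial \<open>u\<close>
  (\<open>pole_order_bounds\<close>, \<open>cderiv_normal_form\<close>, \<open>tangent_to_identity_embedding\<close>).

  The model fields are affine in \<open>(s, r)\<close>, so they are complete on the whole \<open>(s, r)\<close>-plane; they
  are also polynomial on the whole \<open>(x, y)\<close>-plane. The surface is the union of these two planes,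
  glued along their tori. It consists of the \<open>(s, r)\<close>-plane and the two axes \<open>x y = 0\<close>. The action
  extends to the axes because \<open>s \<mapsto> s - \<tau>\<close> reads \<open>u \<mapsto> u / (1 - \<tau> u)\<close>, with a denominator that is
  \<open>1\<close> on the axes, and similarly for \<open>r\<close> and \<open>v\<close>; the monomial map lifts such rescalings of
  \<open>(u, v)\<close> to \<open>(x, y)\<close> (\<open>model_flow_True\<close>). The gluing is Hausdorff because \<open>u\<close> tends to \<open>0\<close> at the
  axes while \<open>1/u\<close> stays bounded near points of the \<open>(s, r)\<close>-plane, and the axes are a closed
  non-compact subset.\<close>

section \<open>Complex directional derivatives\<close>

text \<open>The predicate joins complex differentiability at \<open>p\<close> with the value \<open>d\<close> of the differential in
  one direction \<open>v\<close>. The transformation law of a vector field is then a chain rule, and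
  differentiability may be certified in any direction.\<close>

definition cderiv ::
    "('a::complex_normed_vector \<Rightarrow> 'b::complex_normed_vector) \<Rightarrow> 'a \<Rightarrow> 'a \<Rightarrow> 'b \<Rightarrow> bool"
  where "cderiv F p v d \<longleftrightarrow>
    (\<exists>L. (F has_derivative L) (at p) \<and> (\<forall>c w. L (c *\<^sub>C w) = c *\<^sub>C L w) \<and> L v = d)"

lemma cscale_mult [simp]: "c *\<^sub>C (x::complex) = c * x"
  by (simp add: cscale_complex_def)

lemma cscale_Pair [simp]: "c *\<^sub>C (x, y) = (c *\<^sub>C x, c *\<^sub>C y)"
  by (simp add: cscale_prod_def)

lemma cscale_one [simp]: "1 *\<^sub>C x = x"
  using cscale_of_real[of 1 x] by simp

lemma cscale_zero_left [simp]: "0 *\<^sub>C x = 0"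
  using cscale_of_real[of 0 x] by simp

lemma cscale_zero_right [simp]: "c *\<^sub>C 0 = 0"
  using cscale_add_right[of c 0 0] by simp

lemma mholomorphic_on_iff_cderiv:
  "F mholomorphic_on S \<longleftrightarrow> (\<forall>p\<in>S. \<exists>d. cderiv F p v d)"
  by (auto simp: mholomorphic_on_def cderiv_def)

lemma mholomorphic_onI:
  assumes "\<And>p. p \<in> S \<Longrightarrow> cderiv F p (v p) (d p)"
  shows "F mholomorphic_on S"
  using assms unfolding mholomorphic_on_def cderiv_def by blast

lemma mholomorphic_onE:
  assumes "F mholomorphic_on S" "p \<in> S"
  obtains d where "cderiv F p v d"
  using assms mholomorphic_on_iff_cderiv by blast

lemma mholomorphic_on_subset:
  "F mholomorphic_on S \<Longrightarrow> R \<subseteq> S \<Longrightarrow> F mholomorphic_on R"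
  unfolding mholomorphic_on_def by blast

lemma cderiv_frechet_derivative:
  "cderiv F p v d \<Longrightarrow> frechet_derivative F (at p) v = d"
  unfolding cderiv_def using frechet_derivative_at by metis

lemma cderiv_unique: "cderiv F p v d \<Longrightarrow> cderiv F p v d' \<Longrightarrow> d = d'"
  using cderiv_frechet_derivative by metis

lemma cderiv_has_derivative:
  "cderiv F (t::complex) 1 d \<Longrightarrow> (F has_derivative (\<lambda>\<tau>. \<tau> *\<^sub>C d)) (at t)"
proof -
  assume "cderiv F t 1 d"
  then obtain L where L: "(F has_derivative L) (at t)" "\<And>c w. L (c *\<^sub>C w) = c *\<^sub>C L w" "L 1 = d"
    unfolding cderiv_def by blast
  have "L \<tau> = \<tau> *\<^sub>C d" for \<tau>
    using L(2)[of \<tau> 1] L(3) by simp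
  then have "L = (\<lambda>\<tau>. \<tau> *\<^sub>C d)" by blast
  with L(1) show ?thesis by simp
qed

lemma mholomorphic_on_imp_continuous_on: "F mholomorphic_on S \<Longrightarrow> continuous_on S F"
  unfolding mholomorphic_on_def
  by (meson continuous_at_imp_continuous_on has_derivative_continuous)

lemma cderiv_transform:
  assumes "cderiv F p v d" "open S" "p \<in> S" "\<And>z. z \<in> S \<Longrightarrow> F z = G z"
  shows "cderiv G p v d"
proof -
  from assms(1) obtain L where
    L: "(F has_derivative L) (at p)" "\<forall>c w. L (c *\<^sub>C w) = c *\<^sub>C L w" "L v = d"
    unfolding cderiv_def by blast
  have "(G has_derivative L) (at p)"
    by (rule has_derivative_transform_within_open[OF L(1) assms(2,3,4)])
  with L(2,3) show ?thesis unfolding cderiv_def by blast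
qed

lemma mholomorphic_on_transform:
  assumes "F mholomorphic_on S" "open S" "\<And>z. z \<in> S \<Longrightarrow> F z = G z"
  shows "G mholomorphic_on S"
  unfolding mholomorphic_on_iff_cderiv[where v=0]
proof
  fix p assume p: "p \<in> S"
  obtain d where "cderiv F p 0 d" using mholomorphic_onE[OF assms(1) p] .
  from cderiv_transform[OF this assms(2) p assms(3)] show "\<exists>d. cderiv G p 0 d" by (rule exI)
qed

lemma cderiv_const: "cderiv (\<lambda>_. c) p v 0"
  unfolding cderiv_def by (intro exI[of _ "\<lambda>_. 0"]) simp

lemma cderiv_ident: "cderiv (\<lambda>z. z) p v v"
  unfolding cderiv_def by (intro exI[of _ "\<lambda>w. w"]) simp

lemma cderiv_Pair:
  assumes "cderiv F p v d" "cderiv G p v d'"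
  shows "cderiv (\<lambda>z. (F z, G z)) p v (d, d')"
proof -
  from assms obtain L M where
    "(F has_derivative L) (at p)" "\<forall>c w. L (c *\<^sub>C w) = c *\<^sub>C L w" "L v = d"
    "(G has_derivative M) (at p)" "\<forall>c w. M (c *\<^sub>C w) = c *\<^sub>C M w" "M v = d'"
    unfolding cderiv_def by blast
  then show ?thesis unfolding cderiv_def
    by (intro exI[of _ "\<lambda>w. (L w, M w)"]) (simp add: has_derivative_Pair)
qed

lemma cderiv_compose:
  assumes "cderiv F p v d" "cderiv G (F p) d d'"
  shows "cderiv (\<lambda>z. G (F z)) p v d'"
proof -
  from assms obtain L M where
    "(F has_derivative L) (at p)" "\<forall>c w. L (c *\<^sub>C w) = c *\<^sub>C L w" "L v = d"
    "(G has_derivative M) (at (F p))" "\<forall>c w. M (c *\<^sub>C w) = c *\<^sub>C M w" "M d = d'"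
    unfolding cderiv_def by blast
  then show ?thesis unfolding cderiv_def
    by (intro exI[of _ "\<lambda>w. M (L w)"]) (simp add: has_derivative_compose)
qed

lemma mholomorphic_on_compose:
  assumes "F mholomorphic_on S" "G mholomorphic_on R" "F ` S \<subseteq> R"
  shows "(\<lambda>z. G (F z)) mholomorphic_on S"
  unfolding mholomorphic_on_iff_cderiv[where v=0]
proof
  fix p assume p: "p \<in> S"
  then obtain d where d: "cderiv F p 0 d" using assms(1) mholomorphic_onE by blast
  from p assms(3) have "F p \<in> R" by blast
  then obtain d' where d': "cderiv G (F p) d d'" using assms(2) mholomorphic_onE by blast
  show "\<exists>d. cderiv (\<lambda>z. G (F z)) p 0 d"
    using cderiv_compose[OF d d'] by (rule exI)
qed

lemma cderiv_fst: "cderiv F p v d \<Longrightarrow> cderiv (\<lambda>z. fst (F z)) p v (fst d)"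
proof (erule cderiv_compose)
  show "cderiv fst (F p) d (fst d)" unfolding cderiv_def
    using has_derivative_fst[OF has_derivative_ident, of "at (F p)"]
    by (intro exI[of _ fst] conjI) (simp_all add: cscale_prod_def)
qed

lemma cderiv_snd: "cderiv F p v d \<Longrightarrow> cderiv (\<lambda>z. snd (F z)) p v (snd d)"
proof (erule cderiv_compose)
  show "cderiv snd (F p) d (snd d)" unfolding cderiv_def
    using has_derivative_snd[OF has_derivative_ident, of "at (F p)"]
    by (intro exI[of _ snd] conjI) (simp_all add: cscale_prod_def)
qed

lemma cderiv_add:
  assumes "cderiv F p v d" "cderiv G p v d'"
  shows "cderiv (\<lambda>z. F z + G z) p v (d + d')"
proof -
  from assms obtain L M where
    "(F has_derivative L) (at p)" "\<forall>c w. L (c *\<^sub>C w) = c *\<^sub>C L w" "L v = d"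
    "(G has_derivative M) (at p)" "\<forall>c w. M (c *\<^sub>C w) = c *\<^sub>C M w" "M v = d'"
    unfolding cderiv_def by blast
  then show ?thesis unfolding cderiv_def
    by (intro exI[of _ "\<lambda>w. L w + M w"]) (simp add: has_derivative_add cscale_add_right)
qed

lemma cderiv_mult:
  fixes F G :: "'a::complex_normed_vector \<Rightarrow> complex"
  assumes "cderiv F p v d" "cderiv G p v d'"
  shows "cderiv (\<lambda>z. F z * G z) p v (F p * d' + d * G p)"
proof -
  from assms obtain L M where
    "(F has_derivative L) (at p)" "\<forall>c w. L (c *\<^sub>C w) = c *\<^sub>C L w" "L v = d"
    "(G has_derivative M) (at p)" "\<forall>c w. M (c *\<^sub>C w) = c *\<^sub>C M w" "M v = d'"
    unfolding cderiv_def by blast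
  then show ?thesis unfolding cderiv_def
    using has_derivative_mult[of F L p UNIV G M]
    by (intro exI[of _ "\<lambda>w. F p * M w + L w * G p"]) (simp add: distrib_left)
qed

lemma cderiv_cmult:
  fixes F :: "'a::complex_normed_vector \<Rightarrow> complex"
  assumes "cderiv F p v d"
  shows "cderiv (\<lambda>z. c * F z) p v (c * d)"
  using cderiv_mult[OF cderiv_const assms, of c] by simp

lemma cderiv_field_compose:
  fixes F :: "'a::complex_normed_vector \<Rightarrow> complex"
  assumes "cderiv F p v d" "(f has_field_derivative f') (at (F p))"
  shows "cderiv (\<lambda>z. f (F z)) p v (f' * d)"
proof (rule cderiv_compose[OF assms(1)])
  show "cderiv f (F p) d (f' * d)" unfolding cderiv_def
    using assms(2) unfolding has_field_derivative_def
    by (intro exI[of _ "(*) f'"]) simp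
qed

text \<open>Derivatives written as a function times a rate. Rates add under products, and at a zero of the
  function the form still makes sense, which matters on the coordinate axes.\<close>

lemma cderiv_log_mult:
  fixes F G :: "'a::complex_normed_vector \<Rightarrow> complex"
  assumes "cderiv F p v (F p * d)" "cderiv G p v (G p * d')"
  shows "cderiv (\<lambda>z. F z * G z) p v (F p * G p * (d + d'))"
  using cderiv_mult[OF assms] by (simp add: algebra_simps)

lemma cderiv_log_power:
  fixes F :: "'a::complex_normed_vector \<Rightarrow> complex"
  assumes "cderiv F p v (F p * d)"
  shows "cderiv (\<lambda>z. F z ^ k) p v (F p ^ k * (of_nat k * d))"
proof (induction k)
  case 0
  then show ?case using cderiv_const[of 1 p v] by simp
next
  case (Suc k)
  show ?case using cderiv_log_mult[OF assms Suc] by (simp add: algebra_simps)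
qed

lemma cderiv_log_power_int:
  fixes F :: "'a::complex_normed_vector \<Rightarrow> complex"
  assumes "cderiv F p v (F p * d)" "F p \<noteq> 0"
  shows "cderiv (\<lambda>z. F z powi k) p v (F p powi k * (of_int k * d))"
proof -
  have "((\<lambda>z. z powi k) has_field_derivative of_int k * F p powi (k - 1) * 1) (at (F p))"
    using assms(2) by (intro DERIV_power_int DERIV_ident) auto
  from cderiv_field_compose[OF assms(1) this]
  have "cderiv (\<lambda>z. F z powi k) p v (of_int k * F p powi (k - 1) * 1 * (F p * d))" .
  moreover have "F p powi (k - 1) * F p = F p powi k"
    using power_int_add[of "F p" "k - 1" 1] assms(2) by simp
  ultimately show ?thesis by (simp add: algebra_simps flip: \<open>F p powi (k - 1) * F p = F p powi k\<close>)
qed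

lemma cderiv_zero_direction: "cderiv F p 0 d \<Longrightarrow> d = 0"
proof -
  assume "cderiv F p 0 d"
  then obtain L where L: "(F has_derivative L) (at p)" "L 0 = d" unfolding cderiv_def by blast
  from L(1) have "linear L" by (rule has_derivative_linear)
  then show "d = 0" using L(2) linear_0 by blast
qed

text \<open>In direction \<open>0\<close> every derivative is \<open>0\<close>. Proofs of holomorphy can therefore use the rules of
  this section without computing a derivative, and \<open>0 = F p * 0\<close> always has the form that the
  logarithmic rules ask for.\<close>

lemma mholomorphic_on_iff_cderiv_zero:
  "F mholomorphic_on S \<longleftrightarrow> (\<forall>p\<in>S. cderiv F p 0 0)"
proof
  assume F: "F mholomorphic_on S"
  show "\<forall>p\<in>S. cderiv F p 0 0"
  proof
    fix p assume "p \<in> S"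
    from mholomorphic_onE[OF F this] obtain d where d: "cderiv F p 0 d" .
    with cderiv_zero_direction[OF d] show "cderiv F p 0 0" by simp
  qed
qed (auto intro: mholomorphic_onI)

text \<open>Differentiating \<open>G (F z) = z\<close> transports a direction back along \<open>F\<close>, so the derivative of an
  inverse map along a field need not be computed.\<close>

lemma cderiv_left_inverse:
  assumes F: "cderiv F p v d" and G: "G mholomorphic_on R" "F p \<in> R"
    and S: "open S" "p \<in> S" "\<And>z. z \<in> S \<Longrightarrow> G (F z) = z"
  shows "cderiv G (F p) d v"
proof -
  obtain d' where d': "cderiv G (F p) d d'" using mholomorphic_onE[OF G] .
  have "cderiv (\<lambda>z. z) p v d'"
    by (rule cderiv_transform[OF cderiv_compose[OF F d'] S(1,2)]) (rule S(3))
  then have "d' = v" using cderiv_unique cderiv_ident by blast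
  with d' show ?thesis by simp
qed

lemma cderiv_fst_snd:
  "cderiv (\<lambda>z. fst z) z v (fst v)" "cderiv (\<lambda>z. snd z) z v (snd v)"
  by (rule cderiv_fst[OF cderiv_ident], rule cderiv_snd[OF cderiv_ident])

section \<open>Complex manifolds given by parametrizations\<close>

lemma inv_into_range_left_inverse:
  assumes "\<And>z. g (f z) = z"
  shows "inv_into (range f) g = f"
proof
  fix x
  have "inv_into (range f) g x = f x"
    using assms by (intro inv_into_f_eq) (auto intro: inj_onI)
  then show "inv_into (range f) g x = f x" .
qed

text \<open>Gluing copies of the model space: injective parametrizations with open overlaps and holomorphic
  transitions determine the topology and the charts of a manifold. All charts have the full model
  space as image, which keeps images and inverses of charts simple.\<close>

locale holomorphic_parametrizations =
  fixes par :: "'i::countable \<Rightarrow> 'e::{complex_normed_vector,second_countable_topology} \<Rightarrow> 'p"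
  assumes par_inj: "inj (par i)"
    and par_distinct: "inj par"
    and open_overlap: "open (par i -` range (par j))"
    and transition_holomorphic:
      "(\<lambda>z. inv (par j) (par i z)) mholomorphic_on (par i -` range (par j))"
begin

definition glued_top :: "'p topology"
  where "glued_top = topology (\<lambda>S. S \<subseteq> (\<Union>i. range (par i)) \<and> (\<forall>i. open (par i -` S)))"

definition param_chart :: "'i \<Rightarrow> ('p, 'e) chart"
  where "param_chart i = (range (par i), inv (par i))"

abbreviation param_atlas :: "('p, 'e) chart set"
  where "param_atlas \<equiv> range param_chart"

lemma inv_par [simp]: "inv (par i) (par i z) = z"
  by (simp add: par_inj)

lemma par_eq_iff [simp]: "par i z = par i w \<longleftrightarrow> z = w"
  using par_inj by (simp add: inj_eq)

lemma inv_into_inv_par [simp]: "inv_into (range (par i)) (inv (par i)) = par i"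
  by (rule inv_into_range_left_inverse) simp

lemma par_inv: "p \<in> range (par i) \<Longrightarrow> par i (inv (par i) p) = p"
  by (simp add: f_inv_into_f)

lemma chart_inv_param_chart: "chart_inv (param_chart i) = par i"
  by (simp add: param_chart_def)

lemma fst_param_chart [simp]: "fst (param_chart i) = range (par i)"
  and snd_param_chart [simp]: "snd (param_chart i) = inv (par i)"
  by (simp_all add: param_chart_def)

lemma inj_param_chart: "inj param_chart"
proof (rule injI)
  fix i j assume eq: "param_chart i = param_chart j"
  have "par i = par j"
    using chart_inv_param_chart[of i] chart_inv_param_chart[of j] eq by simp
  then show "i = j" using par_distinct by (simp add: inj_eq)
qed

lemma openin_glued_top: "openin glued_top S \<longleftrightarrow> S \<subseteq> (\<Union>i. range (par i)) \<and> (\<forall>i. open (par i -` S))"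
proof -
  have "istopology (\<lambda>S. S \<subseteq> (\<Union>i. range (par i)) \<and> (\<forall>i. open (par i -` S)))"
    unfolding istopology_def by (auto simp: vimage_Union intro!: open_Int open_UN)
  then show ?thesis unfolding glued_top_def by (simp add: topology_inverse')
qed

text \<open>Seen from \<open>par j\<close>, the image is the preimage of \<open>S\<close> under a transition map, which is continuous
  on an open set.\<close>

lemma openin_par_image:
  assumes "open S"
  shows "openin glued_top (par i ` S)"
proof -
  have "open (par j -` (par i ` S))" for j
  proof -
    have "continuous_on (par j -` range (par i)) (\<lambda>z. inv (par i) (par j z))"
      by (rule mholomorphic_on_imp_continuous_on[OF transition_holomorphic])
    then have "open (par j -` range (par i) \<inter> (\<lambda>z. inv (par i) (par j z)) -` S)"
      using assms open_overlap by (metis continuous_open_preimage)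
    moreover have "par j -` range (par i) \<inter> (\<lambda>z. inv (par i) (par j z)) -` S = par j -` (par i ` S)"
      by (auto simp: image_iff)
    ultimately show ?thesis by simp
  qed
  then show ?thesis unfolding openin_glued_top by blast
qed

lemma openin_range_par: "openin glued_top (range (par i))"
  by (simp add: openin_par_image)

lemma topspace_glued_top: "topspace glued_top = (\<Union>i. range (par i))"
proof (rule antisym)
  show "topspace glued_top \<subseteq> (\<Union>i. range (par i))"
    using openin_topspace[of glued_top] openin_glued_top by blast
  show "(\<Union>i. range (par i)) \<subseteq> topspace glued_top"
    using openin_range_par openin_subset by blast
qed

lemma par_in_topspace [simp]: "par i z \<in> topspace glued_top"
  by (auto simp: topspace_glued_top)

lemma continuous_par: "continuous_map euclidean glued_top (par i)"
  by (auto simp: continuous_map_def openin_glued_top vimage_def)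

lemma continuous_inv_par:
  "continuous_map (subtopology glued_top (range (par i))) euclidean (inv (par i))"
proof -
  have "openin (subtopology glued_top (range (par i)))
      {x \<in> topspace (subtopology glued_top (range (par i))). inv (par i) x \<in> S}" if "open S" for S
  proof -
    have "{x \<in> topspace (subtopology glued_top (range (par i))). inv (par i) x \<in> S} =
        par i ` S \<inter> range (par i)"
      by (auto simp: topspace_glued_top)
    then show ?thesis
      using openin_par_image[OF that] unfolding openin_subtopology by blast
  qed
  then show ?thesis by (simp add: continuous_map_def)
qed

lemma homeomorphic_inv_par:
  "homeomorphic_map (subtopology glued_top (range (par i))) euclidean (inv (par i))"
proof -
  have "homeomorphic_maps (subtopology glued_top (range (par i))) euclidean (inv (par i)) (par i)"
    unfolding homeomorphic_maps_def
    using continuous_inv_par continuous_par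
    by (auto simp: continuous_map_in_subtopology)
  then show ?thesis using homeomorphic_map_maps by blast
qed

lemma inv_par_image: "inv (par i) ` {p \<in> range (par i). Q p} = {z. Q (par i z)}"
proof (intro antisym subsetI)
  fix z assume "z \<in> {z. Q (par i z)}"
  then show "z \<in> inv (par i) ` {p \<in> range (par i). Q p}"
    by (intro image_eqI[of _ _ "par i z"]) simp_all
qed auto

lemma inv_par_image_range [simp]: "inv (par i) ` range (par i) = UNIV"
  by (auto simp: image_image)

lemma second_countable_glued_top: "second_countable glued_top"
proof -
  obtain B :: "'e set set" where B: "countable B" "topological_basis B"
    using ex_countable_basis by blast
  define BB where "BB = (\<lambda>(i, b). par i ` b) ` (UNIV \<times> B)"
  have "countable BB" unfolding BB_def using B(1) by simp
  moreover have "\<forall>V\<in>BB. openin glued_top V"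
    unfolding BB_def using topological_basis_open[OF B(2)] openin_par_image by auto
  moreover have "\<exists>V\<in>BB. x \<in> V \<and> V \<subseteq> U" if U: "openin glued_top U" "x \<in> U" for U x
  proof -
    from U obtain i z where z: "x = par i z" using openin_glued_top by blast
    have "open (par i -` U)" "z \<in> par i -` U" using U z openin_glued_top by auto
    then obtain b where "b \<in> B" "z \<in> b" "b \<subseteq> par i -` U"
      using topological_basisE[OF B(2)] by metis
    then show ?thesis unfolding BB_def z
      by (intro bexI[of _ "par i ` b"]) auto
  qed
  ultimately show ?thesis unfolding second_countable_def by blast
qed

lemma complex_manifold_glued_top: "complex_manifold glued_top param_atlas"
  unfolding complex_manifold_def
proof (intro conjI ballI)
  show "second_countable glued_top" by (rule second_countable_glued_top)
  show "(\<Union>c\<in>param_atlas. fst c) = topspace glued_top" by (auto simp: topspace_glued_top)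
  fix c assume "c \<in> param_atlas"
  then obtain i where c: "c = param_chart i" by blast
  show "openin glued_top (fst c)" by (simp add: c openin_range_par)
  show "open (snd c ` fst c)" by (simp add: c)
  show "homeomorphic_map (subtopology glued_top (fst c)) (top_of_set (snd c ` fst c)) (snd c)"
    by (simp add: c homeomorphic_inv_par)
  fix d assume "d \<in> param_atlas"
  then obtain j where d: "d = param_chart j" by blast
  have "snd c ` (fst c \<inter> fst d) = par i -` range (par j)"
    using inv_par_image[of i "\<lambda>p. p \<in> range (par j)"] by (auto simp: c d Int_def vimage_def)
  moreover have "snd d \<circ> chart_inv c = (\<lambda>z. inv (par j) (par i z))"
    by (simp add: c d chart_inv_param_chart comp_def)
  ultimately show "(snd d \<circ> chart_inv c) mholomorphic_on (snd c ` (fst c \<inter> fst d))"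
    by (simp only: transition_holomorphic)
qed

text \<open>A vector field is described by its components \<open>v i\<close> in each parametrization.\<close>

definition chartwise_field :: "('i \<Rightarrow> 'e \<Rightarrow> 'e) \<Rightarrow> ('p, 'e) vfield"
  where "chartwise_field v c p = v (inv param_chart c) (snd c p)"

text \<open>The transformation law of tangent vectors under the transition maps.\<close>

definition field_compatible :: "('i \<Rightarrow> 'e \<Rightarrow> 'e) \<Rightarrow> bool"
  where "field_compatible v \<longleftrightarrow> (\<forall>i j z. par i z \<in> range (par j) \<longrightarrow>
    cderiv (\<lambda>w. inv (par j) (par i w)) z (v i z) (v j (inv (par j) (par i z))))"

lemma field_compatibleD:
  "field_compatible v \<Longrightarrow> par i z \<in> range (par j) \<Longrightarrow>
    cderiv (\<lambda>w. inv (par j) (par i w)) z (v i z) (v j (inv (par j) (par i z)))"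
  unfolding field_compatible_def by blast

lemma chartwise_field_param_chart [simp]: "chartwise_field v (param_chart i) p = v i (inv (par i) p)"
  by (simp add: chartwise_field_def inj_param_chart)

lemma holomorphic_vector_field_chartwise_field:
  assumes "field_compatible v" "\<And>i. v i mholomorphic_on UNIV"
  shows "holomorphic_vector_field param_atlas (chartwise_field v)"
  unfolding holomorphic_vector_field_def differential_sends_def
proof (intro conjI ballI impI)
  fix c d p assume "c \<in> param_atlas" "d \<in> param_atlas" and p: "p \<in> fst c" "p \<in> fst d"
  then obtain i j where c: "c = param_chart i" and d: "d = param_chart j" by blast
  from p(1) obtain z where z: "p = par i z" by (auto simp: c)
  have "cderiv (\<lambda>w. inv (par j) (par i w)) z (v i z) (v j (inv (par j) p))"
    using field_compatibleD[OF assms(1)] p(2) by (simp add: z d)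
  then have "frechet_derivative (\<lambda>w. inv (par j) (par i w)) (at z) (v i z) = v j (inv (par j) p)"
    by (rule cderiv_frechet_derivative)
  then show "frechet_derivative (snd d \<circ> (\<lambda>p. p) \<circ> chart_inv c) (at (snd c p)) (chartwise_field v c p) = chartwise_field v d p"
    by (simp add: c d z chart_inv_param_chart comp_def)
next
  fix c assume "c \<in> param_atlas"
  then obtain i where c: "c = param_chart i" by blast
  show "(chartwise_field v c \<circ> chart_inv c) mholomorphic_on (snd c ` fst c)"
    using assms(2)[of i] unfolding c chart_inv_param_chart comp_def by simp
qed

lemma commuting_fields_chartwise_field:
  assumes "\<And>i z. lie_bracket (v i) (w i) z = 0"
  shows "commuting_fields param_atlas (chartwise_field v) (chartwise_field w)"
  unfolding commuting_fields_def using assms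
  by (auto simp: chart_inv_param_chart comp_def)

text \<open>An integral curve has to be recognized in one parametrization only, near each time; the
  transformation law takes care of the remaining charts.\<close>

lemma generated_by_chartwise_field:
  assumes "field_compatible v"
    and loc: "\<And>p t. p \<in> topspace glued_top \<Longrightarrow>
      \<exists>i F S. open S \<and> t \<in> S \<and> (\<forall>s\<in>S. \<Phi> s p = par i (F s)) \<and> cderiv F t 1 (v i (F t))"
  shows "generated_by glued_top param_atlas \<Phi> (chartwise_field v)"
  unfolding generated_by_def
proof (intro ballI allI impI)
  fix p t c assume p: "p \<in> topspace glued_top" and "c \<in> param_atlas" and pc: "\<Phi> t p \<in> fst c"
  then obtain j where c: "c = param_chart j" by blast
  obtain i F S where S: "open S" "t \<in> S" "\<And>s. s \<in> S \<Longrightarrow> \<Phi> s p = par i (F s)"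
      "cderiv F t 1 (v i (F t))"
    using loc[OF p, of t] by blast
  have "par i (F t) \<in> range (par j)" using pc S(2,3) by (simp add: c)
  note cderiv_compose[OF S(4) field_compatibleD[OF assms(1) this]]
  then have "cderiv (\<lambda>s. inv (par j) (\<Phi> s p)) t 1 (v j (inv (par j) (par i (F t))))"
    by (rule cderiv_transform[OF _ S(1,2)]) (simp add: S(3))
  then show "((\<lambda>s. snd c (\<Phi> s p)) has_derivative (\<lambda>\<tau>. \<tau> *\<^sub>C chartwise_field v c (\<Phi> t p))) (at t)"
    using cderiv_has_derivative S(2,3) by (simp add: c)
qed

text \<open>It suffices to see the action as holomorphic in one pair of parametrizations near each point:
  products of open sets in the parameter space are mapped to open sets, which gives continuity, and
  in any other pair of charts the action differs by transition maps, which are holomorphic.\<close>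

lemma holomorphic_actionI:
  fixes \<Phi> :: "'g::complex_normed_vector \<Rightarrow> 'p \<Rightarrow> 'p"
  assumes loc: "\<And>t p. p \<in> topspace glued_top \<Longrightarrow>
      \<exists>i j z W F. p = par i z \<and> open W \<and> (t, z) \<in> W \<and> F mholomorphic_on W \<and>
        (\<forall>s w. (s, w) \<in> W \<longrightarrow> \<Phi> s (par i w) = par j (F (s, w)))"
    and zero: "\<And>p. p \<in> topspace glued_top \<Longrightarrow> \<Phi> 0 p = p"
    and add: "\<And>s t p. p \<in> topspace glued_top \<Longrightarrow> \<Phi> (s + t) p = \<Phi> s (\<Phi> t p)"
  shows "holomorphic_action glued_top param_atlas \<Phi>"
  unfolding holomorphic_action_def holomorphic_map_def
proof (intro conjI ballI allI)
  show "continuous_map (prod_topology euclidean glued_top) glued_top (\<lambda>(t, p). \<Phi> t p)"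
    unfolding continuous_map_def
  proof (intro conjI allI impI)
    show "(\<lambda>(t, p). \<Phi> t p) \<in> topspace (prod_topology euclidean glued_top) \<rightarrow> topspace glued_top"
    proof (intro funcsetI)
      fix x assume x: "x \<in> topspace (prod_topology (euclidean :: 'g topology) glued_top)"
      obtain t p where tp: "x = (t, p)" by fastforce
      with x have "p \<in> topspace glued_top" by simp
      from loc[OF this, of t] obtain j y where "\<Phi> t p = par j y" by blast
      then show "(case x of (t, p) \<Rightarrow> \<Phi> t p) \<in> topspace glued_top" by (simp add: tp)
    qed
    fix U assume U: "openin glued_top U"
    let ?P = "{x \<in> topspace (prod_topology euclidean glued_top). (case x of (t, p) \<Rightarrow> \<Phi> t p) \<in> U}"
    show "openin (prod_topology euclidean glued_top) ?P"
    proof (subst openin_subopen, intro ballI)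
      fix x assume x: "x \<in> ?P"
      obtain t p where tp: "x = (t, p)" by fastforce
      with x have p: "p \<in> topspace glued_top" and pU: "\<Phi> t p \<in> U" by auto
      obtain i j z W F where W: "p = par i z" "open W" "(t, z) \<in> W" "F mholomorphic_on W"
          "\<And>s w. (s, w) \<in> W \<Longrightarrow> \<Phi> s (par i w) = par j (F (s, w))"
        using loc[OF p, of t] by blast
      have "open (par j -` U)" using U openin_glued_top by blast
      then have "open (W \<inter> F -` (par j -` U))"
        using mholomorphic_on_imp_continuous_on[OF W(4)] W(2) by (metis continuous_open_preimage)
      moreover have "(t, z) \<in> W \<inter> F -` (par j -` U)" using W pU by auto
      ultimately obtain A B where AB: "open A" "open B" "(t, z) \<in> A \<times> B"
          "A \<times> B \<subseteq> W \<inter> F -` (par j -` U)"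
        by (rule open_prod_elim)
      have "openin (prod_topology euclidean glued_top) (A \<times> par i ` B)"
        using AB(1,2) openin_par_image by (simp add: openin_prod_Times_iff)
      moreover have "x \<in> A \<times> par i ` B" using AB(3) tp W(1) by auto
      moreover have "A \<times> par i ` B \<subseteq> ?P"
      proof
        fix y assume "y \<in> A \<times> par i ` B"
        then obtain s w where y: "y = (s, par i w)" "s \<in> A" "w \<in> B" by blast
        then have "(s, w) \<in> W" "F (s, w) \<in> par j -` U" using AB(4) by auto
        then show "y \<in> ?P" using W(5) y(1) by simp
      qed
      ultimately show "\<exists>T. openin (prod_topology euclidean glued_top) T \<and> x \<in> T \<and> T \<subseteq> ?P" by blast
    qed
  qed
next
  fix c d assume "c \<in> prod_atlas (flat_atlas (UNIV :: 'g set)) param_atlas" "d \<in> param_atlas"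
  then obtain k l where
    c: "c = (UNIV \<times> range (par k), map_prod (\<lambda>z. z) (inv (par k)))" and d: "d = param_chart l"
    by (fastforce simp: prod_atlas_def flat_atlas_def param_chart_def)
  have ran: "UNIV \<times> range (par k) = range (\<lambda>(t::'g, z). (t, par k z))" by auto
  have ci: "chart_inv c = (\<lambda>(t, z). (t, par k z))"
    unfolding c fst_conv snd_conv ran by (rule inv_into_range_left_inverse) auto
  have "(\<lambda>x. inv (par l) (\<Phi> (fst x) (par k (snd x)))) mholomorphic_on
      {x. \<Phi> (fst x) (par k (snd x)) \<in> range (par l)}"
    unfolding mholomorphic_on_iff_cderiv[where v=0]
  proof
    fix x assume x: "x \<in> {x. \<Phi> (fst x) (par k (snd x)) \<in> range (par l)}"
    obtain t z where tz: "x = (t, z)" by fastforce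
    obtain i j z' W F where W: "par k z = par i z'" "open W" "(t, z') \<in> W" "F mholomorphic_on W"
        "\<And>s w. (s, w) \<in> W \<Longrightarrow> \<Phi> s (par i w) = par j (F (s, w))"
      using loc[of "par k z" t] by auto
    let ?O = "par k -` range (par i)" and ?P = "par j -` range (par l)"
    let ?tr = "\<lambda>w. inv (par i) (par k w)" and ?tr' = "\<lambda>w. inv (par l) (par j w)"
    have z': "?tr z = z'" by (simp add: W(1))
    have WP: "open (W \<inter> F -` ?P)"
      using mholomorphic_on_imp_continuous_on[OF W(4)] W(2) open_overlap
      by (metis continuous_open_preimage)
    have O: "open (UNIV \<times> ?O)" using open_overlap by (simp add: open_Times)
    have trc: "continuous_on (UNIV \<times> ?O) (\<lambda>x. (fst x, ?tr (snd x)))"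
      by (intro continuous_intros continuous_on_compose2[OF
            mholomorphic_on_imp_continuous_on[OF transition_holomorphic]]) auto
    let ?N = "(UNIV \<times> ?O) \<inter> (\<lambda>x. (fst x, ?tr (snd x))) -` (W \<inter> F -` ?P)"
    have N: "open ?N" using continuous_open_preimage[OF trc O WP] .
    have eq: "\<Phi> (fst y) (par k (snd y)) = par j (F (fst y, ?tr (snd y)))" if "y \<in> ?N" for y
    proof -
      from that have "par k (snd y) = par i (?tr (snd y))" by (auto simp: par_inv)
      moreover have "(fst y, ?tr (snd y)) \<in> W" using that by auto
      ultimately show ?thesis using W(5) by metis
    qed
    have xN: "x \<in> ?N"
      using x W z' unfolding tz by auto
    have "z \<in> ?O" using W(1) by auto
    then obtain d1 where d1: "cderiv ?tr z 0 d1"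
      using transition_holomorphic mholomorphic_onE by blast
    have "cderiv (\<lambda>x. snd x) x 0 (snd (0 :: 'g \<times> 'e))" by (rule cderiv_snd[OF cderiv_ident])
    then have "cderiv (\<lambda>x. snd x) x 0 0" by simp
    from cderiv_compose[OF this] d1 have "cderiv (\<lambda>x. ?tr (snd x)) x 0 d1" by (simp add: tz)
    from cderiv_Pair[OF cderiv_fst[OF cderiv_ident] this]
    have d2: "cderiv (\<lambda>x. (fst x, ?tr (snd x))) x 0 (fst (0 :: 'g \<times> 'e), d1)" .
    obtain d3 where d3: "cderiv F (fst x, ?tr (snd x)) (fst (0 :: 'g \<times> 'e), d1) d3"
      using W(3,4) z' tz mholomorphic_onE by (metis fst_conv snd_conv)
    have d4: "cderiv (\<lambda>x. F (fst x, ?tr (snd x))) x 0 d3" by (rule cderiv_compose[OF d2 d3])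
    have "F (fst x, ?tr (snd x)) \<in> ?P" using xN by auto
    then obtain d5 where d5: "cderiv ?tr' (F (fst x, ?tr (snd x))) d3 d5"
      using transition_holomorphic mholomorphic_onE by blast
    have "cderiv (\<lambda>x. inv (par l) (\<Phi> (fst x) (par k (snd x)))) x 0 d5"
      by (rule cderiv_transform[OF cderiv_compose[OF d4 d5] N xN]) (simp add: eq)
    then show "\<exists>d. cderiv (\<lambda>x. inv (par l) (\<Phi> (fst x) (par k (snd x)))) x 0 d" by blast
  qed
  moreover have "snd c ` {p \<in> fst c. (case p of (t, p) \<Rightarrow> \<Phi> t p) \<in> fst d} =
      {x. \<Phi> (fst x) (par k (snd x)) \<in> range (par l)}"
    by (force simp: c d image_iff)
  moreover have "snd d \<circ> (\<lambda>(t, p). \<Phi> t p) \<circ> chart_inv c =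
      (\<lambda>x. inv (par l) (\<Phi> (fst x) (par k (snd x))))"
    by (auto simp: d ci)
  ultimately show "(snd d \<circ> (\<lambda>(t, p). \<Phi> t p) \<circ> chart_inv c) mholomorphic_on
      (snd c ` {p \<in> fst c. (case p of (t, p) \<Rightarrow> \<Phi> t p) \<in> fst d})" by simp
qed (use zero add in auto)

text \<open>A biholomorphism onto an open subset of the model space becomes a chart-independent open
  embedding after composition with one parametrization.\<close>

lemma embedding_biholomorphic:
  fixes i :: 'i and G K :: "'e \<Rightarrow> 'e" and U :: "'e set"
  assumes U: "open U" and G: "G mholomorphic_on U" and GU: "open (G ` U)"
    and K: "K mholomorphic_on (G ` U)" and KG: "\<And>z. z \<in> U \<Longrightarrow> K (G z) = z"
  defines "\<psi> \<equiv> (\<lambda>z. par i (G z))"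
  shows "openin glued_top (\<psi> ` U)"
    and "biholomorphic_map (top_of_set U) (flat_atlas U)
      (subtopology glued_top (\<psi> ` U)) (restrict_atlas (\<psi> ` U) param_atlas) \<psi>"
proof -
  have img: "\<psi> ` U = par i ` (G ` U)" by (auto simp: \<psi>_def)
  show op: "openin glued_top (\<psi> ` U)" unfolding img by (rule openin_par_image[OF GU])
  have sub: "\<psi> ` U \<subseteq> topspace glued_top" using op openin_subset by blast
  have cG: "continuous_on U G" by (rule mholomorphic_on_imp_continuous_on[OF G])
  have cK: "continuous_on (G ` U) K" by (rule mholomorphic_on_imp_continuous_on[OF K])
  have id: "inv_into U (\<lambda>z. z) z = z" if "z \<in> U" for z
    using that by (intro inv_into_f_eq) auto
  define k where "k = (\<lambda>p. K (inv (par i) p))"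
  have k\<psi>: "k (\<psi> z) = z" if "z \<in> U" for z using that by (simp add: k_def \<psi>_def KG)
  have chart: "inv_into (range (par j) \<inter> \<psi> ` U) (inv (par j)) z = par j z"
    if "par j z \<in> \<psi> ` U" for j z
  proof (rule inv_into_f_eq)
    show "inj_on (inv (par j)) (range (par j) \<inter> \<psi> ` U)"
      by (rule inj_onI) (metis IntD1 par_inv)
  qed (use that in auto)
  have "holomorphic_map (top_of_set U) (flat_atlas U)
      (subtopology glued_top (\<psi> ` U)) (restrict_atlas (\<psi> ` U) param_atlas) \<psi>"
    unfolding holomorphic_map_def
  proof (intro conjI ballI)
    have "continuous_map (top_of_set U) glued_top \<psi>"
      unfolding \<psi>_def using continuous_map_compose[OF _ continuous_par, of "top_of_set U" G] cG
      by (simp add: comp_def)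
    then show "continuous_map (top_of_set U) (subtopology glued_top (\<psi> ` U)) \<psi>"
      by (simp add: continuous_map_in_subtopology)
  next
    fix c d assume "c \<in> flat_atlas U" "d \<in> restrict_atlas (\<psi> ` U) param_atlas"
    then obtain j where c: "c = (U, \<lambda>z. z)" and d: "d = (range (par j) \<inter> \<psi> ` U, inv (par j))"
      by (fastforce simp: flat_atlas_def restrict_atlas_def param_chart_def)
    have dom: "snd c ` {p \<in> fst c. \<psi> p \<in> fst d} = U \<inter> G -` (par i -` range (par j))"
      by (auto simp: c d \<psi>_def)
    have op': "open (U \<inter> G -` (par i -` range (par j)))"
      using continuous_open_preimage[OF cG U open_overlap] .
    have "(\<lambda>z. inv (par j) (par i (G z))) mholomorphic_on (U \<inter> G -` (par i -` range (par j)))"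
      by (rule mholomorphic_on_compose[OF mholomorphic_on_subset[OF G] transition_holomorphic]) auto
    then have "(snd d \<circ> \<psi> \<circ> chart_inv c) mholomorphic_on (U \<inter> G -` (par i -` range (par j)))"
      by (rule mholomorphic_on_transform[OF _ op']) (simp add: c d id \<psi>_def)
    then show "(snd d \<circ> \<psi> \<circ> chart_inv c) mholomorphic_on (snd c ` {p \<in> fst c. \<psi> p \<in> fst d})"
      by (simp only: dom)
  qed
  moreover have "holomorphic_map (subtopology glued_top (\<psi> ` U)) (restrict_atlas (\<psi> ` U) param_atlas)
      (top_of_set U) (flat_atlas U) k"
    unfolding holomorphic_map_def
  proof (intro conjI ballI)
    have "continuous_map (subtopology glued_top (\<psi> ` U)) (top_of_set (G ` U)) (inv (par i))"
    proof -
      have "subtopology glued_top (\<psi> ` U) = subtopology (subtopology glued_top (range (par i))) (\<psi> ` U)"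
        by (simp add: subtopology_subtopology img Int_absorb1 image_mono)
      then have "continuous_map (subtopology glued_top (\<psi> ` U)) euclidean (inv (par i))"
        using continuous_map_from_subtopology[OF continuous_inv_par] by metis
      then show ?thesis by (auto simp: continuous_map_in_subtopology img)
    qed
    moreover have "continuous_map (top_of_set (G ` U)) (top_of_set U) K"
      using cK KG by (auto simp: continuous_map_in_subtopology)
    ultimately have "continuous_map (subtopology glued_top (\<psi> ` U)) (top_of_set U) (K \<circ> inv (par i))"
      by (rule continuous_map_compose)
    then show "continuous_map (subtopology glued_top (\<psi> ` U)) (top_of_set U) k"
      by (simp only: k_def comp_def)
  next
    fix c d assume "c \<in> restrict_atlas (\<psi> ` U) param_atlas" "d \<in> flat_atlas U"
    then obtain j where d: "d = (U, \<lambda>z. z)" and c: "c = (range (par j) \<inter> \<psi> ` U, inv (par j))"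
      by (fastforce simp: flat_atlas_def restrict_atlas_def param_chart_def)
    have dom: "snd c ` {p \<in> fst c. k p \<in> fst d} = par j -` (\<psi> ` U)"
    proof -
      have "{p \<in> fst c. k p \<in> fst d} = {p \<in> range (par j). p \<in> \<psi> ` U}"
        using k\<psi> by (auto simp: c d)
      then have "snd c ` {p \<in> fst c. k p \<in> fst d} = inv (par j) ` {p \<in> range (par j). p \<in> \<psi> ` U}"
        by (simp only: c snd_conv)
      also have "\<dots> = par j -` (\<psi> ` U)" unfolding inv_par_image vimage_def ..
      finally show ?thesis .
    qed
    have op': "open (par j -` (\<psi> ` U))" using op openin_glued_top by blast
    have "(\<lambda>z. inv (par i) (par j z)) mholomorphic_on par j -` (\<psi> ` U)"
      by (rule mholomorphic_on_subset[OF transition_holomorphic]) (auto simp: \<psi>_def)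
    then have "(\<lambda>z. K (inv (par i) (par j z))) mholomorphic_on par j -` (\<psi> ` U)"
      by (rule mholomorphic_on_compose[OF _ K]) (auto simp: \<psi>_def)
    then have "(snd d \<circ> k \<circ> chart_inv c) mholomorphic_on par j -` (\<psi> ` U)"
      by (rule mholomorphic_on_transform[OF _ op']) (simp add: c d chart k_def)
    then show "(snd d \<circ> k \<circ> chart_inv c) mholomorphic_on (snd c ` {p \<in> fst c. k p \<in> fst d})"
      by (simp only: dom)
  qed
  ultimately show "biholomorphic_map (top_of_set U) (flat_atlas U)
      (subtopology glued_top (\<psi> ` U)) (restrict_atlas (\<psi> ` U) param_atlas) \<psi>"
    unfolding biholomorphic_map_def using sub k\<psi> by (auto intro!: exI[of _ k])
qed

lemma embedding_differential_sends:
  assumes U: "open U" and v: "field_compatible v"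
    and G: "\<And>z. z \<in> U \<Longrightarrow> cderiv G z (V z) (v i (G z))"
  shows "differential_sends (flat_atlas U) param_atlas (\<lambda>z. par i (G z)) (\<lambda>c. V) (chartwise_field v)"
  unfolding differential_sends_def
proof (intro ballI impI)
  fix c d p assume "c \<in> flat_atlas U" "d \<in> param_atlas" "p \<in> fst c" and pd: "par i (G p) \<in> fst d"
  then obtain j where c: "c = (U, \<lambda>z. z)" and d: "d = param_chart j" and p: "p \<in> U"
    by (auto simp: flat_atlas_def)
  have id: "inv_into U (\<lambda>z. z) z = z" if "z \<in> U" for z
    using that by (intro inv_into_f_eq) auto
  have "par i (G p) \<in> range (par j)" using pd by (simp add: d)
  from cderiv_compose[OF G[OF p] field_compatibleD[OF v this]]
  have "cderiv (snd d \<circ> (\<lambda>z. par i (G z)) \<circ> chart_inv c) p (V p) (v j (inv (par j) (par i (G p))))"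
    by (rule cderiv_transform[OF _ U p]) (simp add: c d id)
  then have "frechet_derivative (snd d \<circ> (\<lambda>z. par i (G z)) \<circ> chart_inv c) (at p) (V p) =
      v j (inv (par j) (par i (G p)))"
    by (rule cderiv_frechet_derivative)
  then show "frechet_derivative (snd d \<circ> (\<lambda>z. par i (G z)) \<circ> chart_inv c) (at (snd c p)) (V p) =
      chartwise_field v d (par i (G p))"
    by (simp only: c d chartwise_field_param_chart snd_conv)
qed

end

section \<open>The surface glued from two copies of the plane\<close>

text \<open>The complement of the coordinate axes, along which the two planes are glued.\<close>

definition torus :: "(complex \<times> complex) set"
  where "torus = {z. fst z \<noteq> 0 \<and> snd z \<noteq> 0}"

lemma open_torus: "open torus"
  unfolding torus_def
  by (intro open_Collect_conj open_Collect_neq continuous_intros)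

text \<open>The exponents of \<open>u = x\<^sup>a y\<^sup>b\<close> and \<open>v = x\<^sup>n y\<^sup>m\<close> form an integer matrix of determinant \<open>\<plusminus>1\<close>, so
  its inverse is integral too.\<close>

locale monomial_coordinates =
  fixes a b m n :: nat and e :: int
  assumes a_pos: "a > 0" and b_pos: "b > 0" and m_pos: "m > 0" and n_pos: "n > 0"
    and det: "int a * int m - int b * int n = e" and e_unit: "e \<in> {-1, 1}"
begin

lemma e_sq [simp]: "e * e = 1"
  using e_unit by auto

lemma e_sq_complex [simp]: "of_int e * of_int e = (1::complex)"
  by (metis e_sq of_int_1 of_int_mult)

lemma det_complex: "(of_int e :: complex) = of_nat a * of_nat m - of_nat b * of_nat n"
  unfolding det[symmetric] by simp

definition mono_u :: "complex \<times> complex \<Rightarrow> complex"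
  where "mono_u z = fst z ^ a * snd z ^ b"

definition mono_v :: "complex \<times> complex \<Rightarrow> complex"
  where "mono_v z = fst z ^ n * snd z ^ m"

text \<open>The lift to \<open>(x, y)\<close> of the rescaling \<open>(u, v) \<mapsto> (u / P, v / Q)\<close>. The exponents are the entries
  of the inverse of the exponent matrix, with the opposite sign. The formula makes sense on the
  axes, where \<open>u\<close> and \<open>v\<close> vanish and no longer determine the point.\<close>

definition twist :: "complex \<Rightarrow> complex \<Rightarrow> complex \<times> complex \<Rightarrow> complex \<times> complex"
  where "twist P Q z =
    (fst z * P powi (- (e * int m)) * Q powi (e * int b),
     snd z * P powi (e * int n) * Q powi (- (e * int a)))"

lemma power_int_scale:
  fixes P Q :: complex
  assumes "P \<noteq> 0" "Q \<noteq> 0"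
  shows "(P powi i * Q powi j) ^ k * (P powi i' * Q powi j') ^ k' =
    P powi (i * int k + i' * int k') * Q powi (j * int k + j' * int k')"
  using assms by (simp add: power_mult_distrib power_int_add power_int_mult)

lemma mono_u_twist: "P \<noteq> 0 \<Longrightarrow> Q \<noteq> 0 \<Longrightarrow> mono_u (twist P Q z) = mono_u z / P"
proof -
  assume PQ: "P \<noteq> 0" "Q \<noteq> 0"
  have "- (e * int m) * int a + e * int n * int b = - (e * (int a * int m - int b * int n))"
    by (simp add: algebra_simps)
  then have 1: "- (e * int m) * int a + e * int n * int b = -1" by (simp add: det)
  have 2: "e * int b * int a + - (e * int a) * int b = 0" by simp
  have "mono_u (twist P Q z) = mono_u z * ((P powi (- (e * int m)) * Q powi (e * int b)) ^ a *
      (P powi (e * int n) * Q powi (- (e * int a))) ^ b)"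
    by (simp add: mono_u_def twist_def power_mult_distrib algebra_simps)
  also have "\<dots> = mono_u z / P"
    unfolding power_int_scale[OF PQ] 1 2 by (simp add: power_int_minus field_simps)
  finally show ?thesis .
qed

lemma mono_v_twist: "P \<noteq> 0 \<Longrightarrow> Q \<noteq> 0 \<Longrightarrow> mono_v (twist P Q z) = mono_v z / Q"
proof -
  assume PQ: "P \<noteq> 0" "Q \<noteq> 0"
  have "e * int b * int n + - (e * int a) * int m = - (e * (int a * int m - int b * int n))"
    by (simp add: algebra_simps)
  then have 1: "e * int b * int n + - (e * int a) * int m = -1" by (simp add: det)
  have 2: "- (e * int m) * int n + e * int n * int m = 0" by simp
  have "mono_v (twist P Q z) = mono_v z * ((P powi (- (e * int m)) * Q powi (e * int b)) ^ n *
      (P powi (e * int n) * Q powi (- (e * int a))) ^ m)"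
    by (simp add: mono_v_def twist_def power_mult_distrib algebra_simps)
  also have "\<dots> = mono_v z / Q"
    unfolding power_int_scale[OF PQ] 1 2 by (simp add: power_int_minus field_simps)
  finally show ?thesis .
qed

lemma twist_twist: "twist P Q (twist P' Q' z) = twist (P * P') (Q * Q') z"
  by (simp add: twist_def power_int_mult_distrib)

lemma twist_one [simp]: "twist 1 1 z = z"
  by (simp add: twist_def)

lemma twist_in_torus: "P \<noteq> 0 \<Longrightarrow> Q \<noteq> 0 \<Longrightarrow> twist P Q z \<in> torus \<longleftrightarrow> z \<in> torus"
  by (simp add: twist_def torus_def power_int_eq_0_iff)

lemma mono_nonzero: "z \<in> torus \<Longrightarrow> mono_u z \<noteq> 0" "z \<in> torus \<Longrightarrow> mono_v z \<noteq> 0"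
  by (simp_all add: mono_u_def mono_v_def torus_def)

lemma mono_zero: "z \<notin> torus \<Longrightarrow> mono_u z = 0" "z \<notin> torus \<Longrightarrow> mono_v z = 0"
  using a_pos b_pos m_pos n_pos by (auto simp: mono_u_def mono_v_def torus_def)

text \<open>The coordinates \<open>s = 1/u\<close>, \<open>r = 1/v\<close>, and their inverse on the torus: the point \<open>(1, 1)\<close> has
  \<open>u = v = 1\<close>, so rescaling it by \<open>(s, r)\<close> gives a point with \<open>u = 1/s\<close> and \<open>v = 1/r\<close>.\<close>

definition to_recip :: "complex \<times> complex \<Rightarrow> complex \<times> complex"
  where "to_recip z = (1 / mono_u z, 1 / mono_v z)"

definition of_recip :: "complex \<times> complex \<Rightarrow> complex \<times> complex"
  where "of_recip q = twist (fst q) (snd q) (1, 1)"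

lemma to_recip_twist:
  "P \<noteq> 0 \<Longrightarrow> Q \<noteq> 0 \<Longrightarrow>
    to_recip (twist P Q z) = (P * fst (to_recip z), Q * snd (to_recip z))"
  by (simp add: to_recip_def mono_u_twist mono_v_twist)

lemma to_recip_of_recip: "q \<in> torus \<Longrightarrow> to_recip (of_recip q) = q"
  by (simp add: of_recip_def to_recip_twist torus_def) (simp add: to_recip_def mono_u_def mono_v_def)

lemma to_recip_in_torus: "z \<in> torus \<Longrightarrow> to_recip z \<in> torus"
  using mono_nonzero[of z] by (simp add: to_recip_def torus_def)

lemma of_recip_in_torus: "q \<in> torus \<Longrightarrow> of_recip q \<in> torus"
  by (simp add: of_recip_def twist_def torus_def power_int_eq_0_iff)

lemma of_recip_to_recip: "z \<in> torus \<Longrightarrow> of_recip (to_recip z) = z"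
proof -
  assume z: "z \<in> torus"
  obtain x y where xy: "z = (x, y)" by fastforce
  have nz: "x \<noteq> 0" "y \<noteq> 0" using z by (auto simp: xy torus_def)
  have pw: "(1 / (x ^ k * y ^ l)) powi i = x powi (- (int k * i)) * y powi (- (int l * i))" for k l i
    using nz by (simp add: power_int_mult_distrib power_int_mult power_int_minus power_int_inverse power_int_divide_distrib
        divide_inverse flip: power_int_of_nat)
  have 1: "- (int a * - (e * int m)) + - (int n * (e * int b)) = 1"
    "- (int a * (e * int n)) + - (int n * - (e * int a)) = 0"
    "- (int b * - (e * int m)) + - (int m * (e * int b)) = 0"
    "- (int b * (e * int n)) + - (int m * - (e * int a)) = 1"
  proof -
    have "e * (int a * int m - int b * int n) = 1" by (simp add: det)
    then show "- (int a * - (e * int m)) + - (int n * (e * int b)) = 1"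
      "- (int b * (e * int n)) + - (int m * - (e * int a)) = 1"
      by (simp_all add: algebra_simps)
  qed (simp_all add: algebra_simps)
  have "x powi (- (int a * - (e * int m))) * y powi (- (int b * - (e * int m))) *
      (x powi (- (int n * (e * int b))) * y powi (- (int m * (e * int b)))) =
      x powi (- (int a * - (e * int m)) + - (int n * (e * int b))) *
      y powi (- (int b * - (e * int m)) + - (int m * (e * int b)))"
    unfolding power_int_add[OF disjI1[OF nz(1)]] power_int_add[OF disjI1[OF nz(2)]]
    by (simp only: mult_ac)
  moreover have "x powi (- (int a * (e * int n))) * y powi (- (int b * (e * int n))) *
      (x powi (- (int n * - (e * int a))) * y powi (- (int m * - (e * int a)))) =
      x powi (- (int a * (e * int n)) + - (int n * - (e * int a))) *
      y powi (- (int b * (e * int n)) + - (int m * - (e * int a)))"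
    unfolding power_int_add[OF disjI1[OF nz(1)]] power_int_add[OF disjI1[OF nz(2)]]
    by (simp only: mult_ac)
  ultimately show ?thesis
    unfolding of_recip_def to_recip_def twist_def mono_u_def mono_v_def xy fst_conv snd_conv pw 1
    by simp
qed

lemma cderiv_mono_u:
  "cderiv mono_u z (fst z * \<xi>, snd z * \<zeta>) (mono_u z * (of_nat a * \<xi> + of_nat b * \<zeta>))"
proof -
  have "cderiv (\<lambda>z. fst z) z (fst z * \<xi>, snd z * \<zeta>) (fst z * \<xi>)"
    "cderiv (\<lambda>z. snd z) z (fst z * \<xi>, snd z * \<zeta>) (snd z * \<zeta>)"
    using cderiv_fst_snd[of z "(fst z * \<xi>, snd z * \<zeta>)"] by simp_all
  from cderiv_log_mult[OF cderiv_log_power[OF this(1), of a] cderiv_log_power[OF this(2), of b]]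
  show ?thesis unfolding mono_u_def .
qed

lemma cderiv_mono_v:
  "cderiv mono_v z (fst z * \<xi>, snd z * \<zeta>) (mono_v z * (of_nat n * \<xi> + of_nat m * \<zeta>))"
proof -
  have "cderiv (\<lambda>z. fst z) z (fst z * \<xi>, snd z * \<zeta>) (fst z * \<xi>)"
    "cderiv (\<lambda>z. snd z) z (fst z * \<xi>, snd z * \<zeta>) (snd z * \<zeta>)"
    using cderiv_fst_snd[of z "(fst z * \<xi>, snd z * \<zeta>)"] by simp_all
  from cderiv_log_mult[OF cderiv_log_power[OF this(1), of n] cderiv_log_power[OF this(2), of m]]
  show ?thesis unfolding mono_v_def .
qed

lemma cderiv_mono_zero: "cderiv mono_u z 0 0" "cderiv mono_v z 0 0"
  using cderiv_mono_u[of z 0 0] cderiv_mono_v[of z 0 0] by (simp_all add: zero_prod_def)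

lemma continuous_mono: "continuous_on S mono_u" "continuous_on S mono_v"
  unfolding mono_u_def mono_v_def by (intro continuous_intros)+

lemma cderiv_to_recip:
  assumes "z \<in> torus"
  shows "cderiv to_recip z (fst z * \<xi>, snd z * \<zeta>)
    (- (fst (to_recip z) * (of_nat a * \<xi> + of_nat b * \<zeta>)),
     - (snd (to_recip z) * (of_nat n * \<xi> + of_nat m * \<zeta>)))"
proof -
  note nz = mono_nonzero[OF assms]
  have "cderiv (\<lambda>z. (mono_u z powi (-1), mono_v z powi (-1))) z (fst z * \<xi>, snd z * \<zeta>)
    (mono_u z powi (-1) * (of_int (-1) * (of_nat a * \<xi> + of_nat b * \<zeta>)),
     mono_v z powi (-1) * (of_int (-1) * (of_nat n * \<xi> + of_nat m * \<zeta>)))"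
    by (intro cderiv_Pair cderiv_log_power_int cderiv_mono_u cderiv_mono_v nz)
  moreover have "to_recip = (\<lambda>z. (mono_u z powi (-1), mono_v z powi (-1)))"
    by (rule ext) (simp add: to_recip_def power_int_minus divide_inverse)
  ultimately show ?thesis by (simp add: right_diff_distrib distrib_left)
qed

lemma cderiv_twist:
  fixes P Q :: "'a::complex_normed_vector \<Rightarrow> complex" and F :: "'a \<Rightarrow> complex \<times> complex"
  assumes "cderiv P p w (P p * \<pi>)" "cderiv Q p w (Q p * \<rho>)"
    "cderiv F p w (fst (F p) * \<xi>, snd (F p) * \<zeta>)" "P p \<noteq> 0" "Q p \<noteq> 0"
  shows "cderiv (\<lambda>z. twist (P z) (Q z) (F z)) p w
    (fst (twist (P p) (Q p) (F p)) * (\<xi> - of_int e * of_nat m * \<pi> + of_int e * of_nat b * \<rho>),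
     snd (twist (P p) (Q p) (F p)) * (\<zeta> + of_int e * of_nat n * \<pi> - of_int e * of_nat a * \<rho>))"
proof -
  have F: "cderiv (\<lambda>z. fst (F z)) p w (fst (F p) * \<xi>)" "cderiv (\<lambda>z. snd (F z)) p w (snd (F p) * \<zeta>)"
    using cderiv_fst[OF assms(3)] cderiv_snd[OF assms(3)] by simp_all
  note P = cderiv_log_power_int[OF assms(1,4)] and Q = cderiv_log_power_int[OF assms(2,5)]
  have "cderiv (\<lambda>z. twist (P z) (Q z) (F z)) p w
    (fst (F p) * P p powi (- (e * int m)) * Q p powi (e * int b) *
       (\<xi> + of_int (- (e * int m)) * \<pi> + of_int (e * int b) * \<rho>),
     snd (F p) * P p powi (e * int n) * Q p powi (- (e * int a)) *
       (\<zeta> + of_int (e * int n) * \<pi> + of_int (- (e * int a)) * \<rho>))"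
    unfolding twist_def by (intro cderiv_Pair cderiv_log_mult P Q F)
  then show ?thesis by (simp add: twist_def)
qed

lemma to_recip_holomorphic: "to_recip mholomorphic_on torus"
  unfolding mholomorphic_on_iff_cderiv_zero
  using cderiv_to_recip[of _ 0 0] by (simp add: zero_prod_def)

lemma of_recip_holomorphic: "of_recip mholomorphic_on torus"
  unfolding mholomorphic_on_iff_cderiv_zero
proof
  fix q assume q: "q \<in> torus"
  have "cderiv (\<lambda>q. twist (fst q) (snd q) (1, 1)) q 0
    (fst (twist (fst q) (snd q) (1, 1)) * (0 - of_int e * of_nat m * 0 + of_int e * of_nat b * 0),
     snd (twist (fst q) (snd q) (1, 1)) * (0 + of_int e * of_nat n * 0 - of_int e * of_nat a * 0))"
    by (rule cderiv_twist)
      (use q cderiv_fst_snd[of q 0] cderiv_const[of "(1,1)" q 0] in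
        \<open>simp_all add: torus_def zero_prod_def\<close>)
  then show "cderiv of_recip q 0 0" unfolding of_recip_def by (simp add: zero_prod_def)
qed

text \<open>\<open>par False\<close> parametrizes the points of the \<open>(s, r)\<close>-plane and \<open>par True\<close> those of the
  \<open>(x, y)\<close>-plane. A point common to both is stored by its reciprocal coordinates with the label
  \<open>(1, 0)\<close>; the label \<open>(0, 0)\<close> marks the points of the two axes. The singletons only serve to obtain
  values of the type of points, which is a type of sets.\<close>

fun par :: "bool \<Rightarrow> complex \<times> complex \<Rightarrow> surface_point"
  where "par True z = (if z \<in> torus then {((1, 0), to_recip z)} else {((0, 0), z)})"
  | "par False q = {((1, 0), q)}"

lemma par_False_range_iff: "par True z \<in> range (par False) \<longleftrightarrow> z \<in> torus"
  by auto

lemma par_True_range_iff: "par False q \<in> range (par True) \<longleftrightarrow> q \<in> torus"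
proof
  assume "q \<in> torus"
  then have "par False q = par True (of_recip q)"
    by (simp add: of_recip_in_torus to_recip_of_recip)
  then show "par False q \<in> range (par True)" by blast
next
  assume "par False q \<in> range (par True)"
  then obtain z where z: "par False q = par True z" by blast
  then have "z \<in> torus" by (auto split: if_splits)
  with z show "q \<in> torus" using to_recip_in_torus by auto
qed

lemma par_injective: "inj (par i)"
proof -
  have "inj (par True)"
  proof (rule injI)
    fix z w assume eq: "par True z = par True w"
    then consider "z \<in> torus" "w \<in> torus" "to_recip z = to_recip w" | "z = w"
      by (auto split: if_splits)
    then show "z = w"
    proof cases
      case 1
      then show ?thesis by (metis of_recip_to_recip)
    qed
  qed
  moreover have "inj (par False)" by (auto intro: injI)
  ultimately show ?thesis by (cases i) simp_all
qed

lemma inv_par_same: "inv (par i) (par i z) = z"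
  by (simp add: par_injective del: par.simps)

lemma inv_par_False_True: "z \<in> torus \<Longrightarrow> inv (par False) (par True z) = to_recip z"
  using inv_par_same[of False "to_recip z"] by simp

lemma inv_par_True_False: "q \<in> torus \<Longrightarrow> inv (par True) (par False q) = of_recip q"
  using inv_par_same[of True "of_recip q"] by (simp add: of_recip_in_torus to_recip_of_recip)

lemma par_overlap: "par i -` range (par j) = (if i = j then UNIV else torus)"
proof -
  have "par True -` range (par False) = torus" "par False -` range (par True) = torus"
    using par_False_range_iff par_True_range_iff unfolding vimage_def by blast+
  moreover have "par i -` range (par i) = UNIV" by blast
  ultimately show ?thesis by (cases i; cases j) simp_all
qed

sublocale holomorphic_parametrizations par
proof
  show "inj (par i)" for i by (rule par_injective)
  have "(0, 0) \<notin> torus" by (simp add: torus_def)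
  then have "par True \<noteq> par False"
    using par_False_range_iff by (metis rangeI)
  then show "inj par"
    unfolding inj_def by (metis (full_types))
  show "open (par i -` range (par j))" for i j by (simp add: par_overlap open_torus)
  show "(\<lambda>z. inv (par j) (par i z)) mholomorphic_on (par i -` range (par j))" for i j
  proof (cases "i = j")
    case True
    then show ?thesis
      by (simp add: inv_par_same par_overlap mholomorphic_on_iff_cderiv_zero cderiv_ident)
  next
    case False
    have "(\<lambda>z. inv (par j) (par i z)) mholomorphic_on torus"
    proof (cases i)
      case True
      with False have "j = False" by simp
      with True show ?thesis
        by (intro mholomorphic_on_transform[OF to_recip_holomorphic open_torus])
          (simp add: inv_par_False_True del: par.simps)
    next
      case i: False
      with False have "j = True" by simp
      with i show ?thesis
        by (intro mholomorphic_on_transform[OF of_recip_holomorphic open_torus])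
          (simp add: inv_par_True_False del: par.simps)
    qed
    then show ?thesis using False by (simp add: par_overlap)
  qed
qed

declare par.simps [simp del]

lemma topspace_cases:
  assumes "p \<in> topspace glued_top"
  obtains q where "p = par False q" | z where "p = par True z" "z \<notin> torus"
proof -
  from assms obtain i z where "p = par i z" by (auto simp: topspace_glued_top)
  then show thesis
    using that by (cases i) (metis (full_types) par_False_range_iff imageE)+
qed

lemma par_True_torus: "z \<in> torus \<Longrightarrow> par True z = par False (to_recip z)"
  by (simp add: par.simps)

text \<open>Only a point of an axis and a point \<open>(s, r)\<close> of the other plane need an argument. They are
  separated by \<open>\<bar>u\<bar> < 1/K\<close> and \<open>\<bar>s\<bar> < K\<close>, since \<open>s u = 1\<close> at common points.\<close>

lemma Hausdorff_glued_top: "Hausdorff_space glued_top"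
proof -
  have same: "\<exists>U V. openin glued_top U \<and> openin glued_top V \<and> p \<in> U \<and> q \<in> V \<and> disjnt U V"
    if pq: "p \<noteq> q" "p = par i z" "q = par i w" for p q i z w
  proof -
    have "z \<noteq> w" using pq by blast
    then obtain A B where AB: "open A" "open B" "z \<in> A" "w \<in> B" "A \<inter> B = {}"
      using hausdorff by metis
    then have "disjnt (par i ` A) (par i ` B)" by (auto simp: disjnt_def)
    then show ?thesis using AB openin_par_image pq(2,3) by blast
  qed
  have mixed: "\<exists>U V. openin glued_top U \<and> openin glued_top V \<and> par True z \<in> U \<and> par False q \<in> V \<and> disjnt U V"
    if z: "z \<notin> torus" for z q
  proof -
    define K where "K = cmod (fst q) + 1"
    have K: "K > 0" unfolding K_def by (simp add: add_nonneg_pos)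
    let ?A = "{w. cmod (mono_u w) * K < 1}" and ?B = "{s. cmod (fst s) < K}"
    have "continuous_on UNIV mono_u" unfolding mono_u_def by (intro continuous_intros)
    then have A: "open ?A" by (intro open_Collect_less continuous_intros)
    have B: "open ?B" by (intro open_Collect_less continuous_intros)
    have "disjnt (par True ` ?A) (par False ` ?B)"
      unfolding disjnt_iff
    proof safe
      fix w s t assume w: "cmod (mono_u w) * K < 1" and s: "cmod (fst (s, t)) < K"
        and eq: "par True w = par False (s, t)"
      have wt: "w \<in> torus" using par_False_range_iff eq by blast
      then have "(s, t) = to_recip w" using eq par_True_torus by simp
      then have "s * mono_u w = 1" using mono_nonzero[OF wt] by (simp add: to_recip_def)
      then have "cmod s * cmod (mono_u w) = 1" by (metis norm_mult norm_one)
      moreover have "cmod s * cmod (mono_u w) \<le> K * cmod (mono_u w)"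
        using s by (intro mult_right_mono) auto
      ultimately show False using w by (simp add: mult.commute)
    qed
    moreover have "z \<in> ?A" using mono_zero[OF z] by simp
    moreover have "q \<in> ?B" by (simp add: K_def)
    ultimately show ?thesis using openin_par_image[OF A] openin_par_image[OF B] by blast
  qed
  show ?thesis unfolding Hausdorff_space_def
  proof (intro allI impI)
    fix p q assume "p \<in> topspace glued_top \<and> q \<in> topspace glued_top \<and> p \<noteq> q"
    then have p: "p \<in> topspace glued_top" and q: "q \<in> topspace glued_top" and pq: "p \<noteq> q" by auto
    show "\<exists>U V. openin glued_top U \<and> openin glued_top V \<and> p \<in> U \<and> q \<in> V \<and> disjnt U V"
    proof (rule topspace_cases[OF p]; rule topspace_cases[OF q])
      fix p' q' assume "p = par False p'" "q = par False q'"
      then show ?thesis by (rule same[OF pq])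
    next
      fix p' q' assume "p = par True p'" "q = par True q'"
      then show ?thesis by (rule same[OF pq])
    next
      fix p' q' assume "p = par True p'" "p' \<notin> torus" "q = par False q'"
      then show ?thesis using mixed[of p' q'] by simp
    next
      fix p' q' assume pq': "p = par False p'" "q = par True q'" and "q' \<notin> torus"
      then obtain U V where UV: "openin glued_top U" "openin glued_top V" "q \<in> U" "p \<in> V" "disjnt U V"
        using mixed[of q' p'] by auto
      then have "openin glued_top V \<and> openin glued_top U \<and> p \<in> V \<and> q \<in> U \<and> disjnt V U"
        by (simp add: disjnt_sym)
      then show ?thesis by (intro exI)
    qed
  qed
qed

lemma connected_glued_top: "connected_space glued_top"
proof -
  have con: "connectedin glued_top (range (par i))" for i
    by (rule connectedin_continuous_map_image[OF continuous_par]) (simp only: connectedin_iff_connected connected_UNIV)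
  have "(1, 1) \<in> torus" by (simp add: torus_def)
  then have "par True (1, 1) \<in> range (par True) \<inter> range (par False)"
    using par_False_range_iff by blast
  then have "connectedin glued_top (range (par True) \<union> range (par False))"
    using con[of True] con[of False] by (intro connectedin_Un) blast+
  moreover have "range (par True) \<union> range (par False) = topspace glued_top"
    by (auto simp: topspace_glued_top UNIV_bool)
  ultimately show ?thesis by (metis connectedin_topspace)
qed

lemma complex_surface_glued_top: "complex_surface glued_top param_atlas"
  by (simp add: complex_surface_def complex_manifold_glued_top connected_glued_top)

text \<open>The \<open>(s, r)\<close>-plane together with growing balls of the \<open>(x, y)\<close>-plane is an increasing open cover
  without a finite subcover: far points of the axes are reached late.\<close>

lemma noncompact_glued_top: "\<not> compact_space glued_top"
proof
  assume "compact_space glued_top"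
  define W where "W = (\<lambda>k::nat. range (par False) \<union> par True ` ball 0 (real k))"
  have op: "openin glued_top (W k)" for k
    unfolding W_def by (intro openin_Un openin_range_par openin_par_image) simp
  have mono: "W k \<subseteq> W l" if "k \<le> l" for k l
    unfolding W_def using that by auto
  have cov: "topspace glued_top \<subseteq> \<Union> (range W)"
  proof
    fix p assume "p \<in> topspace glued_top"
    then show "p \<in> \<Union> (range W)"
    proof (cases rule: topspace_cases)
      case (2 z)
      obtain k :: nat where "norm z < real k" using reals_Archimedean2 by blast
      then have "p \<in> W k" using 2 by (auto simp: W_def)
      then show ?thesis by blast
    qed (auto simp: W_def)
  qed
  with \<open>compact_space glued_top\<close> op obtain \<F> where F: "finite \<F>" "\<F> \<subseteq> range W" "topspace glued_top \<subseteq> \<Union>\<F>"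
    unfolding compact_space_alt by (metis (no_types, lifting) rangeE)
  then obtain I where I: "finite I" "\<F> = W ` I" by (meson finite_subset_image)
  define k where "k = Max (insert 0 I)"
  have sub: "\<Union>\<F> \<subseteq> W k"
    unfolding I(2) k_def using mono I(1) by (meson Max_ge UN_least finite_insert insertCI)
  define z where "z = (of_nat k :: complex, 0 :: complex)"
  have zt: "z \<notin> torus" by (simp add: z_def torus_def)
  have "par True z \<in> W k" using sub F(3) par_in_topspace by blast
  then have "par True z \<in> par True ` ball 0 (real k)"
    using zt par_False_range_iff by (auto simp: W_def)
  then have "z \<in> ball 0 (real k)" by auto
  then show False by (simp add: z_def norm_Pair)
qed

end

section \<open>The model action\<close>

text \<open>The condition \<open>\<kappa> \<mu> = 0\<close> keeps the flow simple: \<open>r\<close> moves either linearly or by translations.\<close>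

locale model_action = monomial_coordinates +
  fixes c \<kappa> \<mu> :: complex
  assumes \<kappa>\<mu>: "\<kappa> * \<mu> = 0"
begin

abbreviation ee :: complex where "ee \<equiv> of_int e"

text \<open>The pair \<open>l\<close> selects the combination \<open>fst l X + snd l Y\<close> of the two model fields. On the
  \<open>(x, y)\<close>-plane it is \<open>x \<xi> \<partial>\<^sub>x + y \<zeta> \<partial>\<^sub>y\<close> with rates \<open>\<xi>\<close>, \<open>\<zeta>\<close> that depend on \<open>u\<close> and \<open>v\<close> only.\<close>

definition model_xi :: "complex \<times> complex \<Rightarrow> complex \<times> complex \<Rightarrow> complex"
  where "model_xi l z = fst l * of_nat m * mono_u z +
    snd l * (c * mono_u z - of_nat b * of_nat m * (\<kappa> + \<mu> * mono_v z))"

definition model_zeta :: "complex \<times> complex \<Rightarrow> complex \<times> complex \<Rightarrow> complex"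
  where "model_zeta l z = - (fst l * of_nat n * mono_u z) +
    snd l * (of_nat a * of_nat m * (\<kappa> + \<mu> * mono_v z) - of_nat n / of_nat m * c * mono_u z)"

fun model_field :: "complex \<times> complex \<Rightarrow> bool \<Rightarrow> complex \<times> complex \<Rightarrow> complex \<times> complex"
  where "model_field l True z = (fst z * model_xi l z, snd z * model_zeta l z)"
  | "model_field l False q = (- (ee * (fst l + snd l * c / of_nat m)),
      - (ee * of_nat m * snd l * (\<kappa> * snd q + \<mu>)))"

lemma m_nonzero [simp]: "m \<noteq> 0"
  using m_pos by simp

lemma model_rate_u:
  "of_nat a * model_xi l z + of_nat b * model_zeta l z =
    ee * (fst l + snd l * c / of_nat m) * mono_u z"
  unfolding model_xi_def model_zeta_def det_complex by (simp add: field_simps)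

lemma model_rate_v:
  "of_nat n * model_xi l z + of_nat m * model_zeta l z =
    ee * of_nat m * snd l * (\<kappa> + \<mu> * mono_v z)"
  unfolding model_xi_def model_zeta_def det_complex by (simp add: field_simps)

lemma cderiv_to_recip_model:
  assumes "z \<in> torus"
  shows "cderiv to_recip z (model_field l True z) (model_field l False (to_recip z))"
proof -
  note nz = mono_nonzero[OF assms]
  have 1: "fst (to_recip z) * (ee * (fst l + snd l * c / of_nat m) * mono_u z) =
      ee * (fst l + snd l * c / of_nat m)"
    using nz by (simp add: to_recip_def)
  have 2: "snd (to_recip z) * (ee * of_nat m * snd l * (\<kappa> + \<mu> * mono_v z)) =
      ee * of_nat m * snd l * (\<kappa> * snd (to_recip z) + \<mu>)"
    using nz by (simp add: to_recip_def field_simps)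
  show ?thesis
    using cderiv_to_recip[OF assms, of "model_xi l z" "model_zeta l z"]
    unfolding model_rate_u model_rate_v 1 2 by simp
qed

lemma cderiv_of_recip_model:
  assumes "q \<in> torus"
  shows "cderiv of_recip q (model_field l False q) (model_field l True (of_recip q))"
proof -
  have z: "of_recip q \<in> torus" by (rule of_recip_in_torus[OF assms])
  have "cderiv of_recip (to_recip (of_recip q)) (model_field l False (to_recip (of_recip q)))
      (model_field l True (of_recip q))"
    by (rule cderiv_left_inverse[OF cderiv_to_recip_model[OF z] of_recip_holomorphic _ open_torus z])
      (simp_all add: to_recip_in_torus z of_recip_to_recip)
  then show ?thesis by (simp only: to_recip_of_recip[OF assms])
qed

lemma field_compatible_model: "field_compatible (model_field l)"
  unfolding field_compatible_def
proof (intro allI impI)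
  fix i j z assume ij: "par i z \<in> range (par j)"
  then have z: "i \<noteq> j \<Longrightarrow> z \<in> torus"
    using par_overlap[of i j] by (auto split: if_splits)
  consider "i = j" | "i" "\<not> j" | "\<not> i" "j" by blast
  then show "cderiv (\<lambda>w. inv (par j) (par i w)) z (model_field l i z)
      (model_field l j (inv (par j) (par i z)))"
  proof cases
    case 1
    then show ?thesis using cderiv_ident by simp
  next
    case 2
    with z have zt: "z \<in> torus" by blast
    have "cderiv (\<lambda>w. inv (par False) (par True w)) z (model_field l True z)
        (model_field l False (to_recip z))"
      by (rule cderiv_transform[OF cderiv_to_recip_model[OF zt] open_torus zt])
        (simp add: inv_par_False_True)
    then show ?thesis using 2 by (simp add: inv_par_False_True[OF zt])
  next
    case 3
    with z have zt: "z \<in> torus" by blast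
    have "cderiv (\<lambda>w. inv (par True) (par False w)) z (model_field l False z)
        (model_field l True (of_recip z))"
      by (rule cderiv_transform[OF cderiv_of_recip_model[OF zt] open_torus zt])
        (simp add: inv_par_True_False)
    then show ?thesis using 3 by (simp add: inv_par_True_False[OF zt])
  qed
qed

lemma cderiv_model_field_True:
  "cderiv (model_field l True) z (fst z * \<xi>, snd z * \<zeta>)
    (fst z * (\<xi> * model_xi l z + (fst l * of_nat m + snd l * c) * (mono_u z * (of_nat a * \<xi> + of_nat b * \<zeta>))
       - snd l * (of_nat b * of_nat m * \<mu> * (mono_v z * (of_nat n * \<xi> + of_nat m * \<zeta>)))),
     snd z * (\<zeta> * model_zeta l z - (fst l * of_nat n + snd l * (of_nat n / of_nat m * c)) * (mono_u z * (of_nat a * \<xi> + of_nat b * \<zeta>))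
       + snd l * (of_nat a * of_nat m * \<mu> * (mono_v z * (of_nat n * \<xi> + of_nat m * \<zeta>)))))"
  (is "cderiv _ z ?w (?d1, ?d2)")
proof -
  have u: "cderiv mono_u z ?w (mono_u z * (of_nat a * \<xi> + of_nat b * \<zeta>))" (is "cderiv _ _ _ ?du")
    by (rule cderiv_mono_u)
  have v: "cderiv mono_v z ?w (mono_v z * (of_nat n * \<xi> + of_nat m * \<zeta>))" (is "cderiv _ _ _ ?dv")
    by (rule cderiv_mono_v)
  have f: "cderiv (\<lambda>z. fst z) z ?w (fst z * \<xi>)" "cderiv (\<lambda>z. snd z) z ?w (snd z * \<zeta>)"
    using cderiv_fst_snd[of z ?w] by simp_all
  have xi: "cderiv (\<lambda>z. (fst l * of_nat m + snd l * c) * mono_u z +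
      (- (snd l * of_nat b * of_nat m * \<mu>) * mono_v z + - (snd l * of_nat b * of_nat m * \<kappa>))) z ?w
    ((fst l * of_nat m + snd l * c) * ?du + (- (snd l * of_nat b * of_nat m * \<mu>) * ?dv + 0))"
    by (intro cderiv_add cderiv_cmult cderiv_const u v)
  have zeta: "cderiv (\<lambda>z. - (fst l * of_nat n + snd l * (of_nat n / of_nat m * c)) * mono_u z +
      ((snd l * of_nat a * of_nat m * \<mu>) * mono_v z + snd l * of_nat a * of_nat m * \<kappa>)) z ?w
    (- (fst l * of_nat n + snd l * (of_nat n / of_nat m * c)) * ?du + ((snd l * of_nat a * of_nat m * \<mu>) * ?dv + 0))"
    by (intro cderiv_add cderiv_cmult cderiv_const u v)
  have xi_eq: "(\<lambda>z. (fst l * of_nat m + snd l * c) * mono_u z +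
      (- (snd l * of_nat b * of_nat m * \<mu>) * mono_v z + - (snd l * of_nat b * of_nat m * \<kappa>))) = model_xi l"
    by (rule ext) (simp add: model_xi_def algebra_simps)
  have zeta_eq: "(\<lambda>z. - (fst l * of_nat n + snd l * (of_nat n / of_nat m * c)) * mono_u z +
      ((snd l * of_nat a * of_nat m * \<mu>) * mono_v z + snd l * of_nat a * of_nat m * \<kappa>)) = model_zeta l"
    by (rule ext) (simp add: model_zeta_def algebra_simps)
  have "cderiv (\<lambda>z. (fst z * model_xi l z, snd z * model_zeta l z)) z ?w
    (fst z * ((fst l * of_nat m + snd l * c) * ?du + (- (snd l * of_nat b * of_nat m * \<mu>) * ?dv + 0)) + fst z * \<xi> * model_xi l z,
     snd z * (- (fst l * of_nat n + snd l * (of_nat n / of_nat m * c)) * ?du + ((snd l * of_nat a * of_nat m * \<mu>) * ?dv + 0)) + snd z * \<zeta> * model_zeta l z)"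
    by (intro cderiv_Pair cderiv_mult f) (use xi zeta in \<open>simp_all only: xi_eq zeta_eq\<close>)
  moreover have "model_field l True = (\<lambda>z. (fst z * model_xi l z, snd z * model_zeta l z))"
    by (rule ext) simp
  ultimately show ?thesis by (simp add: algebra_simps)
qed

lemma cderiv_model_field_False:
  "cderiv (model_field l False) q v (0, - (ee * of_nat m * snd l * \<kappa> * snd v))"
proof -
  have "cderiv (\<lambda>q. (- (ee * (fst l + snd l * c / of_nat m)),
      - (ee * of_nat m * snd l * \<kappa>) * snd q + - (ee * of_nat m * snd l * \<mu>))) q v
    (0, - (ee * of_nat m * snd l * \<kappa>) * snd v + 0)"
    by (intro cderiv_Pair cderiv_add cderiv_cmult cderiv_const cderiv_snd cderiv_ident)
  moreover have "model_field l False = (\<lambda>q. (- (ee * (fst l + snd l * c / of_nat m)),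
      - (ee * of_nat m * snd l * \<kappa>) * snd q + - (ee * of_nat m * snd l * \<mu>)))"
    by (rule ext) (simp add: algebra_simps)
  ultimately show ?thesis by simp
qed

lemma model_field_holomorphic: "model_field l i mholomorphic_on UNIV"
proof (cases i)
  case True
  then show ?thesis unfolding mholomorphic_on_iff_cderiv_zero
    using cderiv_model_field_True[of l _ 0 0] by (simp add: zero_prod_def del: model_field.simps)
next
  case False
  then show ?thesis unfolding mholomorphic_on_iff_cderiv_zero
    using cderiv_model_field_False[of l _ 0] by (simp add: zero_prod_def del: model_field.simps)
qed

lemma holomorphic_model_field: "holomorphic_vector_field param_atlas (chartwise_field (model_field l))"
  by (rule holomorphic_vector_field_chartwise_field[OF field_compatible_model model_field_holomorphic])

text \<open>On the \<open>(x, y)\<close>-plane the rates of \<open>u\<close> and \<open>v\<close> along the field of \<open>l\<close> are multiples of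
  \<open>fst l + snd l c/m\<close> and \<open>snd l\<close>, and these are the same linear forms of \<open>l\<close> by which \<open>u\<close> and \<open>v\<close>
  enter \<open>\<xi>\<close>, \<open>\<zeta>\<close> up to constants; so the two halves of the bracket cancel. On the \<open>(s, r)\<close>-plane
  both fields have a constant first component, and their second components are proportional.\<close>

lemma commuting_model_fields: "commuting_fields param_atlas (chartwise_field (model_field l)) (chartwise_field (model_field l'))"
proof (rule commuting_fields_chartwise_field)
  fix i z
  show "lie_bracket (model_field l i) (model_field l' i) z = 0"
  proof (cases i)
    case True
    have D: "frechet_derivative (model_field l' True) (at z) (model_field l True z) =
      (fst z * (model_xi l z * model_xi l' z + (fst l' * of_nat m + snd l' * c) * (mono_u z * (of_nat a * model_xi l z + of_nat b * model_zeta l z))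
       - snd l' * (of_nat b * of_nat m * \<mu> * (mono_v z * (of_nat n * model_xi l z + of_nat m * model_zeta l z)))),
     snd z * (model_zeta l z * model_zeta l' z - (fst l' * of_nat n + snd l' * (of_nat n / of_nat m * c)) * (mono_u z * (of_nat a * model_xi l z + of_nat b * model_zeta l z))
       + snd l' * (of_nat a * of_nat m * \<mu> * (mono_v z * (of_nat n * model_xi l z + of_nat m * model_zeta l z)))))" for l l'
      using cderiv_frechet_derivative[OF cderiv_model_field_True[of l' z "model_xi l z" "model_zeta l z"]]
      by simp
    show ?thesis
      using True unfolding lie_bracket_def
      by (simp add: D model_rate_u model_rate_v del: model_field.simps)
        (simp add: zero_prod_def field_simps)
  next
    case False
    have "frechet_derivative (model_field l' False) (at z) v = (0, - (ee * of_nat m * snd l' * \<kappa> * snd v))" for l' v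
      by (rule cderiv_frechet_derivative[OF cderiv_model_field_False])
    then show ?thesis using False \<kappa>\<mu>
      by (simp add: lie_bracket_def zero_prod_def algebra_simps)
  qed
qed

text \<open>The flow in reciprocal coordinates is \<open>(s, r) \<mapsto> (s - shift, stretch r - drift)\<close>. Written for
  \<open>u = 1/s\<close>, \<open>v = 1/r\<close> it divides \<open>u\<close> by \<open>1 - shift u\<close> and \<open>v\<close> by \<open>stretch - drift v\<close>; these divisors
  feed \<open>twist\<close> in the other plane.\<close>

definition shift :: "complex \<times> complex \<Rightarrow> complex"
  where "shift t = ee * (fst t + snd t * c / of_nat m)"

definition stretch :: "complex \<times> complex \<Rightarrow> complex"
  where "stretch t = exp (- (ee * of_nat m * \<kappa> * snd t))"

definition drift :: "complex \<times> complex \<Rightarrow> complex"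
  where "drift t = ee * of_nat m * \<mu> * snd t"

definition recip_flow :: "complex \<times> complex \<Rightarrow> complex \<times> complex \<Rightarrow> complex \<times> complex"
  where "recip_flow t q = (fst q - shift t, stretch t * snd q - drift t)"

definition chart_P :: "complex \<times> complex \<Rightarrow> complex \<times> complex \<Rightarrow> complex"
  where "chart_P t z = 1 - shift t * mono_u z"

definition chart_Q :: "complex \<times> complex \<Rightarrow> complex \<times> complex \<Rightarrow> complex"
  where "chart_Q t z = stretch t - drift t * mono_v z"

definition chart_flow :: "complex \<times> complex \<Rightarrow> complex \<times> complex \<Rightarrow> complex \<times> complex"
  where "chart_flow t z = twist (chart_P t z) (chart_Q t z) z"

definition model_flow :: "complex \<times> complex \<Rightarrow> surface_point \<Rightarrow> surface_point"
  where "model_flow t p = (if p \<in> range (par False)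
    then par False (recip_flow t (inv (par False) p))
    else par True (chart_flow t (inv (par True) p)))"

lemma shift_add: "shift (s + t) = shift s + shift t"
  by (simp add: shift_def field_simps)

lemma stretch_add: "stretch (s + t) = stretch s * stretch t"
  by (simp add: stretch_def algebra_simps flip: exp_add)

lemma stretch_nonzero [simp]: "stretch t \<noteq> 0"
  by (simp add: stretch_def)

lemma drift_add: "drift (s + t) = drift s + drift t"
  by (simp add: drift_def algebra_simps)

text \<open>The identity that makes \<open>r \<mapsto> stretch r - drift\<close> additive in time: either the stretch is trivial
  or the drift vanishes.\<close>

lemma stretch_drift: "stretch s * drift t = drift t"
  using \<kappa>\<mu> by (auto simp: stretch_def drift_def)

lemma flow_data_zero [simp]: "shift 0 = 0" "stretch 0 = 1" "drift 0 = 0"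
  by (simp_all add: shift_def stretch_def drift_def)

lemma recip_flow_add: "recip_flow (s + t) q = recip_flow s (recip_flow t q)"
  unfolding recip_flow_def
  by (simp add: shift_add stretch_add drift_add right_diff_distrib stretch_drift mult.assoc)

lemma model_flow_False: "model_flow t (par False q) = par False (recip_flow t q)"
  by (simp add: model_flow_def)

lemma chart_axis: "z \<notin> torus \<Longrightarrow> chart_P t z = 1" "z \<notin> torus \<Longrightarrow> chart_Q t z = stretch t"
  by (simp_all add: chart_P_def chart_Q_def mono_zero)

text \<open>The flow has one formula near the axes although it is defined by cases: on the torus both
  descriptions have the same reciprocal coordinates, and off the torus the case distinction selects
  this formula.\<close>

lemma model_flow_True:
  assumes "chart_P t z \<noteq> 0" "chart_Q t z \<noteq> 0"
  shows "model_flow t (par True z) = par True (chart_flow t z)"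
proof (cases "z \<in> torus")
  case True
  note nz = mono_nonzero[OF True]
  have "recip_flow t (to_recip z) = to_recip (chart_flow t z)"
    unfolding chart_flow_def to_recip_twist[OF assms]
    using nz by (simp add: recip_flow_def to_recip_def chart_P_def chart_Q_def field_simps)
  moreover have "chart_flow t z \<in> torus"
    unfolding chart_flow_def using assms True twist_in_torus by blast
  ultimately show ?thesis
    using par_True_torus True by (simp add: model_flow_False)
next
  case False
  then show ?thesis using par_False_range_iff by (simp add: model_flow_def)
qed

lemma model_flow_axis:
  "z \<notin> torus \<Longrightarrow> model_flow t (par True z) = par True (twist 1 (stretch t) z)"
  using model_flow_True[of t z] by (simp add: chart_axis chart_flow_def)

lemma model_flow_zero: "p \<in> topspace glued_top \<Longrightarrow> model_flow 0 p = p"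
proof (erule topspace_cases)
  fix q assume "p = par False q"
  then show ?thesis by (simp add: model_flow_False recip_flow_def)
next
  fix z assume "p = par True z" "z \<notin> torus"
  then show ?thesis by (simp add: model_flow_axis)
qed

lemma model_flow_add:
  "p \<in> topspace glued_top \<Longrightarrow> model_flow (s + t) p = model_flow s (model_flow t p)"
proof (erule topspace_cases)
  fix q assume "p = par False q"
  then show ?thesis by (simp add: model_flow_False recip_flow_add)
next
  fix z assume "p = par True z" "z \<notin> torus"
  then show ?thesis
    by (simp add: model_flow_axis twist_in_torus twist_twist stretch_add mult.commute)
qed

lemma cderiv_flow_data_zero:
  fixes L :: "'g::complex_normed_vector \<Rightarrow> complex \<times> complex"
  assumes "cderiv L p 0 0"
  shows "cderiv (\<lambda>s. shift (L s)) p 0 0" "cderiv (\<lambda>s. stretch (L s)) p 0 0"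
    "cderiv (\<lambda>s. drift (L s)) p 0 0"
proof -
  have L: "cderiv (\<lambda>s. fst (L s)) p 0 0" "cderiv (\<lambda>s. snd (L s)) p 0 0"
    using cderiv_fst[OF assms] cderiv_snd[OF assms] by simp_all
  have "cderiv (\<lambda>s. ee * (fst (L s) + c / of_nat m * snd (L s))) p 0 (ee * (0 + c / of_nat m * 0))"
    by (intro cderiv_cmult cderiv_add L)
  then show "cderiv (\<lambda>s. shift (L s)) p 0 0" by (simp add: shift_def mult_ac)
  have "cderiv (\<lambda>s. exp (- (ee * of_nat m * \<kappa>) * snd (L s))) p 0
      (exp (- (ee * of_nat m * \<kappa>) * snd (L p)) * (- (ee * of_nat m * \<kappa>) * 0))"
    by (rule cderiv_field_compose[OF cderiv_cmult[OF L(2)] DERIV_exp])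
  then show "cderiv (\<lambda>s. stretch (L s)) p 0 0" by (simp add: stretch_def mult_ac)
  have "cderiv (\<lambda>s. ee * of_nat m * \<mu> * snd (L s)) p 0 (ee * of_nat m * \<mu> * 0)"
    by (intro cderiv_cmult L)
  then show "cderiv (\<lambda>s. drift (L s)) p 0 0" by (simp add: drift_def)
qed

text \<open>Additive holomorphic maps \<open>L\<close> into the time plane cover the joint action (\<open>L\<close> the identity) and the
  two flows (\<open>L\<close> an embedding of a coordinate axis) at once. Points of the \<open>(s, r)\<close>-plane never
  leave it, and points of the axes stay on the axes, so source and target parametrization agree.\<close>

lemma holomorphic_action_model_flow:
  fixes L :: "'g::complex_normed_vector \<Rightarrow> complex \<times> complex"
  assumes L: "L mholomorphic_on UNIV" and L0: "L 0 = 0" and Ladd: "\<And>s t. L (s + t) = L s + L t"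
  shows "holomorphic_action glued_top param_atlas (\<lambda>t. model_flow (L t))"
proof (rule holomorphic_actionI)
  fix t :: 'g and p assume p: "p \<in> topspace glued_top"
  have L': "cderiv (\<lambda>x. L (fst x)) y 0 0" for y :: "'g \<times> (complex \<times> complex)"
    using cderiv_compose[OF cderiv_fst[OF cderiv_ident[of y 0]], of L 0] L
    by (simp add: mholomorphic_on_iff_cderiv_zero)
  have s: "cderiv (\<lambda>x. snd x) y 0 0" for y :: "'g \<times> (complex \<times> complex)"
    using cderiv_snd[OF cderiv_ident[of y 0]] by simp
  note data = cderiv_flow_data_zero[OF L']
  show "\<exists>i j z W F. p = par i z \<and> open W \<and> (t, z) \<in> W \<and> F mholomorphic_on W \<and>
      (\<forall>s w. (s, w) \<in> W \<longrightarrow> model_flow (L s) (par i w) = par j (F (s, w)))"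
  proof (rule topspace_cases[OF p])
    fix q assume q: "p = par False q"
    have "cderiv (\<lambda>x. (fst (snd x) + (-1) * shift (L (fst x)),
        stretch (L (fst x)) * snd (snd x) + (-1) * drift (L (fst x)))) y 0
      (fst (0 :: complex \<times> complex) + (-1) * 0,
        (stretch (L (fst y)) * snd (0 :: complex \<times> complex) + 0 * snd (snd y)) + (-1) * 0)"
      for y :: "'g \<times> (complex \<times> complex)"
      by (intro cderiv_Pair cderiv_add cderiv_cmult cderiv_mult data cderiv_fst cderiv_snd s)
    then have "(\<lambda>x. recip_flow (L (fst x)) (snd x)) mholomorphic_on UNIV"
      unfolding mholomorphic_on_iff_cderiv_zero recip_flow_def by (simp add: zero_prod_def)
    then show ?thesis
      using q by (intro exI[of _ False] exI[of _ q] exI[of _ UNIV]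
          exI[of _ "\<lambda>x. recip_flow (L (fst x)) (snd x)"]) (simp add: model_flow_False)
  next
    fix z assume z: "p = par True z" "z \<notin> torus"
    let ?P = "\<lambda>x. chart_P (L (fst x)) (snd x)" and ?Q = "\<lambda>x. chart_Q (L (fst x)) (snd x)"
    have uv: "cderiv (\<lambda>x. mono_u (snd x)) y 0 0" "cderiv (\<lambda>x. mono_v (snd x)) y 0 0"
      for y :: "'g \<times> (complex \<times> complex)"
      by (rule cderiv_compose[OF s cderiv_mono_zero(1)], rule cderiv_compose[OF s cderiv_mono_zero(2)])
    have "cderiv (\<lambda>x. 1 + (-1) * (shift (L (fst x)) * mono_u (snd x))) y 0
        (0 + (-1) * (shift (L (fst y)) * 0 + 0 * mono_u (snd y)))" for y
      by (intro cderiv_add cderiv_const cderiv_cmult cderiv_mult data uv)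
    then have P: "cderiv ?P y 0 0" for y by (simp add: chart_P_def)
    have "cderiv (\<lambda>x. stretch (L (fst x)) + (-1) * (drift (L (fst x)) * mono_v (snd x))) y 0
        (0 + (-1) * (drift (L (fst y)) * 0 + 0 * mono_v (snd y)))" for y
      by (intro cderiv_add cderiv_const cderiv_cmult cderiv_mult data uv)
    then have Q: "cderiv ?Q y 0 0" for y by (simp add: chart_Q_def)
    define W where "W = {x. ?P x \<noteq> 0 \<and> ?Q x \<noteq> 0}"
    have "continuous_on UNIV ?P" "continuous_on UNIV ?Q"
      using P Q mholomorphic_on_imp_continuous_on mholomorphic_on_iff_cderiv_zero by blast+
    then have W: "open W"
      unfolding W_def by (intro open_Collect_conj open_Collect_neq continuous_intros)
    have "(\<lambda>x. chart_flow (L (fst x)) (snd x)) mholomorphic_on W"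
      unfolding mholomorphic_on_iff_cderiv_zero
    proof
      fix y assume y: "y \<in> W"
      have "cderiv (\<lambda>x. twist (?P x) (?Q x) (snd x)) y 0
        (fst (twist (?P y) (?Q y) (snd y)) * (0 - ee * of_nat m * 0 + ee * of_nat b * 0),
         snd (twist (?P y) (?Q y) (snd y)) * (0 + ee * of_nat n * 0 - ee * of_nat a * 0))"
        by (rule cderiv_twist) (use y P Q s[of y] in \<open>simp_all add: W_def zero_prod_def\<close>)
      then show "cderiv (\<lambda>x. chart_flow (L (fst x)) (snd x)) y 0 0"
        by (simp add: chart_flow_def zero_prod_def)
    qed
    moreover have "(t, z) \<in> W" using z(2) by (simp add: W_def chart_axis)
    ultimately show ?thesis
      using z W by (intro exI[of _ True] exI[of _ z] exI[of _ W]
          exI[of _ "\<lambda>x. chart_flow (L (fst x)) (snd x)"]) (simp add: W_def model_flow_True)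
  qed
qed (simp_all add: L0 Ladd model_flow_zero model_flow_add)

lemma generated_by_model_flow:
  "generated_by glued_top param_atlas (\<lambda>s. model_flow (s * fst l, s * snd l)) (chartwise_field (model_field l))"
proof (rule generated_by_chartwise_field[OF field_compatible_model])
  fix p and t :: complex assume p: "p \<in> topspace glued_top"
  have str: "cderiv (\<lambda>s. stretch (s * fst l, s * snd l)) t 1
      (stretch (t * fst l, t * snd l) * (- (ee * of_nat m * \<kappa> * snd l)))"
  proof -
    have "cderiv (\<lambda>s. exp (- (ee * of_nat m * \<kappa> * snd l) * s)) t 1
        (exp (- (ee * of_nat m * \<kappa> * snd l) * t) * (- (ee * of_nat m * \<kappa> * snd l) * 1))"
      by (rule cderiv_field_compose[OF cderiv_cmult[OF cderiv_ident] DERIV_exp])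
    then show ?thesis by (simp add: stretch_def mult_ac)
  qed
  show "\<exists>i F S. open S \<and> t \<in> S \<and> (\<forall>s\<in>S. model_flow (s * fst l, s * snd l) p = par i (F s)) \<and>
      cderiv F t 1 (model_field l i (F t))"
  proof (rule topspace_cases[OF p])
    fix q assume q: "p = par False q"
    let ?F = "\<lambda>s. recip_flow (s * fst l, s * snd l) q"
    have "cderiv (\<lambda>s. (fst q + - (ee * (fst l + snd l * c / of_nat m)) * s,
        snd q * stretch (s * fst l, s * snd l) + - (ee * of_nat m * \<mu> * snd l) * s)) t 1
      (0 + - (ee * (fst l + snd l * c / of_nat m)) * 1,
        snd q * (stretch (t * fst l, t * snd l) * (- (ee * of_nat m * \<kappa> * snd l))) +
        - (ee * of_nat m * \<mu> * snd l) * 1)"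
      by (intro cderiv_Pair cderiv_add cderiv_const cderiv_cmult cderiv_ident str)
    moreover have "(\<lambda>s. (fst q + - (ee * (fst l + snd l * c / of_nat m)) * s,
        snd q * stretch (s * fst l, s * snd l) + - (ee * of_nat m * \<mu> * snd l) * s)) = ?F"
      by (rule ext) (simp add: recip_flow_def shift_def drift_def field_simps)
    moreover have "(0 + - (ee * (fst l + snd l * c / of_nat m)) * 1,
        snd q * (stretch (t * fst l, t * snd l) * (- (ee * of_nat m * \<kappa> * snd l))) +
        - (ee * of_nat m * \<mu> * snd l) * 1) = model_field l False (?F t)"
    proof -
      have "\<kappa> * drift s = 0" for s
        using \<kappa>\<mu> by (auto simp: drift_def)
      then have "\<kappa> * (A - drift s) = \<kappa> * A" for A s by (simp only: right_diff_distrib diff_zero)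
      then show ?thesis by (simp only: recip_flow_def model_field.simps snd_conv) (simp add: algebra_simps)
    qed
    ultimately have "cderiv ?F t 1 (model_field l False (?F t))" by simp
    then show ?thesis
      using q by (intro exI[of _ False] exI[of _ ?F] exI[of _ UNIV]) (simp add: model_flow_False)
  next
    fix z assume z: "p = par True z" "z \<notin> torus"
    let ?F = "\<lambda>s. twist 1 (stretch (s * fst l, s * snd l)) z"
    have "cderiv ?F t 1
      (fst (?F t) * (0 - ee * of_nat m * 0 + ee * of_nat b * (- (ee * of_nat m * \<kappa> * snd l))),
       snd (?F t) * (0 + ee * of_nat n * 0 - ee * of_nat a * (- (ee * of_nat m * \<kappa> * snd l))))"
      by (rule cderiv_twist)
        (use cderiv_const[of 1 t 1] cderiv_const[of z t 1] str in \<open>simp_all add: zero_prod_def\<close>)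
    moreover have "ee * (ee * x) = x" for x
      by (simp flip: mult.assoc)
    moreover have "?F t \<notin> torus" using z(2) by (simp add: twist_in_torus)
    ultimately have "cderiv ?F t 1 (model_field l True (?F t))"
      by (simp add: model_xi_def model_zeta_def mono_zero mult_ac)
    then show ?thesis
      using z by (intro exI[of _ True] exI[of _ ?F] exI[of _ UNIV]) (simp add: model_flow_axis)
  qed
qed

end

section \<open>Normalizing functions of one variable\<close>

lemma holomorphic_on_ball_has_fps_expansion:
  assumes "f holomorphic_on ball 0 r" "r > 0"
  shows "f has_fps_expansion fps_expansion f 0"
  using assms by (intro analytic_at_imp_has_fps_expansion_0)
    (auto simp: analytic_at intro!: exI[of _ "ball 0 r"])

lemma holomorphic_on_ball_isCont:
  assumes "f holomorphic_on ball 0 r" "r > 0"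
  shows "isCont f 0"
  using holomorphic_on_imp_continuous_on[OF assms(1)] assms(2)
  by (simp add: continuous_on_eq_continuous_at)

lemma holomorphic_divide_variable:
  assumes "f holomorphic_on ball 0 r" "r > 0"
  obtains q where "q holomorphic_on ball 0 r" "\<And>v. f v = f 0 + v * q v" "q 0 = deriv f 0"
proof
  let ?q = "\<lambda>v. if v = 0 then deriv f 0 else (f v - f 0) / (v - 0)"
  show "?q holomorphic_on ball 0 r"
    using assms by (intro pole_lemma) auto
qed auto

text \<open>The monomial \<open>v\<^sup>j\<close> is an eigenvector of \<open>\<phi> \<mapsto> v \<phi>' - k \<phi>\<close> with eigenvalue \<open>j - k\<close>, so the
  coefficient of \<open>v\<^sup>k\<close> is the only obstruction. The induction avoids manipulating power series:
  writing \<open>R = R(0) + v q\<close> and \<open>\<phi> = - R(0)/k + v \<psi>\<close> reduces the equation for \<open>k\<close> and \<open>R\<close> to the one for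
  \<open>k - 1\<close> and \<open>q\<close>, and the case \<open>k = 0\<close> is an integration.\<close>

lemma resonant_euler_equation:
  assumes "R holomorphic_on ball 0 r" "r > 0" "R has_fps_expansion F" "fps_nth F k = 0"
  shows "\<exists>\<phi>. \<phi> holomorphic_on ball 0 r \<and>
    (\<forall>v\<in>ball 0 r. v * deriv \<phi> v - of_nat k * \<phi> v = R v)"
  using assms
proof (induction k arbitrary: R F)
  case 0
  obtain q where q: "q holomorphic_on ball 0 r" "\<And>v. R v = R 0 + v * q v"
    using holomorphic_divide_variable[OF "0.prems"(1,2)] by metis
  have R0: "R 0 = 0" using has_fps_expansion_imp_0_eq_fps_nth_0[OF "0.prems"(3)] "0.prems"(4) by simp
  obtain \<phi> where \<phi>: "\<And>v. v \<in> ball 0 r \<Longrightarrow> (\<phi> has_field_derivative q v) (at v within ball 0 r)"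
    using holomorphic_convex_primitive'[OF convex_ball open_ball q(1)] by metis
  then have d: "(\<phi> has_field_derivative q v) (at v)" if "v \<in> ball 0 r" for v
    using that at_within_open[OF that open_ball] by metis
  then have "\<phi> holomorphic_on ball 0 r"
    using holomorphic_on_open[OF open_ball] by blast
  moreover have "v * deriv \<phi> v - of_nat 0 * \<phi> v = R v" if "v \<in> ball 0 r" for v
    using DERIV_imp_deriv[OF d[OF that]] q(2)[of v] R0 by simp
  ultimately show ?case by blast
next
  case (Suc k)
  obtain q where q: "q holomorphic_on ball 0 r" "\<And>v. R v = R 0 + v * q v"
    using holomorphic_divide_variable[OF Suc.prems(1,2)] by metis
  define E where "E = fps_expansion q 0"
  have E: "q has_fps_expansion E"
    unfolding E_def by (rule holomorphic_on_ball_has_fps_expansion[OF q(1) Suc.prems(2)])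
  have "(\<lambda>v. R 0 + v * q v) has_fps_expansion fps_const (R 0) + fps_X * E"
    by (intro fps_expansion_intros E)
  moreover have "(\<lambda>v. R 0 + v * q v) = R" by (rule ext) (rule q(2)[symmetric])
  ultimately have "F = fps_const (R 0) + fps_X * E"
    using fps_expansion_unique_complex Suc.prems(3) by metis
  then have "fps_nth E k = 0" using Suc.prems(4) by simp
  from Suc.IH[OF q(1) Suc.prems(2) E this] obtain \<psi> where
    \<psi>: "\<psi> holomorphic_on ball 0 r" "\<And>v. v \<in> ball 0 r \<Longrightarrow> v * deriv \<psi> v - of_nat k * \<psi> v = q v"
    by blast
  define \<phi> where "\<phi> = (\<lambda>v. - R 0 / of_nat (Suc k) + v * \<psi> v)"
  have "\<phi> holomorphic_on ball 0 r"
    unfolding \<phi>_def by (intro holomorphic_intros \<psi>(1))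
  moreover have "v * deriv \<phi> v - of_nat (Suc k) * \<phi> v = R v" if v: "v \<in> ball 0 r" for v
  proof -
    have "(\<psi> has_field_derivative deriv \<psi> v) (at v)"
      by (rule holomorphic_derivI[OF \<psi>(1) open_ball v])
    then have "(\<phi> has_field_derivative (\<psi> v + v * deriv \<psi> v)) (at v)"
      unfolding \<phi>_def by (auto intro!: derivative_eq_intros)
    then have d: "deriv \<phi> v = \<psi> v + v * deriv \<psi> v" by (rule DERIV_imp_deriv)
    have k: "of_nat (Suc k) * (- R 0 / of_nat (Suc k)) = - R 0"
      by (simp del: of_nat_Suc)
    have "v * deriv \<phi> v - of_nat (Suc k) * \<phi> v =
        v * (\<psi> v + v * deriv \<psi> v) - (of_nat (Suc k) * (- R 0 / of_nat (Suc k)) + of_nat (Suc k) * (v * \<psi> v))"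
      unfolding d by (simp only: \<phi>_def distrib_left)
    also have "\<dots> = R 0 + v * (v * deriv \<psi> v - of_nat k * \<psi> v)"
      unfolding k by (simp add: algebra_simps)
    also have "\<dots> = R v" using \<psi>(2)[OF v] q(2)[of v] by simp
    finally show ?thesis .
  qed
  ultimately show ?case by blast
qed

text \<open>The two equations that straighten \<open>Y\<close>, for \<open>f = w / v\<^sup>k\<close> and \<open>M = m\<close>. The function
  \<open>\<phi> / v\<^sup>k\<close> is what has to be added to \<open>1/u\<close> so that \<open>Y\<close> acts on the sum by a constant, and
  \<open>v / Q\<close> is the coordinate in which \<open>v g(v) \<partial>\<^sub>v\<close> becomes \<open>V (\<kappa> + \<mu> V) \<partial>\<^sub>V\<close>. The first equation
  is multiplied by \<open>g\<close> to cover the case \<open>g(0) = 0\<close> as well.\<close>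

lemma normalizing_functions:
  fixes g w :: "complex \<Rightarrow> complex" and M :: complex
  assumes g: "g holomorphic_on ball 0 r" and w: "w holomorphic_on ball 0 r" and r: "r > 0"
    and W: "w has_fps_expansion W" and M: "M \<noteq> 0"
    and cases: "g 0 \<noteq> 0 \<or> g 0 = 0 \<and> (deriv ^^ 2) g 0 = 0 \<and> fps_nth W k = 0 \<and> deriv g 0 \<noteq> 0"
  shows "\<exists>s \<phi> Q \<kappa> \<mu>. 0 < s \<and> s \<le> r \<and> \<phi> holomorphic_on ball 0 s \<and> Q holomorphic_on ball 0 s \<and>
    \<kappa> * \<mu> = 0 \<and> Q 0 = 1 \<and>
    (\<forall>v\<in>ball 0 s. M\<^sup>2 * (v * deriv \<phi> v - of_nat k * \<phi> v) * g v =
        g v * w v - v ^ k * (g 0 * fps_nth W k) \<and>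
      g v * (Q v - v * deriv Q v) = \<kappa> * Q v + \<mu> * v)"
  using cases
proof
  assume g0: "g 0 \<noteq> 0"
  have "isCont g 0"
    by (rule holomorphic_on_ball_isCont[OF g r])
  then obtain s0 where s0: "s0 > 0" "\<And>v. dist v 0 < s0 \<Longrightarrow> g v \<noteq> 0"
    using g0 continuous_at_avoid[of 0 g 0] by (metis dist_commute)
  define s where "s = min s0 r"
  have s: "s > 0" "s \<le> r" using s0 r by (auto simp: s_def)
  have nz: "g v \<noteq> 0" if "v \<in> ball 0 s" for v using s0(2)[of v] that by (simp add: s_def)
  have gs: "g holomorphic_on ball 0 s" and ws: "w holomorphic_on ball 0 s"
    using g w s(2) by (auto elim!: holomorphic_on_subset)
  \<comment> \<open>The constant term \<open>1\<close> of \<open>S = g(0)/g\<close> makes the subtraction of \<open>f0 v\<^sup>k S\<close> kill exactly the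
    resonant coefficient of \<open>w\<close>.\<close>
  define S where "S = (\<lambda>v. g 0 / g v)"
  have S: "S holomorphic_on ball 0 s"
    unfolding S_def by (intro holomorphic_intros gs) (use nz in auto)
  define E where "E = fps_expansion S 0"
  have E: "S has_fps_expansion E"
    unfolding E_def by (rule holomorphic_on_ball_has_fps_expansion[OF S s(1)])
  have E0: "fps_nth E 0 = 1"
    using has_fps_expansion_imp_0_eq_fps_nth_0[OF E] g0 by (simp add: S_def)
  define f0 where "f0 = fps_nth W k"
  have "\<exists>\<phi>. \<phi> holomorphic_on ball 0 s \<and> (\<forall>v\<in>ball 0 s. v * deriv \<phi> v - of_nat k * \<phi> v =
      1 / M\<^sup>2 * (w v - f0 * (v ^ k * S v)))"
  proof (rule resonant_euler_equation)
    show "(\<lambda>v. 1 / M\<^sup>2 * (w v - f0 * (v ^ k * S v))) holomorphic_on ball 0 s"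
      by (intro holomorphic_intros ws S)
    show "(\<lambda>v. 1 / M\<^sup>2 * (w v - f0 * (v ^ k * S v))) has_fps_expansion
        fps_const (1 / M\<^sup>2) * (W - fps_const f0 * (fps_X ^ k * E))"
      by (intro fps_expansion_intros W E)
    show "fps_nth (fps_const (1 / M\<^sup>2) * (W - fps_const f0 * (fps_X ^ k * E))) k = 0"
      using E0 by (simp add: f0_def fps_X_power_mult_nth)
  qed (rule s)
  then obtain \<phi> where \<phi>: "\<phi> holomorphic_on ball 0 s"
    "\<And>v. v \<in> ball 0 s \<Longrightarrow> v * deriv \<phi> v - of_nat k * \<phi> v = 1 / M\<^sup>2 * (w v - f0 * (v ^ k * S v))"
    by blast
  have "\<exists>q. q holomorphic_on ball 0 s \<and> (\<forall>v\<in>ball 0 s. v * deriv q v - of_nat 0 * q v = S v - 1)"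
  proof (rule resonant_euler_equation)
    show "(\<lambda>v. S v - 1) has_fps_expansion E - 1" by (intro fps_expansion_intros E)
    show "(\<lambda>v. S v - 1) holomorphic_on ball 0 s" by (intro holomorphic_intros S)
  qed (use s E0 in auto)
  then obtain q where q: "q holomorphic_on ball 0 s"
    "\<And>v. v \<in> ball 0 s \<Longrightarrow> v * deriv q v = S v - 1" by auto
  \<comment> \<open>With \<open>Q = exp (- q)\<close> the equation \<open>g (Q - v Q') = g(0) Q\<close> becomes \<open>1 + v q' = g(0)/g\<close>; the
    factor \<open>exp (q 0)\<close> normalizes \<open>Q(0)\<close>.\<close>
  define Q where "Q = (\<lambda>v. exp (q 0 - q v))"
  have Q: "Q holomorphic_on ball 0 s" unfolding Q_def by (intro holomorphic_intros q(1))
  have "M\<^sup>2 * (v * deriv \<phi> v - of_nat k * \<phi> v) * g v = g v * w v - v ^ k * (g 0 * fps_nth W k) \<and>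
      g v * (Q v - v * deriv Q v) = g 0 * Q v + 0 * v" if v: "v \<in> ball 0 s" for v
  proof
    note nzv = nz[OF v]
    show "M\<^sup>2 * (v * deriv \<phi> v - of_nat k * \<phi> v) * g v = g v * w v - v ^ k * (g 0 * fps_nth W k)"
      unfolding \<phi>(2)[OF v] S_def f0_def using nzv M by (simp add: field_simps)
    have "(q has_field_derivative deriv q v) (at v)"
      by (rule holomorphic_derivI[OF q(1) open_ball v])
    then have "(Q has_field_derivative (- deriv q v * Q v)) (at v)"
      unfolding Q_def by (auto intro!: derivative_eq_intros)
    then have d: "deriv Q v = - deriv q v * Q v" by (rule DERIV_imp_deriv)
    have "g v * (Q v - v * deriv Q v) = g v * Q v * (1 + v * deriv q v)"
      unfolding d by (simp add: algebra_simps)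
    also have "\<dots> = g v * Q v * S v" unfolding q(2)[OF v] by simp
    also have "\<dots> = g 0 * Q v + 0 * v" using nzv by (simp add: S_def)
    finally show "g v * (Q v - v * deriv Q v) = g 0 * Q v + 0 * v" .
  qed
  then show ?thesis
    using s \<phi>(1) Q
    by (intro exI[of _ s] exI[of _ \<phi>] exI[of _ Q] exI[of _ "g 0"] exI[of _ 0]) (auto simp: Q_def)
next
  assume A: "g 0 = 0 \<and> (deriv ^^ 2) g 0 = 0 \<and> fps_nth W k = 0 \<and> deriv g 0 \<noteq> 0"
  define g1 where "g1 = deriv g 0"
  have g1: "g1 \<noteq> 0" using A by (simp add: g1_def)
  obtain q where q: "q holomorphic_on ball 0 r" "\<And>v. g v = g 0 + v * q v" "q 0 = g1"
    using holomorphic_divide_variable[OF g r] g1_def by metis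
  have gq: "g v = v * q v" for v using q(2)[of v] A by simp
  have "isCont q 0"
    by (rule holomorphic_on_ball_isCont[OF q(1) r])
  then obtain s0 where s0: "s0 > 0" "\<And>v. dist v 0 < s0 \<Longrightarrow> q v \<noteq> 0"
    using g1 q(3) continuous_at_avoid[of 0 q 0] by (metis dist_commute)
  define s where "s = min s0 r"
  have s: "s > 0" "s \<le> r" using s0 r by (auto simp: s_def)
  have nz: "q v \<noteq> 0" if "v \<in> ball 0 s" for v using s0(2)[of v] that by (simp add: s_def)
  have qs: "q holomorphic_on ball 0 s" and ws: "w holomorphic_on ball 0 s"
    using q(1) w s(2) by (auto elim!: holomorphic_on_subset)
  have "\<exists>\<phi>. \<phi> holomorphic_on ball 0 s \<and> (\<forall>v\<in>ball 0 s. v * deriv \<phi> v - of_nat k * \<phi> v = 1 / M\<^sup>2 * w v)"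
  proof (rule resonant_euler_equation)
    show "(\<lambda>v. 1 / M\<^sup>2 * w v) holomorphic_on ball 0 s" by (intro holomorphic_intros ws)
    show "(\<lambda>v. 1 / M\<^sup>2 * w v) has_fps_expansion fps_const (1 / M\<^sup>2) * W"
      by (intro fps_expansion_intros W)
    show "fps_nth (fps_const (1 / M\<^sup>2) * W) k = 0" using A by simp
  qed (rule s)
  then obtain \<phi> where \<phi>: "\<phi> holomorphic_on ball 0 s"
    "\<And>v. v \<in> ball 0 s \<Longrightarrow> v * deriv \<phi> v - of_nat k * \<phi> v = 1 / M\<^sup>2 * w v" by blast
  \<comment> \<open>With \<open>g = v q\<close> the equation for \<open>Q\<close> is \<open>v Q' - Q = - g'(0)/q\<close>, whose resonant coefficient is
    the one of \<open>v\<close>. It is found by comparing coefficients of \<open>v\<^sup>2\<close> in \<open>g S = - g'(0) v\<close>.\<close>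
  define S where "S = (\<lambda>v. - g1 / q v)"
  have S: "S holomorphic_on ball 0 s"
    unfolding S_def by (intro holomorphic_intros qs) (use nz in auto)
  define E where "E = fps_expansion S 0"
  have E: "S has_fps_expansion E"
    unfolding E_def by (rule holomorphic_on_ball_has_fps_expansion[OF S s(1)])
  have E1: "fps_nth E 1 = 0"
  proof -
    define B where "B = fps_expansion g 0"
    have B: "g has_fps_expansion B"
      unfolding B_def by (rule holomorphic_on_ball_has_fps_expansion[OF g r])
    have Bn: "fps_nth B 0 = 0" "fps_nth B 1 = g1" "fps_nth B 2 = 0"
      using A by (simp_all add: B_def fps_expansion_def g1_def)
    have "(\<lambda>v. g v * S v) has_fps_expansion B * E" by (intro fps_expansion_intros B E)
    moreover have "(\<lambda>v. - g1 * v) has_fps_expansion fps_const (- g1) * fps_X"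
      by (intro fps_expansion_intros)
    moreover have "\<forall>\<^sub>F v in nhds 0. g v * S v = - g1 * v"
      using eventually_nhds_in_open[OF open_ball, of 0 0 s] s(1)
      by (auto elim!: eventually_mono simp: gq S_def dest!: nz[unfolded mem_ball_0])
    ultimately have "B * E = fps_const (- g1) * fps_X"
      using has_fps_expansion_cong fps_expansion_unique_complex by metis
    then have "fps_nth (B * E) 2 = fps_nth (fps_const (- g1) * fps_X) 2" by simp
    then show ?thesis
      using Bn g1 by (simp add: fps_mult_nth numeral_2_eq_2)
  qed
  have "\<exists>Q. Q holomorphic_on ball 0 s \<and> (\<forall>v\<in>ball 0 s. v * deriv Q v - of_nat 1 * Q v = S v)"
    by (rule resonant_euler_equation[OF S s(1) E E1])
  then obtain Q where Q: "Q holomorphic_on ball 0 s"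
    "\<And>v. v \<in> ball 0 s \<Longrightarrow> v * deriv Q v - Q v = S v" by auto
  have "Q 0 = 1" using Q(2)[of 0] s(1) q(3) g1 by (simp add: S_def)
  moreover have "M\<^sup>2 * (v * deriv \<phi> v - of_nat k * \<phi> v) * g v = g v * w v - v ^ k * (g 0 * fps_nth W k) \<and>
      g v * (Q v - v * deriv Q v) = 0 * Q v + g1 * v" if v: "v \<in> ball 0 s" for v
  proof
    show "M\<^sup>2 * (v * deriv \<phi> v - of_nat k * \<phi> v) * g v = g v * w v - v ^ k * (g 0 * fps_nth W k)"
      unfolding \<phi>(2)[OF v] using M A by simp
    have "Q v - v * deriv Q v = - S v" using Q(2)[OF v] by (simp add: algebra_simps)
    then show "g v * (Q v - v * deriv Q v) = 0 * Q v + g1 * v"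
      using nz[OF v] by (simp add: S_def gq)
  qed
  ultimately show ?thesis
    using s \<phi>(1) Q(1)
    by (intro exI[of _ s] exI[of _ \<phi>] exI[of _ Q] exI[of _ 0] exI[of _ g1]) auto
qed

text \<open>Here \<open>k\<close> is the order of the pole of \<open>f\<close> at \<open>0\<close>, or \<open>0\<close> if there is none; multiplication by \<open>v\<^sup>k\<close>
  moves the constant term of the Laurent series to the Taylor coefficient of index \<open>k\<close>.\<close>

lemma laurent_pole_factor:
  assumes D: "open D" "0 \<in> D" and mero: "f meromorphic_on D" and hol: "f holomorphic_on D - {0}"
  shows "\<exists>k w W r. 0 < r \<and> ball 0 r \<subseteq> D \<and> w holomorphic_on ball 0 r \<and> w has_fps_expansion W \<and>
    fps_nth W k = fls_nth (laurent_expansion f 0) 0 \<and> (k = 0 \<or> w 0 \<noteq> 0) \<and>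
    (\<forall>v\<in>ball 0 r - {0}. f v * v ^ k = w v)"
proof -
  define L where "L = laurent_expansion f 0"
  have L: "f has_laurent_expansion L"
    using mero D(2) not_essential_has_laurent_expansion_0
    unfolding meromorphic_on_altdef L_def by blast
  define k where "k = nat (- fls_subdegree L)"
  define K where "K = fls_X ^ k * L"
  have Knth: "fls_nth K i = fls_nth L (i - int k)" for i
    by (simp add: K_def fls_X_power_times_conv_shift)
  have "fls_nth K i = 0" if "i < 0" for i
    using that unfolding Knth k_def by (intro fls_eq0_below_subdegree) linarith
  then have Kr: "fps_to_fls (fls_regpart K) = K"
    by (intro fls_eqI) (auto simp: fps_to_fls_nth)
  define W where "W = fls_regpart K"
  define w where "w = (\<lambda>v. if v = 0 then fps_nth W 0 else f v * v ^ k)"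
  have "(\<lambda>v. v ^ k * f v) has_laurent_expansion K"
    unfolding K_def by (intro laurent_expansion_intros L)
  moreover have "\<forall>\<^sub>F v in at 0. v ^ k * f v = w v"
    by (auto simp: w_def eventually_at_filter mult.commute)
  ultimately have "w has_laurent_expansion fps_to_fls W"
    unfolding W_def Kr using has_laurent_expansion_cong[of "\<lambda>v. v ^ k * f v" w K K] by simp
  then have W: "w has_fps_expansion W"
    by (simp add: has_fps_expansion_to_laurent w_def)
  then have "w analytic_on {0}" by (rule has_fps_expansion_imp_analytic_0)
  then obtain r0 where r0: "r0 > 0" "w holomorphic_on ball 0 r0"
    unfolding analytic_on_def by auto
  obtain r1 where r1: "r1 > 0" "ball 0 r1 \<subseteq> D" using D open_contains_ball by blast
  define r where "r = min r0 r1"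
  have "w holomorphic_on ball 0 r" using r0(2) by (rule holomorphic_on_subset) (auto simp: r_def)
  moreover have "fps_nth W k = fls_nth L 0" by (simp add: W_def Knth)
  moreover have "k = 0 \<or> w 0 \<noteq> 0"
  proof (cases "k = 0")
    case False
    then have "L \<noteq> 0" "- int k = fls_subdegree L" by (auto simp: k_def)
    then show ?thesis by (simp add: w_def W_def Knth)
  qed simp
  ultimately show ?thesis
    using r0(1) r1 W unfolding L_def
    by (intro exI[of _ k] exI[of _ w] exI[of _ W] exI[of _ r]) (auto simp: w_def r_def)
qed

text \<open>Otherwise division by \<open>x\<^sup>a\<close> would leave a positive power of \<open>x\<close> on the left and force
  \<open>\<theta> 0 = 0\<close> in the limit.\<close>

lemma vanishing_order_bound:
  fixes \<eta> \<theta> :: "complex \<Rightarrow> complex"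
  assumes "isCont \<eta> 0" "isCont \<theta> 0" "\<theta> 0 \<noteq> 0"
    and ev: "\<forall>\<^sub>F x in at 0. \<eta> x * x ^ j = x ^ a * \<theta> x"
  shows "j \<le> a"
proof (rule ccontr)
  assume "\<not> j \<le> a"
  then obtain d where d: "j = a + d" "d > 0" by (metis less_imp_add_positive not_le)
  have "\<forall>\<^sub>F x in at 0. \<eta> x * x ^ d = \<theta> x"
    using ev eventually_neq_at_within[of 0 0 UNIV]
    by eventually_elim (simp add: d(1) power_add)
  moreover have "((\<lambda>x. \<eta> x * x ^ d) \<longlongrightarrow> \<eta> 0 * 0 ^ d) (at 0)"
    using assms(1) by (intro tendsto_intros) (simp add: isCont_def)
  ultimately have "(\<theta> \<longlongrightarrow> \<eta> 0 * 0 ^ d) (at 0)"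
    by (rule Lim_transform_eventually[rotated])
  moreover have "(\<theta> \<longlongrightarrow> \<theta> 0) (at 0)" using assms(2) by (simp add: isCont_def)
  ultimately have "\<theta> 0 = \<eta> 0 * 0 ^ d" using tendsto_unique trivial_limit_at by metis
  then show False using assms(3) d(2) by simp
qed

section \<open>Maps tangent to the identity\<close>

text \<open>The derivative is bounded on the smaller disc by the Cauchy inequality on discs of radius \<open>r\<close>.\<close>

lemma bounded_holomorphic_lipschitz:
  assumes f: "f holomorphic_on ball 0 (2 * r)" and r: "r > 0"
    and B: "\<And>x. x \<in> ball 0 (2 * r) \<Longrightarrow> cmod (f x) \<le> B"
    and x: "x \<in> ball 0 r" "x' \<in> ball 0 r"
  shows "cmod (f x - f x') \<le> B / r * cmod (x - x')"
proof (rule field_differentiable_bound[OF convex_ball _ _ x])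
  fix z :: complex assume z: "z \<in> ball 0 r"
  then have z2: "z \<in> ball 0 (2 * r)" using r by auto
  have sub: "cball z r \<subseteq> ball 0 (2 * r)"
  proof
    fix y assume "y \<in> cball z r"
    then show "y \<in> ball 0 (2 * r)"
      using z dist_triangle[of 0 y z] by simp
  qed
  show "(f has_field_derivative deriv f z) (at z within ball 0 r)"
    using holomorphic_derivI[OF f open_ball z2] has_field_derivative_at_within by blast
  have "cmod ((deriv ^^ 1) f z) \<le> fact 1 * B / r ^ 1"
  proof (rule Cauchy_inequality)
    show "f holomorphic_on ball z r"
      using f sub ball_subset_cball holomorphic_on_subset by (metis subset_trans)
    show "continuous_on (cball z r) f"
      using f sub holomorphic_on_imp_continuous_on continuous_on_subset by blast
    fix y assume "cmod (z - y) = r"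
    then have "y \<in> cball z r" by (simp add: dist_norm)
    then show "cmod (f y) \<le> B" using B sub by blast
  qed (rule r)
  then show "cmod (deriv f z) \<le> B / r" by simp
qed

lemma mholomorphic_on_slices:
  fixes A :: "complex \<times> complex \<Rightarrow> complex"
  assumes A: "A mholomorphic_on N"
  shows "open S \<Longrightarrow> (\<And>x. x \<in> S \<Longrightarrow> (x, y) \<in> N) \<Longrightarrow> (\<lambda>x. A (x, y)) holomorphic_on S"
    and "open S \<Longrightarrow> (\<And>x. x \<in> S \<Longrightarrow> (y, x) \<in> N) \<Longrightarrow> (\<lambda>x. A (y, x)) holomorphic_on S"
proof -
  have 1: "(\<lambda>x. (x, y)) mholomorphic_on S" "(\<lambda>x. (y, x)) mholomorphic_on S" for S :: "complex set"
    by (rule mholomorphic_onI, rule cderiv_Pair[OF cderiv_ident cderiv_const],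
        rule mholomorphic_onI, rule cderiv_Pair[OF cderiv_const cderiv_ident])
  show "open S \<Longrightarrow> (\<And>x. x \<in> S \<Longrightarrow> (x, y) \<in> N) \<Longrightarrow> (\<lambda>x. A (x, y)) holomorphic_on S"
    using mholomorphic_on_compose[OF 1(1) A] mholomorphic_on_complex_iff by blast
  show "open S \<Longrightarrow> (\<And>x. x \<in> S \<Longrightarrow> (y, x) \<in> N) \<Longrightarrow> (\<lambda>x. A (y, x)) holomorphic_on S"
    using mholomorphic_on_compose[OF 1(2) A] mholomorphic_on_complex_iff by blast
qed

lemma norm_fst_le_norm: "norm (fst z) \<le> norm z" and norm_snd_le_norm: "norm (snd z) \<le> norm z"
  using norm_fst_le[of "fst z" "snd z"] norm_snd_le[of "snd z" "fst z"] by simp_all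

text \<open>Local Lipschitz continuity in two variables follows one variable at a time; it stands in for
  continuity of the differential.\<close>

lemma mholomorphic_locally_lipschitz:
  fixes A :: "complex \<times> complex \<Rightarrow> complex"
  assumes A: "A mholomorphic_on N" and N: "open N" "(0, 0) \<in> N"
  shows "\<exists>r L. r > 0 \<and> L > 0 \<and> ball 0 r \<times> ball 0 r \<subseteq> N \<and>
    (\<forall>z\<in>ball 0 r \<times> ball 0 r. \<forall>w\<in>ball 0 r \<times> ball 0 r. cmod (A z - A w) \<le> L * norm (z - w))"
proof -
  obtain P Q where PQ: "open P" "open Q" "(0, 0) \<in> P \<times> Q" "P \<times> Q \<subseteq> N"
    using N by (rule open_prod_elim)
  obtain p where p: "p > 0" "cball 0 p \<subseteq> P"
    using PQ(1,3) open_contains_cball by blast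
  obtain q where q: "q > 0" "cball 0 q \<subseteq> Q"
    using PQ(2,3) open_contains_cball by blast
  define r where "r = min p q / 2"
  have r: "r > 0" using p q by (simp add: r_def)
  have "cball 0 (2 * r) \<subseteq> P" "cball 0 (2 * r) \<subseteq> Q"
    using p q by (auto simp: r_def)
  then have sub: "cball 0 (2 * r) \<times> cball 0 (2 * r) \<subseteq> N" using PQ(4) by blast
  have "compact (A ` (cball 0 (2 * r) \<times> cball 0 (2 * r)))"
    by (intro compact_continuous_image compact_Times compact_cball
        continuous_on_subset[OF mholomorphic_on_imp_continuous_on[OF A] sub])
  then obtain B where B: "B > 0" "\<And>z. z \<in> cball 0 (2 * r) \<times> cball 0 (2 * r) \<Longrightarrow> cmod (A z) \<le> B"
    using compact_imp_bounded bounded_pos by (metis imageI)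
  define L where "L = 2 * B / r"
  have "cmod (A z - A w) \<le> L * norm (z - w)"
    if zw: "z \<in> ball 0 r \<times> ball 0 r" "w \<in> ball 0 r \<times> ball 0 r" for z w
  proof -
    obtain x y x' y' where xy: "z = (x, y)" "w = (x', y')" by fastforce
    have in2: "s \<in> cball 0 (2 * r)" if "s \<in> ball 0 (2 * r)" for s :: complex using that by auto
    have in1: "y \<in> cball 0 (2 * r)" "x' \<in> cball 0 (2 * r)" using zw r by (auto simp: xy)
    have "cmod (A (x, y) - A (x', y)) \<le> B / r * cmod (x - x')"
      by (rule bounded_holomorphic_lipschitz[OF mholomorphic_on_slices(1)[OF A open_ball] r])
        (use sub in1 in2 B(2) zw in \<open>auto simp: xy\<close>)
    also have "\<dots> \<le> B / r * norm (z - w)"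
      using B(1) r norm_fst_le_norm[of "z - w"] by (intro mult_left_mono) (auto simp: xy)
    finally have 1: "cmod (A (x, y) - A (x', y)) \<le> B / r * norm (z - w)" .
    have "cmod (A (x', y) - A (x', y')) \<le> B / r * cmod (y - y')"
      by (rule bounded_holomorphic_lipschitz[OF mholomorphic_on_slices(2)[OF A open_ball] r])
        (use sub in1 in2 B(2) zw in \<open>auto simp: xy\<close>)
    also have "\<dots> \<le> B / r * norm (z - w)"
      using B(1) r norm_snd_le_norm[of "z - w"] by (intro mult_left_mono) (auto simp: xy)
    finally have 2: "cmod (A (x', y) - A (x', y')) \<le> B / r * norm (z - w)" .
    have "cmod (A z - A w) \<le> cmod (A (x, y) - A (x', y)) + cmod (A (x', y) - A (x', y'))"
      using norm_triangle_ineq[of "A (x, y) - A (x', y)" "A (x', y) - A (x', y')"] by (simp add: xy)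
    also have "\<dots> \<le> L * norm (z - w)"
      using add_mono[OF 1 2] by (simp add: L_def)
    finally show ?thesis .
  qed
  moreover have "ball 0 r \<times> ball 0 r \<subseteq> N"
    using sub r by (auto simp: subset_iff)
  ultimately show ?thesis using r B(1) by (intro exI[of _ r] exI[of _ L]) (auto simp: L_def)
qed

text \<open>The estimate makes \<open>G\<close> injective, so the image is open by invariance of domain, and it makes the
  differential injective at every point, so the inverse map is differentiable. Its differential is
  complex linear as the inverse of a complex linear map.\<close>

lemma near_identity_biholomorphic:
  fixes G :: "complex \<times> complex \<Rightarrow> complex \<times> complex"
  assumes U: "open U" and G: "G mholomorphic_on U"
    and est: "\<And>z w. z \<in> U \<Longrightarrow> w \<in> U \<Longrightarrow> norm (G z - G w - (z - w)) \<le> norm (z - w) / 2"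
  shows "open (G ` U) \<and> (\<exists>K. K mholomorphic_on (G ` U) \<and> (\<forall>z\<in>U. K (G z) = z))"
proof -
  have low: "norm (z - w) / 2 \<le> norm (G z - G w)" if "z \<in> U" "w \<in> U" for z w
    using est[OF that] norm_triangle_ineq2[of "z - w" "G z - G w"]
    by (simp add: norm_minus_commute)
  have inj: "inj_on G U"
  proof (rule inj_onI)
    fix z w assume "z \<in> U" "w \<in> U" "G z = G w"
    then show "z = w" using low[of z w] by simp
  qed
  have cont: "continuous_on U G" by (rule mholomorphic_on_imp_continuous_on[OF G])
  have op: "open (G ` U)" by (rule invariance_of_domain[OF cont U inj])
  define K where "K = inv_into U G"
  have KG: "K (G z) = z" if "z \<in> U" for z using inj that by (simp add: K_def)
  have "\<exists>M. (K has_derivative M) (at (G z)) \<and> (\<forall>c v. M (c *\<^sub>C v) = c *\<^sub>C M v)" if z: "z \<in> U" for z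
  proof -
    obtain L where L: "(G has_derivative L) (at z)" "\<And>c v. L (c *\<^sub>C v) = c *\<^sub>C L v"
      using G z unfolding mholomorphic_on_def by blast
    have lin: "linear L" using L(1) by (rule has_derivative_linear)
    have "v = 0" if Lv: "L v = 0" for v
    proof (rule ccontr)
      assume v: "v \<noteq> 0"
      obtain d where d: "d > 0" "\<And>y. norm (y - z) < d \<Longrightarrow>
          norm (G y - G z - L (y - z)) \<le> 1 / 4 * norm (y - z)"
        using L(1) unfolding has_derivative_at_alt by (metis zero_less_divide_1_iff zero_less_numeral)
      obtain d' where d': "d' > 0" "ball z d' \<subseteq> U" using U z open_contains_ball by blast
      define t where "t = min d d' / (2 * norm v)"
      have t: "t > 0" using d d' v by (simp add: t_def)
      have tv: "norm (t *\<^sub>R v) = min d d' / 2" using d d' v by (simp add: t_def)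
      have "dist z (z + t *\<^sub>R v) = norm (t *\<^sub>R v)" by (simp add: dist_norm)
      also have "\<dots> < d'" unfolding tv using d d' by linarith
      finally have y: "z + t *\<^sub>R v \<in> U" using d'(2) by auto
      have "norm (G (z + t *\<^sub>R v) - G z) \<le> 1 / 4 * norm (t *\<^sub>R v)"
        using d(2)[of "z + t *\<^sub>R v"] tv d(1) d'(1) Lv lin by (simp add: linear_cmul)
      moreover have "norm (t *\<^sub>R v) / 2 \<le> norm (G (z + t *\<^sub>R v) - G z)"
        using low[OF y z] by simp
      moreover have "norm (t *\<^sub>R v) > 0" using t v by simp
      ultimately show False by linarith
    qed
    then have injL: "inj L" using lin linear_injective_0 by blast
    then have surjL: "surj L" using lin linear_injective_imp_surjective by blast
    define M where "M = inv L"
    have LM: "L (M w) = w" for w using surjL by (simp add: M_def surj_f_inv_f)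
    have LMinv: "M (L v) = v" for v using injL by (simp add: M_def)
    have "(K has_derivative M) (at (G z))"
      by (rule has_derivative_inverse_strong[OF U z cont KG L(1)]) (auto simp: LM)
    moreover have "M (c *\<^sub>C w) = c *\<^sub>C M w" for c w
      by (metis L(2) LM LMinv)
    ultimately show ?thesis by blast
  qed
  then have "K mholomorphic_on (G ` U)" unfolding mholomorphic_on_def by blast
  with op KG show ?thesis by blast
qed

text \<open>If \<open>A\<close> is Lipschitz with \<open>A(0) = 1\<close>, then \<open>x A - x' A' - (x - x') = (x - x') (A - 1) + x' (A - A')\<close>
  is small compared with the distance of the two points near the origin.\<close>

lemma tangent_to_identity_embedding:
  fixes A B :: "complex \<times> complex \<Rightarrow> complex"
  defines "G \<equiv> (\<lambda>z. (fst z * A z, snd z * B z))"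
  assumes N: "open N" "(0, 0) \<in> N" and A: "A mholomorphic_on N" and B: "B mholomorphic_on N"
    and one: "A (0, 0) = 1" "B (0, 0) = 1" and G: "G mholomorphic_on N"
  shows "\<exists>U K. open U \<and> (0, 0) \<in> U \<and> U \<subseteq> N \<and> open (G ` U) \<and> K mholomorphic_on (G ` U) \<and>
    (\<forall>z\<in>U. K (G z) = z)"
proof -
  obtain r1 L1 where 1: "r1 > 0" "L1 > 0" "ball 0 r1 \<times> ball 0 r1 \<subseteq> N"
      "\<And>z w. z \<in> ball 0 r1 \<times> ball 0 r1 \<Longrightarrow> w \<in> ball 0 r1 \<times> ball 0 r1 \<Longrightarrow> cmod (A z - A w) \<le> L1 * norm (z - w)"
    using mholomorphic_locally_lipschitz[OF A N] by blast
  obtain r2 L2 where 2: "r2 > 0" "L2 > 0" "ball 0 r2 \<times> ball 0 r2 \<subseteq> N"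
      "\<And>z w. z \<in> ball 0 r2 \<times> ball 0 r2 \<Longrightarrow> w \<in> ball 0 r2 \<times> ball 0 r2 \<Longrightarrow> cmod (B z - B w) \<le> L2 * norm (z - w)"
    using mholomorphic_locally_lipschitz[OF B N] by blast
  define L where "L = max L1 L2"
  define r where "r = min (min r1 r2) (1 / (8 * L))"
  have L: "L > 0" "L1 \<le> L" "L2 \<le> L" using 1(2) by (auto simp: L_def)
  have r: "r > 0" "r \<le> r1" "r \<le> r2" "L * r \<le> 1 / 8"
  proof -
    have "L * r \<le> L * (1 / (8 * L))" using L(1) by (intro mult_left_mono) (auto simp: r_def)
    then show "L * r \<le> 1 / 8" using L(1) by simp
  qed (use 1(1) 2(1) L(1) in \<open>auto simp: r_def\<close>)
  define U where "U = ball (0 :: complex \<times> complex) r"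
  have Ub: "fst z \<in> ball 0 r" "snd z \<in> ball 0 r" "norm z < r" if "z \<in> U" for z
    using that norm_fst_le_norm[of z] norm_snd_le_norm[of z] by (auto simp: U_def)
  have Lip: "cmod (A z - A w) \<le> L * norm (z - w)" "cmod (B z - B w) \<le> L * norm (z - w)"
    if "z \<in> U" "w \<in> U" for z w
  proof -
    have "z \<in> ball 0 r1 \<times> ball 0 r1" "w \<in> ball 0 r1 \<times> ball 0 r1"
      "z \<in> ball 0 r2 \<times> ball 0 r2" "w \<in> ball 0 r2 \<times> ball 0 r2"
      using Ub[OF that(1)] Ub[OF that(2)] r by (auto simp: mem_Times_iff)
    then have "cmod (A z - A w) \<le> L1 * norm (z - w)" "cmod (B z - B w) \<le> L2 * norm (z - w)"
      using 1(4) 2(4) by blast+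
    moreover have "L1 * norm (z - w) \<le> L * norm (z - w)" "L2 * norm (z - w) \<le> L * norm (z - w)"
      using L by (auto intro: mult_right_mono)
    ultimately show "cmod (A z - A w) \<le> L * norm (z - w)" "cmod (B z - B w) \<le> L * norm (z - w)"
      by linarith+
  qed
  have U0: "(0, 0) \<in> U" using r by (simp add: U_def zero_prod_def[symmetric])
  have component: "cmod (p * C z - q * C w - (p - q)) \<le> norm (z - w) / 4"
    if lip: "\<And>z w. z \<in> U \<Longrightarrow> w \<in> U \<Longrightarrow> cmod (C z - C w) \<le> L * norm (z - w)" and C1: "C (0, 0) = 1"
      and zw: "z \<in> U" "w \<in> U" and pq: "cmod (p - q) \<le> norm (z - w)" "cmod q < r"
    for C :: "complex \<times> complex \<Rightarrow> complex" and z w p q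
  proof -
    have "cmod (C z - 1) \<le> L * norm z"
      using lip[OF zw(1) U0] C1 by (simp add: zero_prod_def[symmetric])
    also have "\<dots> \<le> L * r" using Ub(3)[OF zw(1)] L(1) by (intro mult_left_mono) auto
    finally have a: "cmod (C z - 1) \<le> 1 / 8" using r(4) by linarith
    have "p * C z - q * C w - (p - q) = (p - q) * (C z - 1) + q * (C z - C w)"
      by (simp add: algebra_simps)
    then have "cmod (p * C z - q * C w - (p - q)) \<le> cmod (p - q) * cmod (C z - 1) + cmod q * cmod (C z - C w)"
      by (metis norm_mult norm_triangle_ineq)
    also have "\<dots> \<le> norm (z - w) * (1 / 8) + r * (L * norm (z - w))"
      using a pq lip[OF zw] r(1) by (intro add_mono mult_mono) auto
    also have "\<dots> = (1 / 8 + L * r) * norm (z - w)" by (simp add: algebra_simps)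
    also have "\<dots> \<le> (1 / 8 + 1 / 8) * norm (z - w)"
      using r(4) by (intro mult_right_mono) auto
    finally show ?thesis by simp
  qed
  have "norm (G z - G w - (z - w)) \<le> norm (z - w) / 2" if zw: "z \<in> U" "w \<in> U" for z w
  proof -
    have "cmod (fst z * A z - fst w * A w - (fst z - fst w)) \<le> norm (z - w) / 4"
      by (rule component[OF Lip(1) one(1) zw])
        (use norm_fst_le_norm[of "z - w"] Ub(1)[OF zw(2)] in auto)
    moreover have "cmod (snd z * B z - snd w * B w - (snd z - snd w)) \<le> norm (z - w) / 4"
      by (rule component[OF Lip(2) one(2) zw])
        (use norm_snd_le_norm[of "z - w"] Ub(2)[OF zw(2)] in auto)
    moreover
    have eq: "G z - G w - (z - w) = (fst z * A z - fst w * A w - (fst z - fst w),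
        snd z * B z - snd w * B w - (snd z - snd w))"
      by (simp add: G_def prod_eq_iff)
    have "norm (G z - G w - (z - w)) \<le> cmod (fst z * A z - fst w * A w - (fst z - fst w)) +
        cmod (snd z * B z - snd w * B w - (snd z - snd w))"
      unfolding eq by (rule norm_Pair_le)
    ultimately show ?thesis by linarith
  qed
  moreover have UN: "U \<subseteq> N"
    using Ub 1(3) r(2) by (force simp: mem_Times_iff)
  moreover have "open U" by (simp add: U_def)
  ultimately have "open (G ` U) \<and> (\<exists>K. K mholomorphic_on (G ` U) \<and> (\<forall>z\<in>U. K (G z) = z))"
    using near_identity_biholomorphic mholomorphic_on_subset[OF G] by blast
  then show ?thesis using U0 UN \<open>open U\<close> by blast
qed

section \<open>Reduction to the model\<close>

context model_action
begin

text \<open>The change of variables \<open>G\<close> rescales \<open>u\<close> by \<open>1 / (1 + H)\<close> and \<open>v\<close> by \<open>1 / Q(v)\<close>, where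
  \<open>H = u \<phi>(v) / v\<^sup>k\<close>; so it adds \<open>\<phi>(v) / v\<^sup>k\<close> to \<open>1/u\<close>. The exponents \<open>p\<close>, \<open>q\<close> are what remains of
  those of \<open>u\<close> after division by \<open>v\<^sup>k\<close>, which makes \<open>H\<close> holomorphic across the axes. Working with rates
  the identity is checked at all points simultaneously, also on the axes, where \<open>u\<close> and \<open>v\<close> are
  no coordinates. The value \<open>hz\<close> is the extension of \<open>u f(v)\<close>.\<close>

lemma cderiv_normal_form:
  fixes \<phi> Q g w :: "complex \<Rightarrow> complex" and z l :: "complex \<times> complex"
    and p q k :: nat
  defines "v \<equiv> mono_v z"
    and "H \<equiv> \<lambda>z. fst z ^ p * snd z ^ q * \<phi> (mono_v z)"
  defines "G \<equiv> \<lambda>z. twist (1 + H z) (Q (mono_v z)) z"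
    and "hz \<equiv> fst z ^ p * snd z ^ q * w v"
  assumes pk: "p + n * k = a" "q + m * k = b"
    and \<phi>: "(\<phi> has_field_derivative \<phi>') (at v)" and Q: "(Q has_field_derivative Q') (at v)"
    and nz: "1 + H z \<noteq> 0" "Q v \<noteq> 0"
    and \<phi>_eq: "(of_nat m)\<^sup>2 * (v * \<phi>' - of_nat k * \<phi> v) * g v = g v * w v - v ^ k * c"
    and Q_eq: "g v * (Q v - v * Q') = \<kappa> * Q v + \<mu> * v"
  shows "cderiv G z
    (fst z * (fst l * of_nat m * mono_u z + snd l * (g v * (- (of_nat b * of_nat m) + hz))),
     snd z * (- (fst l * of_nat n * mono_u z) +
       snd l * (g v * (of_nat a * of_nat m - of_nat n / of_nat m * hz))))
    (model_field l True (G z))"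
    (is "cderiv G z (fst z * ?\<xi>, snd z * ?\<zeta>) _")
proof -
  define \<xi> \<zeta> where "\<xi> = ?\<xi>" and "\<zeta> = ?\<zeta>"
  define mon where "mon = fst z ^ p * snd z ^ q"
  define U where "U = mono_u z"
  define P where "P = 1 + H z"
  have e2: "ee * (ee * x) = x" for x by (simp flip: mult.assoc)
  have ab: "(of_nat a :: complex) = of_nat p + of_nat n * of_nat k"
    "(of_nat b :: complex) = of_nat q + of_nat m * of_nat k"
    unfolding pk[symmetric] by simp_all
  have detp: "ee = of_nat p * of_nat m - of_nat q * of_nat n"
    unfolding det_complex ab by (simp add: algebra_simps)
  have Uv: "U = mon * v ^ k"
  proof -
    have "x ^ a = x ^ p * (x ^ n) ^ k" "x ^ b = x ^ q * (x ^ m) ^ k" for x :: complex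
      unfolding pk[symmetric] by (simp_all add: power_add power_mult)
    then show ?thesis
      by (simp add: U_def mono_u_def mon_def v_def mono_v_def power_mult_distrib mult_ac)
  qed
  have Hz: "H z = mon * \<phi> v" by (simp add: H_def mon_def v_def)
  have hz: "hz = mon * w v" by (simp add: hz_def mon_def)
  \<comment> \<open>The field multiplies \<open>x\<^sup>p y\<^sup>q\<close>, respectively \<open>v\<close>, by these rates.\<close>
  have rate_p: "of_nat p * \<xi> + of_nat q * \<zeta> =
      ee * (fst l * U) + snd l * (g v * (ee * hz / of_nat m - ee * of_nat m * of_nat k))"
    unfolding \<xi>_def \<zeta>_def U_def ab detp by (simp add: field_simps)
  have rate_v: "of_nat n * \<xi> + of_nat m * \<zeta> = ee * of_nat m * (snd l * g v)"
    unfolding \<xi>_def \<zeta>_def det_complex by (simp add: field_simps)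
  have f: "cderiv (\<lambda>z. fst z) z (fst z * \<xi>, snd z * \<zeta>) (fst z * \<xi>)"
    "cderiv (\<lambda>z. snd z) z (fst z * \<xi>, snd z * \<zeta>) (snd z * \<zeta>)"
    using cderiv_fst_snd[of z "(fst z * \<xi>, snd z * \<zeta>)"] by simp_all
  have dv: "cderiv mono_v z (fst z * \<xi>, snd z * \<zeta>) (v * (of_nat n * \<xi> + of_nat m * \<zeta>))"
    unfolding v_def by (rule cderiv_mono_v)
  have "cderiv H z (fst z * \<xi>, snd z * \<zeta>)
    (fst z ^ p * snd z ^ q * (\<phi>' * (v * (of_nat n * \<xi> + of_nat m * \<zeta>))) +
      fst z ^ p * snd z ^ q * (of_nat p * \<xi> + of_nat q * \<zeta>) * \<phi> (mono_v z))"
    unfolding H_def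
    by (intro cderiv_mult cderiv_log_mult cderiv_log_power f
        cderiv_field_compose[OF dv \<phi>[unfolded v_def]])
  then have dH: "cderiv H z (fst z * \<xi>, snd z * \<zeta>)
    (mon * (\<phi>' * (v * (of_nat n * \<xi> + of_nat m * \<zeta>))) + mon * (of_nat p * \<xi> + of_nat q * \<zeta>) * \<phi> v)"
    by (simp add: mon_def v_def)
  have "mon * (\<phi>' * (v * (of_nat n * \<xi> + of_nat m * \<zeta>))) + mon * (of_nat p * \<xi> + of_nat q * \<zeta>) * \<phi> v =
      ee * (fst l * U) * H z + snd l * ee / of_nat m * (g v * hz * H z +
        mon * ((of_nat m)\<^sup>2 * (v * \<phi>' - of_nat k * \<phi> v) * g v))"
    unfolding rate_p rate_v Hz by (simp add: field_simps power2_eq_square)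
  also have "\<dots> = P * (ee * (fst l * (U - U / P) + snd l / of_nat m * (g v * hz - c * (U / P))))"
  proof -
    \<comment> \<open>The equation for \<open>\<phi>\<close> enters here, multiplied by \<open>x\<^sup>p y\<^sup>q\<close>.\<close>
    have eq: "mon * ((of_nat m)\<^sup>2 * (v * \<phi>' - of_nat k * \<phi> v) * g v) = g v * hz - c * U"
      unfolding \<phi>_eq Uv hz by (simp add: algebra_simps)
    have "P * (U / P) = U" using nz(1) by (simp add: P_def)
    moreover have "P * (ee * (fst l * (U - X) + snd l / of_nat m * (g v * hz - c * X))) =
        ee * (fst l * (P * U - P * X)) + snd l * ee / of_nat m * (P * (g v * hz) - c * (P * X))" for X
      by (simp add: algebra_simps)
    ultimately have "P * (ee * (fst l * (U - U / P) + snd l / of_nat m * (g v * hz - c * (U / P)))) =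
        ee * (fst l * (P * U - U)) + snd l * ee / of_nat m * (P * (g v * hz) - c * U)"
      by (simp only:)
    then show ?thesis unfolding eq by (simp add: P_def algebra_simps)
  qed
  finally have "cderiv H z (fst z * \<xi>, snd z * \<zeta>)
    (P * (ee * (fst l * (U - U / P) + snd l / of_nat m * (g v * hz - c * (U / P)))))"
    using dH by simp
  from cderiv_add[OF cderiv_const[of 1] this]
  have dP: "cderiv (\<lambda>z. 1 + H z) z (fst z * \<xi>, snd z * \<zeta>)
    ((1 + H z) * (ee * (fst l * (U - U / P) + snd l / of_nat m * (g v * hz - c * (U / P)))))"
    by (simp add: P_def)
  have "Q' * (v * (of_nat n * \<xi> + of_nat m * \<zeta>)) =
      ee * of_nat m * snd l * (g v * Q v - g v * (Q v - v * Q'))"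
    unfolding rate_v by (simp add: algebra_simps)
  also have "\<dots> = Q v * (ee * (of_nat m * snd l * (g v - (\<kappa> + \<mu> * (v / Q v)))))"
    unfolding Q_eq using nz(2) by (simp add: field_simps)
  finally have dQ: "cderiv (\<lambda>z. Q (mono_v z)) z (fst z * \<xi>, snd z * \<zeta>)
    (Q (mono_v z) * (ee * (of_nat m * snd l * (g v - (\<kappa> + \<mu> * (v / Q v))))))"
    using cderiv_field_compose[OF dv Q[unfolded v_def]] by (simp add: v_def)
  have nz': "1 + H z \<noteq> 0" "Q (mono_v z) \<noteq> 0" using nz by (simp_all add: v_def)
  have Gu: "mono_u (G z) = U / P" and Gv: "mono_v (G z) = v / Q v"
    unfolding G_def using nz' by (simp_all add: mono_u_twist mono_v_twist U_def P_def v_def)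
  have 1: "\<xi> - ee * of_nat m * (ee * (fst l * (U - U / P) + snd l / of_nat m * (g v * hz - c * (U / P)))) +
      ee * of_nat b * (ee * (of_nat m * snd l * (g v - (\<kappa> + \<mu> * (v / Q v))))) = model_xi l (G z)"
  proof -
    have "ee * of_nat m * (ee * x) = of_nat m * x" "ee * of_nat b * (ee * x) = of_nat b * x" for x
      using e2 by (simp_all add: mult.left_commute)
    moreover have "of_nat m * (fst l * (U - U / P) + snd l / of_nat m * (g v * hz - c * (U / P))) =
        of_nat m * fst l * (U - U / P) + snd l * (g v * hz - c * (U / P))"
      by (simp add: distrib_left)
    ultimately show ?thesis
      unfolding model_xi_def Gu Gv \<xi>_def U_def[symmetric]
      by (simp add: algebra_simps e2)
  qed
  have 2: "\<zeta> + ee * of_nat n * (ee * (fst l * (U - U / P) + snd l / of_nat m * (g v * hz - c * (U / P)))) -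
      ee * of_nat a * (ee * (of_nat m * snd l * (g v - (\<kappa> + \<mu> * (v / Q v))))) = model_zeta l (G z)"
  proof -
    have "ee * of_nat n * (ee * x) = of_nat n * x" "ee * of_nat a * (ee * x) = of_nat a * x" for x
      using e2 by (simp_all add: mult.left_commute)
    then show ?thesis
      unfolding model_zeta_def Gu Gv \<zeta>_def U_def[symmetric]
      by (simp add: algebra_simps e2)
  qed
  have Geq: "(\<lambda>z. twist (1 + H z) (Q (mono_v z)) z) = G" by (simp add: G_def)
  show ?thesis
    using cderiv_twist[OF dP dQ cderiv_ident nz']
    unfolding Geq fun_cong[OF Geq] 1 2 \<xi>_def[symmetric] \<zeta>_def[symmetric] by simp
qed

text \<open>The model surface with its two fields realizes every pair of fields that a biholomorphism onto an
  open subset of the \<open>(x, y)\<close>-plane carries to the model fields.\<close>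

lemma realization:
  fixes G K X Y :: "complex \<times> complex \<Rightarrow> complex \<times> complex"
  assumes U: "open U" "(0, 0) \<in> U"
    and G: "G mholomorphic_on U" "open (G ` U)"
    and K: "K mholomorphic_on (G ` U)" "\<And>z. z \<in> U \<Longrightarrow> K (G z) = z"
    and X: "\<And>z. z \<in> U \<Longrightarrow> cderiv G z (X z) (model_field (1, 0) True (G z))"
    and Y: "\<And>z. z \<in> U \<Longrightarrow> cderiv G z (Y z) (model_field (0, 1) True (G z))"
  shows "\<exists>(T :: surface_point topology) A V W \<psi>.
    complex_surface T A \<and> Hausdorff_space T \<and> \<not> compact_space T \<and>
    holomorphic_vector_field A V \<and> holomorphic_vector_field A W \<and>
    commuting_fields A V W \<and>
    complete_vector_field T A V \<and> complete_vector_field T A W \<and>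
    (\<exists>\<Phi> :: complex \<times> complex \<Rightarrow> surface_point \<Rightarrow> surface_point.
       holomorphic_action T A \<Phi> \<and>
       generated_by T A (\<lambda>s. \<Phi> (s, 0)) V \<and> generated_by T A (\<lambda>t. \<Phi> (0, t)) W) \<and>
    openin T (\<psi> ` U) \<and>
    biholomorphic_map (top_of_set U) (flat_atlas U)
      (subtopology T (\<psi> ` U)) (restrict_atlas (\<psi> ` U) A) \<psi> \<and>
    differential_sends (flat_atlas U) A \<psi> (\<lambda>c. X) V \<and>
    differential_sends (flat_atlas U) A \<psi> (\<lambda>c. Y) W"
proof -
  let ?V = "chartwise_field (model_field (1, 0))" and ?W = "chartwise_field (model_field (0, 1))"
  have gen: "generated_by glued_top param_atlas (\<lambda>s. model_flow (s, 0)) ?V"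
    "generated_by glued_top param_atlas (\<lambda>t. model_flow (0, t)) ?W"
    using generated_by_model_flow[of "(1, 0)"] generated_by_model_flow[of "(0, 1)"] by simp_all
  have id: "(\<lambda>t. t) mholomorphic_on S" for S :: "(complex \<times> complex) set"
    by (rule mholomorphic_onI) (rule cderiv_ident)
  have act: "holomorphic_action glued_top param_atlas model_flow"
    using holomorphic_action_model_flow[OF id] by simp
  have "(\<lambda>s. (s, 0 :: complex)) mholomorphic_on S" "(\<lambda>s. (0 :: complex, s)) mholomorphic_on S"
    for S :: "complex set"
    by (rule mholomorphic_onI, rule cderiv_Pair[OF cderiv_ident cderiv_const],
        rule mholomorphic_onI, rule cderiv_Pair[OF cderiv_const cderiv_ident])
  then have "holomorphic_action glued_top param_atlas (\<lambda>s :: complex. model_flow (s, 0))"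
    "holomorphic_action glued_top param_atlas (\<lambda>s :: complex. model_flow (0, s))"
    by (auto intro!: holomorphic_action_model_flow simp: zero_prod_def)
  then have "complete_vector_field glued_top param_atlas ?V" "complete_vector_field glued_top param_atlas ?W"
    unfolding complete_vector_field_def using gen by blast+
  moreover note embedding_biholomorphic[OF U(1) G K, of True]
  moreover have "differential_sends (flat_atlas U) param_atlas (\<lambda>z. par True (G z)) (\<lambda>c. X) ?V"
    by (rule embedding_differential_sends[OF U(1) field_compatible_model X])
  moreover have "differential_sends (flat_atlas U) param_atlas (\<lambda>z. par True (G z)) (\<lambda>c. Y) ?W"
    by (rule embedding_differential_sends[OF U(1) field_compatible_model Y])
  ultimately show ?thesis
    using complex_surface_glued_top Hausdorff_glued_top noncompact_glued_top holomorphic_model_field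
      commuting_model_fields act gen
    by (intro exI[of _ glued_top] exI[of _ param_atlas] exI[of _ ?V] exI[of _ ?W]
        exI[of _ "\<lambda>z. par True (G z)"] exI[of _ model_flow] conjI) simp_all
qed

end

context monomial_coordinates
begin

text \<open>The monomial \<open>u = x\<^sup>a y\<^sup>b\<close> compensates the pole of \<open>f(x\<^sup>n y\<^sup>m)\<close> in each variable separately: one
  variable is frozen at a small non-zero value and the other tends to \<open>0\<close>.\<close>

lemma pole_order_bounds:
  assumes N: "open N" "(0, 0) \<in> N" and h: "continuous_on N h"
    and w: "isCont w 0" "w 0 \<noteq> 0" and r: "r > 0" and fw: "\<And>v. v \<in> ball 0 r - {0} \<Longrightarrow> f v * v ^ k = w v"
    and hf: "\<And>z. z \<in> N \<Longrightarrow> z \<in> torus \<Longrightarrow> h z = mono_u z * f (mono_v z)"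
  shows "n * k \<le> a \<and> m * k \<le> b"
proof -
  obtain A B where AB: "open A" "open B" "(0, 0) \<in> A \<times> B" "A \<times> B \<subseteq> N"
    using N by (rule open_prod_elim)
  then have "open (A \<inter> B)" "0 \<in> A \<inter> B" by auto
  then obtain d where d: "d > 0" "ball 0 d \<subseteq> A \<inter> B" using open_contains_ball by blast
  define y where "y = complex_of_real (d / 2)"
  have y: "y \<noteq> 0" "y \<in> ball 0 d" using d(1) by (simp_all add: y_def)
  have small: "\<forall>\<^sub>F x in at 0. x \<in> ball 0 d \<and> x \<noteq> 0 \<and> x ^ i * y ^ j \<in> ball 0 r" if "i > 0" for i j
  proof -
    have "((\<lambda>x. x ^ i * y ^ j) \<longlongrightarrow> 0 ^ i * y ^ j) (at 0)" by (intro tendsto_intros)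
    then have "((\<lambda>x. x ^ i * y ^ j) \<longlongrightarrow> 0) (at 0)"
      by (simp only: zero_power[OF that] mult_zero_left)
    then have "\<forall>\<^sub>F x in at 0. x ^ i * y ^ j \<in> ball 0 r"
      using r by (intro topological_tendstoD) auto
    moreover have "\<forall>\<^sub>F x in at (0::complex). x \<in> ball 0 d - {0}"
      using d(1) by (intro eventually_at_in_open) auto
    ultimately show ?thesis by eventually_elim auto
  qed
  have contw: "isCont (\<lambda>x. y ^ l * w (x ^ i * y ^ j)) 0" if "i > 0" for i j l
  proof -
    have "isCont (\<lambda>x. x ^ i * y ^ j) 0" by (intro continuous_intros)
    moreover have "isCont w (0 ^ i * y ^ j)"
      using w(1) by (simp only: zero_power[OF that] mult_zero_left)
    ultimately have "isCont (\<lambda>x. w (x ^ i * y ^ j)) 0" by (rule isCont_o2)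
    then show ?thesis by (rule isCont_mult[OF continuous_const])
  qed
  have inN: "(x, y) \<in> N" "(y, x) \<in> N" if "x \<in> ball 0 d" for x
    using that y(2) d(2) AB(4) by blast+
  have hc: "isCont h z" if "z \<in> N" for z
    using h N(1) that by (simp add: continuous_on_eq_continuous_at)
  have "n * k \<le> a"
  proof (rule vanishing_order_bound)
    show "isCont (\<lambda>x. h (x, y) * y ^ (m * k)) 0"
    proof -
      have "isCont (\<lambda>x. (x, y)) 0" by (intro continuous_intros)
      moreover have "isCont h (0, y)" using hc[OF inN(1)[of 0]] d(1) by simp
      ultimately have "isCont (\<lambda>x. h (x, y)) 0" by (rule isCont_o2)
      then show ?thesis by (rule isCont_mult[OF _ continuous_const])
    qed
    show "isCont (\<lambda>x. y ^ b * w (x ^ n * y ^ m)) 0" by (rule contw[OF n_pos])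
    show "y ^ b * w (0 ^ n * y ^ m) \<noteq> 0" using y w(2) n_pos by (simp add: zero_power)
    show "\<forall>\<^sub>F x in at 0. h (x, y) * y ^ (m * k) * x ^ (n * k) = x ^ a * (y ^ b * w (x ^ n * y ^ m))"
      using small[OF n_pos, of m]
    proof eventually_elim
      case (elim x)
      then have "(x, y) \<in> torus" "x ^ n * y ^ m \<in> ball 0 r - {0}" using y by (auto simp: torus_def)
      then have "h (x, y) = x ^ a * y ^ b * f (x ^ n * y ^ m)" "f (x ^ n * y ^ m) * (x ^ n * y ^ m) ^ k = w (x ^ n * y ^ m)"
        using hf[OF inN(1)] fw elim by (auto simp: mono_u_def mono_v_def)
      then show ?case by (simp add: power_mult power_mult_distrib flip: \<open>f (x ^ n * y ^ m) * (x ^ n * y ^ m) ^ k = w (x ^ n * y ^ m)\<close>)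
    qed
  qed
  moreover have "m * k \<le> b"
  proof (rule vanishing_order_bound)
    show "isCont (\<lambda>x. h (y, x) * y ^ (n * k)) 0"
    proof -
      have "isCont (\<lambda>x. (y, x)) 0" by (intro continuous_intros)
      moreover have "isCont h (y, 0)" using hc[OF inN(2)[of 0]] d(1) by simp
      ultimately have "isCont (\<lambda>x. h (y, x)) 0" by (rule isCont_o2)
      then show ?thesis by (rule isCont_mult[OF _ continuous_const])
    qed
    show "isCont (\<lambda>x. y ^ a * w (x ^ m * y ^ n)) 0" by (rule contw[OF m_pos])
    show "y ^ a * w (0 ^ m * y ^ n) \<noteq> 0" using y w(2) m_pos by (simp add: zero_power)
    show "\<forall>\<^sub>F x in at 0. h (y, x) * y ^ (n * k) * x ^ (m * k) = x ^ b * (y ^ a * w (x ^ m * y ^ n))"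
      using small[OF m_pos, of n]
    proof eventually_elim
      case (elim x)
      then have "(y, x) \<in> torus" "x ^ m * y ^ n \<in> ball 0 r - {0}" using y by (auto simp: torus_def)
      then have "h (y, x) = y ^ a * x ^ b * f (x ^ m * y ^ n)" "f (x ^ m * y ^ n) * (x ^ m * y ^ n) ^ k = w (x ^ m * y ^ n)"
        using hf[OF inN(2)] fw elim by (auto simp: mono_u_def mono_v_def mult.commute)
      then show ?case by (simp add: power_mult power_mult_distrib flip: \<open>f (x ^ m * y ^ n) * (x ^ m * y ^ n) ^ k = w (x ^ m * y ^ n)\<close>)
    qed
  qed
  ultimately show ?thesis ..
qed

end

text \<open>The torus is dense; the diagonal through \<open>z\<close> meets its complement in at most two points.\<close>

lemma continuous_eq_from_torus:
  fixes F G :: "complex \<times> complex \<Rightarrow> complex"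
  assumes N: "open N" and F: "continuous_on N F" and G: "continuous_on N G"
    and eq: "\<And>z. z \<in> N \<Longrightarrow> z \<in> torus \<Longrightarrow> F z = G z" and z: "z \<in> N"
  shows "F z = G z"
proof -
  have "((\<lambda>s. z + (s, s)) \<longlongrightarrow> z + (0, 0)) (at 0)" by (intro tendsto_intros)
  then have lim: "((\<lambda>s. z + (s, s)) \<longlongrightarrow> z) (at 0)" by (simp add: zero_prod_def[symmetric])
  have inN: "\<forall>\<^sub>F s in at 0. z + (s, s) \<in> N" by (rule topological_tendstoD[OF lim N z])
  have cont: "isCont F z" "isCont G z"
    using F G N z by (simp_all add: continuous_on_eq_continuous_at)
  have Glim: "(\<lambda>s. G (z + (s, s))) \<midarrow>0\<rightarrow> G z"
    by (rule isCont_tendsto_compose[OF cont(2) lim])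
  have "(\<lambda>s. F (z + (s, s))) \<midarrow>0\<rightarrow> F z"
    by (rule isCont_tendsto_compose[OF cont(1) lim])
  moreover have "\<forall>\<^sub>F s in at 0. F (z + (s, s)) = G (z + (s, s))"
    using inN eventually_neq_at_within[of "- fst z" 0 UNIV] eventually_neq_at_within[of "- snd z" 0 UNIV]
  proof eventually_elim
    case (elim s)
    then have "z + (s, s) \<in> torus" by (simp add: torus_def add_eq_0_iff)
    then show ?case using eq elim by blast
  qed
  ultimately have "(\<lambda>s. G (z + (s, s))) \<midarrow>0\<rightarrow> F z" by (rule Lim_transform_eventually)
  with Glim show ?thesis by (rule LIM_unique[symmetric])
qed

theorem theoremA:
  fixes a b m n :: nat
    and f g :: "complex \<Rightarrow> complex"
    and h :: "complex \<times> complex \<Rightarrow> complex"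
    and D :: "complex set"
    and N :: "(complex \<times> complex) set"
  assumes "a > 0" "b > 0" "m > 0" "n > 0"
    and "int a * int m - int b * int n \<in> {-1, 1}"
    and "open D" "0 \<in> D"
    and "g holomorphic_on D"
    and "f meromorphic_on D" "f holomorphic_on D - {0}"
    and "open N" "(0, 0) \<in> N"
    and "\<And>x y. (x, y) \<in> N \<Longrightarrow> x ^ n * y ^ m \<in> D"
    and "h mholomorphic_on N"
    and "\<And>x y. (x, y) \<in> N \<Longrightarrow> x \<noteq> 0 \<Longrightarrow> y \<noteq> 0 \<Longrightarrow>
           h (x, y) = x ^ a * y ^ b * f (x ^ n * y ^ m)"
    and "order_at_origin h \<ge> 1"
    and "g 0 \<noteq> 0 \<or>
         (g 0 = 0 \<and> (deriv ^^ 2) g 0 = 0 \<and> fls_nth (laurent_expansion f 0) 0 = 0 \<and>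
          deriv g 0 \<noteq> 0)"
  shows "\<exists>U (T :: surface_point topology) A V W \<psi>.
    open U \<and> (0, 0) \<in> U \<and> U \<subseteq> N \<and>
    complex_surface T A \<and> Hausdorff_space T \<and> \<not> compact_space T \<and>
    holomorphic_vector_field A V \<and> holomorphic_vector_field A W \<and>
    commuting_fields A V W \<and>
    complete_vector_field T A V \<and> complete_vector_field T A W \<and>
    (\<exists>\<Phi> :: complex \<times> complex \<Rightarrow> surface_point \<Rightarrow> surface_point.
       holomorphic_action T A \<Phi> \<and>
       generated_by T A (\<lambda>s. \<Phi> (s, 0)) V \<and> generated_by T A (\<lambda>t. \<Phi> (0, t)) W) \<and>
    openin T (\<psi> ` U) \<and>
    biholomorphic_map (top_of_set U) (flat_atlas U)
      (subtopology T (\<psi> ` U)) (restrict_atlas (\<psi> ` U) A) \<psi> \<and>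
    differential_sends (flat_atlas U) A \<psi> (\<lambda>c. field_X a b m n) V \<and>
    differential_sends (flat_atlas U) A \<psi> (\<lambda>c. field_Y a b m n g h) W"
proof -
  define e where "e = int a * int m - int b * int n"
  interpret monomial_coordinates a b m n e
    by unfold_locales (use assms(1-5) in \<open>simp_all add: e_def\<close>)
  obtain k w W r where r: "0 < r" "ball 0 r \<subseteq> D" and w: "w holomorphic_on ball 0 r"
    and W: "w has_fps_expansion W" "fps_nth W k = fls_nth (laurent_expansion f 0) 0"
    and k: "k = 0 \<or> w 0 \<noteq> 0" and fw: "\<And>v. v \<in> ball 0 r - {0} \<Longrightarrow> f v * v ^ k = w v"
    using laurent_pole_factor[OF assms(6,7,9,10)] by blast
  have g: "g holomorphic_on ball 0 r" using assms(8) r(2) by (rule holomorphic_on_subset)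
  have hc: "continuous_on N h" by (rule mholomorphic_on_imp_continuous_on[OF assms(14)])
  have hf: "h z = mono_u z * f (mono_v z)" if "z \<in> N" "z \<in> torus" for z
    using assms(15)[of "fst z" "snd z"] that by (simp add: mono_u_def mono_v_def torus_def)
  have "n * k \<le> a \<and> m * k \<le> b"
  proof (cases "k = 0")
    case False
    with k have "w 0 \<noteq> 0" by blast
    from pole_order_bounds[OF assms(11,12) hc holomorphic_on_ball_isCont[OF w r(1)] this r(1) fw hf]
    show ?thesis by blast
  qed simp
  then obtain p q where pq: "p + n * k = a" "q + m * k = b"
    by (metis le_add_diff_inverse2)
  \<comment> \<open>Otherwise \<open>(a, b)\<close> would be a multiple of \<open>(n, m)\<close> and the determinant would vanish. Together
    with \<open>Q(0) = 1\<close> this makes the change of variables tangent to the identity.\<close>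
  have pq_pos: "p > 0 \<or> q > 0"
  proof (rule ccontr)
    assume "\<not> (p > 0 \<or> q > 0)"
    then have "e = 0" using pq by (simp add: e_def flip: pq)
    then show False using e_unit by simp
  qed
  have "\<exists>s \<phi> Q \<kappa> \<mu>. 0 < s \<and> s \<le> r \<and> \<phi> holomorphic_on ball 0 s \<and> Q holomorphic_on ball 0 s \<and>
    \<kappa> * \<mu> = 0 \<and> Q 0 = 1 \<and>
    (\<forall>v\<in>ball 0 s. (of_nat m)\<^sup>2 * (v * deriv \<phi> v - of_nat k * \<phi> v) * g v =
        g v * w v - v ^ k * (g 0 * fps_nth W k) \<and>
      g v * (Q v - v * deriv Q v) = \<kappa> * Q v + \<mu> * v)"
    by (rule normalizing_functions[OF g w r(1) W(1)]) (use assms(3,17) W(2) in auto)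
  then obtain s \<phi> Q \<kappa> \<mu> where s: "0 < s" "s \<le> r"
    and \<phi>: "\<phi> holomorphic_on ball 0 s" and Q: "Q holomorphic_on ball 0 s"
    and \<kappa>\<mu>: "\<kappa> * \<mu> = 0" and Q0: "Q 0 = 1"
    and \<phi>_eq: "\<And>v. v \<in> ball 0 s \<Longrightarrow> (of_nat m)\<^sup>2 * (v * deriv \<phi> v - of_nat k * \<phi> v) * g v =
        g v * w v - v ^ k * (g 0 * fps_nth W k)"
    and Q_eq: "\<And>v. v \<in> ball 0 s \<Longrightarrow> g v * (Q v - v * deriv Q v) = \<kappa> * Q v + \<mu> * v"
    by blast
  interpret model_action a b m n e "g 0 * fps_nth W k" \<kappa> \<mu>
    by unfold_locales (rule \<kappa>\<mu>)
  define N0 where "N0 = N \<inter> mono_v -` ball 0 s"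
  have N0: "open N0" "(0, 0) \<in> N0"
    using continuous_open_preimage[OF continuous_mono(2) assms(11) open_ball] assms(4,12) s(1)
    by (simp_all add: N0_def mono_v_def zero_power)
  have v_in: "mono_v z \<in> ball 0 s" if "z \<in> N0" for z using that by (simp add: N0_def)
  have h_eq: "h z = fst z ^ p * snd z ^ q * w (mono_v z)" if z: "z \<in> N0" for z
  proof (rule continuous_eq_from_torus[OF N0(1) _ _ _ z])
    show "continuous_on N0 h" using hc by (rule continuous_on_subset) (simp add: N0_def)
    have "continuous_on N0 (\<lambda>z. w (mono_v z))"
      by (rule continuous_on_compose2[OF holomorphic_on_imp_continuous_on[OF w] continuous_mono(2)])
        (use v_in s(2) in fastforce)
    then show "continuous_on N0 (\<lambda>z. fst z ^ p * snd z ^ q * w (mono_v z))"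
      by (intro continuous_intros)
    fix z assume z: "z \<in> N0" "z \<in> torus"
    have "x ^ a = x ^ p * (x ^ n) ^ k" "x ^ b = x ^ q * (x ^ m) ^ k" for x :: complex
      unfolding pq[symmetric] by (simp_all add: power_add power_mult)
    then have "mono_u z = fst z ^ p * snd z ^ q * mono_v z ^ k"
      by (simp add: mono_u_def mono_v_def power_mult_distrib mult_ac)
    moreover have "mono_v z \<in> ball 0 r - {0}"
      using v_in[OF z(1)] s(2) mono_nonzero(2)[OF z(2)] by auto
    ultimately show "h z = fst z ^ p * snd z ^ q * w (mono_v z)"
      using hf[of z] fw[of "mono_v z"] z by (simp add: N0_def mult_ac)
  qed
  define H where "H = (\<lambda>z. fst z ^ p * snd z ^ q * \<phi> (mono_v z))"
  have \<phi>': "(\<phi> has_field_derivative deriv \<phi> (mono_v z)) (at (mono_v z))"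
    and Q': "(Q has_field_derivative deriv Q (mono_v z)) (at (mono_v z))" if "z \<in> N0" for z
    using holomorphic_derivI[OF \<phi> open_ball v_in[OF that]]
      holomorphic_derivI[OF Q open_ball v_in[OF that]] by blast+
  have dQ: "cderiv (\<lambda>z. Q (mono_v z)) z 0 0" if "z \<in> N0" for z
    using cderiv_field_compose[OF cderiv_mono_zero(2) Q'[OF that]] by simp
  have dH: "cderiv H z 0 0" if z: "z \<in> N0" for z
  proof -
    have f: "cderiv (\<lambda>z. fst z) z 0 (fst z * 0)" "cderiv (\<lambda>z. snd z) z 0 (snd z * 0)"
      using cderiv_fst_snd[of z 0] by simp_all
    have "cderiv H z 0 (fst z ^ p * snd z ^ q * (deriv \<phi> (mono_v z) * 0) +
        fst z ^ p * snd z ^ q * (of_nat p * 0 + of_nat q * 0) * \<phi> (mono_v z))"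
      unfolding H_def
      by (intro cderiv_mult cderiv_log_mult cderiv_log_power f
          cderiv_field_compose[OF cderiv_mono_zero(2) \<phi>'[OF z]])
    then show ?thesis by simp
  qed
  \<comment> \<open>On this neighbourhood the change of variables is defined.\<close>
  define N1 where "N1 = (N0 \<inter> (\<lambda>z. 1 + H z) -` (- {0})) \<inter> (N0 \<inter> (\<lambda>z. Q (mono_v z)) -` (- {0}))"
  have "H mholomorphic_on N0" "(\<lambda>z. Q (mono_v z)) mholomorphic_on N0"
    using dH dQ unfolding mholomorphic_on_iff_cderiv_zero by blast+
  then have cont: "continuous_on N0 H" "continuous_on N0 (\<lambda>z. Q (mono_v z))"
    by (simp_all add: mholomorphic_on_imp_continuous_on)
  have "continuous_on N0 (\<lambda>z. 1 + H z)" by (intro continuous_on_add continuous_on_const cont)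
  then have "open N1"
    unfolding N1_def by (intro open_Int continuous_open_preimage N0(1) cont) auto
  have H0: "H (0, 0) = 0" using pq_pos by (auto simp: H_def)
  have v0: "mono_v (0, 0) = 0" using n_pos by (simp add: mono_v_def zero_power)
  have "(0, 0) \<in> N1" using N0(2) H0 v0 Q0 by (simp add: N1_def)
  have N1: "z \<in> N0" "1 + H z \<noteq> 0" "Q (mono_v z) \<noteq> 0" if "z \<in> N1" for z
    using that by (auto simp: N1_def)
  define G where "G = (\<lambda>z. twist (1 + H z) (Q (mono_v z)) z)"
  have dG: "cderiv G z
      (fst z * (fst l * of_nat m * mono_u z + snd l * (g (mono_v z) * (- (of_nat b * of_nat m) + h z))),
       snd z * (- (fst l * of_nat n * mono_u z) +
         snd l * (g (mono_v z) * (of_nat a * of_nat m - of_nat n / of_nat m * h z))))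
      (model_field l True (G z))" if z: "z \<in> N1" for z l
    unfolding h_eq[OF N1(1)[OF z]] G_def H_def
    by (rule cderiv_normal_form[where \<phi> = \<phi> and Q = Q and g = g and w = w and z = z and l = l
          and p = p and q = q and k = k, OF pq \<phi>'[OF N1(1)[OF z]] Q'[OF N1(1)[OF z]]
          N1(2)[OF z, unfolded H_def] N1(3)[OF z]
          \<phi>_eq[OF v_in[OF N1(1)[OF z]]] Q_eq[OF v_in[OF N1(1)[OF z]]]])
  have G: "G mholomorphic_on N1" by (rule mholomorphic_onI[OF dG])
  define A where "A i j = (\<lambda>z. (1 + H z) powi i * Q (mono_v z) powi j)" for i j
  have A: "A i j mholomorphic_on N1" for i j
    unfolding mholomorphic_on_iff_cderiv_zero
  proof
    fix z assume z: "z \<in> N1"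
    have "cderiv (\<lambda>z. 1 + H z) z 0 ((1 + H z) * 0)"
      using cderiv_add[OF cderiv_const dH[OF N1(1)[OF z]], of 1] by simp
    moreover have "cderiv (\<lambda>z. Q (mono_v z)) z 0 (Q (mono_v z) * 0)"
      using dQ[OF N1(1)[OF z]] by simp
    ultimately have "cderiv (A i j) z 0
        ((1 + H z) powi i * Q (mono_v z) powi j * (of_int i * 0 + of_int j * 0))"
      unfolding A_def by (intro cderiv_log_mult cderiv_log_power_int N1[OF z])
    then show "cderiv (A i j) z 0 0" by simp
  qed
  have A0: "A i j (0, 0) = 1" for i j by (simp add: A_def H0 v0 Q0)
  have G_eq: "G = (\<lambda>z. (fst z * A (- (e * int m)) (e * int b) z, snd z * A (e * int n) (- (e * int a)) z))"
    by (rule ext) (simp add: G_def twist_def A_def mult.assoc)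
  have "\<exists>U K. open U \<and> (0, 0) \<in> U \<and> U \<subseteq> N1 \<and> open (G ` U) \<and> K mholomorphic_on (G ` U) \<and>
      (\<forall>z\<in>U. K (G z) = z)"
    using tangent_to_identity_embedding[OF \<open>open N1\<close> \<open>(0, 0) \<in> N1\<close>
        A[of "- (e * int m)" "e * int b"] A[of "e * int n" "- (e * int a)"] A0 A0] G
    unfolding G_eq by blast
  then obtain U K where U: "open U" "(0, 0) \<in> U" "U \<subseteq> N1" and GU: "open (G ` U)"
    and K: "K mholomorphic_on (G ` U)" "\<And>z. z \<in> U \<Longrightarrow> K (G z) = z"
    by (elim exE conjE) blast
  have X: "cderiv G z (field_X a b m n z) (model_field (1, 0) True (G z))" if "z \<in> U" for z
  proof -
    have "z \<in> N1" using that U(3) by blast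
    moreover have "field_X a b m n z = (fst z * (of_nat m * mono_u z), snd z * (- (of_nat n * mono_u z)))"
      by (cases z) (simp add: field_X_def mono_u_def)
    ultimately show ?thesis using dG[of z "(1, 0)"] by simp
  qed
  have Y: "cderiv G z (field_Y a b m n g h z) (model_field (0, 1) True (G z))" if "z \<in> U" for z
  proof -
    have "z \<in> N1" using that U(3) by blast
    moreover have "field_Y a b m n g h z = (fst z * (g (mono_v z) * (- (of_nat b * of_nat m) + h z)),
        snd z * (g (mono_v z) * (of_nat a * of_nat m - of_nat n / of_nat m * h z)))"
      by (cases z) (simp add: field_Y_def mono_v_def mult_ac)
    ultimately show ?thesis using dG[of z "(0, 1)"] by simp
  qed
  have "U \<subseteq> N" using U(3) by (auto simp: N1_def N0_def)
  moreover note realization[OF U(1,2) mholomorphic_on_subset[OF G U(3)] GU K X Y]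
  ultimately show ?thesis using U(1,2) by blast
qed

end
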